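(* Let $S\in\mathbb{R}^{K\times K}$ be an irreducible matrix with non-negative entries that has support, let $\sigma$ be the associated self-consistent density of states, and let $$\kappa:=\min_{\gamma}\frac{\langle\gamma\rangle}{|\gamma|}\in(0,1],$$ where the minimum is taken over all cycles $\gamma$ in the edge-labeled directed graph on $\{1,\dots,L\}$ with edges of types $\lhd$ and $\prec$ associated with a normal form of $S$, $|\gamma|$ is the total number of edges of $\gamma$ and $\langle\gamma\rangle$ is its number of $\prec$-edges. Then $$\lim_{z\to 0}\frac{\log\sigma(z)}{\log|z|}=-2+2\kappa .$$
   Context: Vectors in $\mathbb{C}^K$ form an algebra with entrywise operations (products, quotients, functions of vectors are entrywise; scalars are identified with constant vectors), and $\langle x\rangle:=\frac1K\sum_{i=1}^K x_i$ for $x \in \mathbb{C}^K$. Support: a non-negative $K\times K$ matrix $R=(r_{ij})$ has support if there is a permutation $\pi$ of $\{1,\dots,K\}$ with $r_{i\pi(i)}>0$ for all $i$. Self-consistent density of states: for $\eta,\tau>0$ let $v=v(\tau,\eta)\in(0,\infty)^K$ and $w=w(\tau,\eta)\in(0,\infty)^K$ be the unique positive solution of the coupled system $$\frac1v=\eta+Sw+\frac{\tau}{\eta+S^tv},\qquad \frac1w=\eta+S^tv+\frac{\tau}{\eta+Sw}.$$ For $z\in\mathbb{C}\setminus\{0\}$ set $$\sigma(z):=-\frac1{2\pi}\Delta_z\int_0^\infty\Big(\langle v(|z|^2,\eta)\rangle-\frac1{1+\eta}\Big)\,d\eta ,$$ where $\Delta_z$ is the Laplacian on $\mathbb{C}\cong\mathbb{R}^2$.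 It is known that $\sigma$ is the density, away from the origin, of a probability measure supported on the disk of radius $\sqrt{\rho(S)}$ ($\rho(S)$ is the spectral radius), and that $\sigma>0$ for $0<|z|^2<\rho(S)$. Normal form: since $S$ has support, there are permutation matrices $Q_1,Q_2$ such that $\widetilde S:=Q_1SQ_2^t$ is block upper triangular, $\widetilde S=(\widetilde S_{lk})_{l,k=1}^L$ with $\widetilde S_{lk}=0$ for $l>k$, and the square diagonal blocks $\widetilde S_{11},\dots,\widetilde S_{LL}$ are primitive with positive main diagonal. Fix such a choice. Let $Q:=Q_1Q_2^t$, partitioned into blocks $Q_{lk}$ in the same way as $\widetilde S$. Labeled graph: for $l,k\in\{1,\dots,L\}$ define $$l\lhd k:\Leftrightarrow \widetilde S_{lk}\neq0\text{ and }l\neq k,\qquad l\prec k:\Leftrightarrow Q_{lk}\ne0 .$$ The edge-labeled directed graph on $\{1,\dots,L\}$ has a $\lhd$-labeled edge $(l,k)$ for every $l\lhd k$ and a $\prec$-labeled edge $(l,k)$ for every $l\prec k$ (self-loops of type $\prec$ are possible; if both relations hold for $(l,k)$ there are two parallel edges, one of each label). A path $\gamma=e_1e_2\cdots e_\ell$, $\ell\ge1$, is a finite concatenation of labeled edges $e_j=(k_{j-1},k_j)$; $|\gamma|:=\ell$, and $\langle\gamma\rangle$ is the number of $j$ for which $e_j$ is $\prec$-labeled. It is a cycle if $k_0=k_\ell$. *)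

theory Defs
  imports "HOL-Analysis.Analysis" "Graph_Theory.Arc_Walk"
begin

section \<open>Non-negative matrices\<close>

type_synonym 'n sqmat = "real ^ 'n ^ 'n"

definition nonneg_matrix :: "'n::finite sqmat \<Rightarrow> bool" where
  "nonneg_matrix R \<longleftrightarrow> (\<forall>i j. 0 \<le> R $ i $ j)"

definition has_support :: "'n::finite sqmat \<Rightarrow> bool" where
  "has_support R \<longleftrightarrow> (\<exists>p. p permutes UNIV \<and> (\<forall>i. 0 < R $ i $ p i))"

text \<open>The operation \<open>*\<close> (hence \<open>^\<close>) on square matrices is entrywise, so powers with
  respect to the matrix product are defined separately.\<close>

primrec mat_power :: "'n::finite sqmat \<Rightarrow> nat \<Rightarrow> 'n sqmat" where
  "mat_power A 0 = mat 1"
| "mat_power A (Suc m) = A ** mat_power A m"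

text \<open>The next two notions are meant for matrices with non-negative entries.\<close>

definition irreducible_matrix :: "'n::finite sqmat \<Rightarrow> bool" where
  "irreducible_matrix A \<longleftrightarrow> (\<forall>i j. \<exists>m\<ge>1. 0 < mat_power A m $ i $ j)"

text \<open>\<open>primitive_on I A\<close>: the square submatrix of \<open>A\<close> with row and column index set \<open>I\<close> is
  primitive. The submatrix is represented by its extension by zero; for \<open>m \<ge> 1\<close> the \<open>m\<close>-th power
  of the extension is the extension of the \<open>m\<close>-th power.\<close>

definition primitive_on :: "'n::finite set \<Rightarrow> 'n sqmat \<Rightarrow> bool" where
  "primitive_on I A \<longleftrightarrow>
     (\<exists>m\<ge>1. \<forall>i\<in>I. \<forall>j\<in>I.
        0 < mat_power (\<chi> i j. if i \<in> I \<and> j \<in> I then A $ i $ j else 0) m $ i $ j)"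

definition permutation_matrix :: "'n::finite sqmat \<Rightarrow> bool" where
  "permutation_matrix Q \<longleftrightarrow>
     (\<exists>p. p permutes UNIV \<and> Q = (\<chi> i j. if j = p i then 1 else 0))"


section \<open>Self-consistent density of states\<close>

definition avg :: "real ^ 'n \<Rightarrow> real" where
  "avg x = (\<Sum>i\<in>UNIV. x $ i) / real CARD('n)"

definition dyson_solution ::
  "'n::finite sqmat \<Rightarrow> real \<Rightarrow> real \<Rightarrow> real ^ 'n \<Rightarrow> real ^ 'n \<Rightarrow> bool" where
  "dyson_solution S \<tau> \<eta> v w \<longleftrightarrow>
     (\<forall>i. 0 < v $ i \<and> 0 < w $ i \<and>
        1 / v $ i = \<eta> + (S *v w) $ i + \<tau> / (\<eta> + (transpose S *v v) $ i) \<and>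
        1 / w $ i = \<eta> + (transpose S *v v) $ i + \<tau> / (\<eta> + (S *v w) $ i))"

text \<open>The component \<open>v(\<tau>, \<eta>)\<close> of the unique positive solution, for \<open>\<tau>, \<eta> > 0\<close>.\<close>

definition dyson_v :: "'n::finite sqmat \<Rightarrow> real \<Rightarrow> real \<Rightarrow> real ^ 'n" where
  "dyson_v S \<tau> \<eta> = fst (THE (v, w). dyson_solution S \<tau> \<eta> v w)"

definition laplacian :: "(complex \<Rightarrow> real) \<Rightarrow> complex \<Rightarrow> real" where
  "laplacian f z =
     (deriv ^^ 2) (\<lambda>x. f (Complex x (Im z))) (Re z) +
     (deriv ^^ 2) (\<lambda>y. f (Complex (Re z) y)) (Im z)"

definition scdos :: "'n::finite sqmat \<Rightarrow> complex \<Rightarrow> real" where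
  "scdos S z = - 1 / (2 * pi) *
     laplacian (\<lambda>\<zeta>. set_lebesgue_integral lborel {0<..}
       (\<lambda>\<eta>. avg (dyson_v S ((cmod \<zeta>)\<^sup>2) \<eta>) - 1 / (1 + \<eta>))) z"


section \<open>Normal form\<close>

text \<open>A partition of the ordered index type \<open>'n\<close> into \<open>L\<close> consecutive non-empty blocks is given by a
  monotone map \<open>b\<close> onto \<open>{1..L}\<close>; the index \<open>i\<close> belongs to the block with number \<open>b i\<close>.\<close>

definition block_partition :: "nat \<Rightarrow> ('n::linorder \<Rightarrow> nat) \<Rightarrow> bool" where
  "block_partition L b \<longleftrightarrow> mono b \<and> range b = {1..L}"

definition block_nonzero :: "('n::finite \<Rightarrow> nat) \<Rightarrow> 'n sqmat \<Rightarrow> nat \<Rightarrow> nat \<Rightarrow> bool" where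
  "block_nonzero b A l k \<longleftrightarrow> (\<exists>i j. b i = l \<and> b j = k \<and> A $ i $ j \<noteq> 0)"

definition normal_form ::
  "'n::{finite,linorder} sqmat \<Rightarrow> 'n sqmat \<Rightarrow> 'n sqmat \<Rightarrow> nat \<Rightarrow> ('n \<Rightarrow> nat) \<Rightarrow> bool"
  where
  "normal_form S Q1 Q2 L b \<longleftrightarrow>
     permutation_matrix Q1 \<and> permutation_matrix Q2 \<and> block_partition L b \<and>
     (let S' = Q1 ** S ** transpose Q2 in
        (\<forall>l\<in>{1..L}. \<forall>k\<in>{1..L}. k < l \<longrightarrow> \<not> block_nonzero b S' l k) \<and>
        (\<forall>l\<in>{1..L}. primitive_on {i. b i = l} S') \<and>
        (\<forall>i. 0 < S' $ i $ i))"


section \<open>The edge-labeled graph\<close>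

datatype edge_label = Lhd | Prec

text \<open>An edge \<open>(l, c, k)\<close> leads from \<open>l\<close> to \<open>k\<close> and carries the label \<open>c\<close>.\<close>

type_synonym labeled_edge = "nat \<times> edge_label \<times> nat"

definition normal_form_graph ::
  "'n::finite sqmat \<Rightarrow> 'n sqmat \<Rightarrow> 'n sqmat \<Rightarrow> nat \<Rightarrow> ('n \<Rightarrow> nat) \<Rightarrow>
     (nat, labeled_edge) pre_digraph" where
  "normal_form_graph S Q1 Q2 L b =
     \<lparr>verts = {1..L},
      arcs =
        {(l, Lhd, k) | l k. l \<in> {1..L} \<and> k \<in> {1..L} \<and>
           block_nonzero b (Q1 ** S ** transpose Q2) l k \<and> l \<noteq> k} \<union>
        {(l, Prec, k) | l k. l \<in> {1..L} \<and> k \<in> {1..L} \<and>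
           block_nonzero b (Q1 ** transpose Q2) l k},
      tail = (\<lambda>(l, c, k). l),
      head = (\<lambda>(l, c, k). k)\<rparr>"

text \<open>A cycle is any non-empty closed walk; vertices and edges may be repeated, so this is
  weaker than \<open>pre_digraph.cycle\<close>.\<close>

definition closed_walk :: "(nat, labeled_edge) pre_digraph \<Rightarrow> labeled_edge list \<Rightarrow> bool" where
  "closed_walk G \<gamma> \<longleftrightarrow> \<gamma> \<noteq> [] \<and> (\<exists>u. pre_digraph.awalk G u \<gamma> u)"

definition prec_count :: "labeled_edge list \<Rightarrow> nat" where
  "prec_count \<gamma> = length (filter (\<lambda>(l, c, k). c = Prec) \<gamma>)"

definition cycle_ratios :: "(nat, labeled_edge) pre_digraph \<Rightarrow> real set" where
  "cycle_ratios G = {real (prec_count \<gamma>) / real (length \<gamma>) | \<gamma>. closed_walk G \<gamma>}"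

end

theory Submission
  imports Defs "HOL-Real_Asymp.Real_Asymp"
begin

text \<open>
  Set \<open>u = v / (\<eta> + S\<^sup>t v) = w / (\<eta> + S w)\<close>. In logarithmic coordinates the Dyson equation is the
  stationarity condition of a convex problem: minimize \<open>\<Sum> (\<tau> u - ln u) + \<eta> \<Sum> w\<close> subject to
  \<open>u (\<eta> + S w) \<le> w\<close>, with \<open>v\<close> as Lagrange multiplier. The minimal value has \<open>\<eta>\<close>-derivative \<open>2 \<Sum> v\<close>, so
  the integral defining \<open>\<sigma>\<close> is \<open>1/2 - V\<^sub>0(\<tau>) / (2 K)\<close>, where \<open>V\<^sub>0\<close> is the value at \<open>\<eta> = 0\<close>. With
  \<open>x = \<tau> u\<close>, \<open>X = \<Sum> x\<close> and \<open>s = ln \<tau>\<close> one has \<open>dV\<^sub>0/ds = X\<close>, hence \<open>\<sigma> = (dX/ds) / (\<pi> K \<tau>)\<close>, and it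
  remains to show that \<open>X\<close> and \<open>dX/ds\<close> are both of order \<open>\<tau>\<^sup>\<kappa>\<close>.

  At \<open>\<eta> = 0\<close> the matrix \<open>m\<^sub>i\<^sub>j = v\<^sub>i S\<^sub>i\<^sub>j w\<^sub>j\<close> plus the diagonal matrix of \<open>x\<close> is doubly stochastic, and
  \<open>x (1 - x) = \<tau> v w\<close>. So around a closed walk of \<open>S\<close>-edges and \<open>x\<close>-edges, the product of the weights,
  divided by the product of the weights on the diagonal of the normal form, is \<open>\<tau>\<close> to the number of
  \<open>x\<close>-edges up to constants. The entries of \<open>m\<close> inside the diagonal blocks are bounded below, those
  between different blocks are at most \<open>X\<close>, so every cycle \<open>\<gamma>\<close> gives \<open>X \<ge> c \<tau>\<close> to the power
  \<open>\<langle>\<gamma>\<rangle> / |\<gamma>|\<close>. Conversely a circulation contains a cycle of edges of weight at least \<open>c X\<close> through the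
  largest \<open>x\<close>, which yields the reverse bound for that cycle; differentiating the product along
  the same cycle yields \<open>dX/ds \<ge> c X\<close>.
\<close>

section \<open>The Dyson equation as a convex minimization problem\<close>

text \<open>No regularity of the solution is known in advance. Derivatives of minimal values come
  from testing the minimum at one parameter with the minimizer at a nearby one, in both directions,
  which needs only continuity of the slopes. In \<open>\<eta>\<close> this continuity follows from a
  quantitative form of minimality; in \<open>s\<close>, X is shown to be differentiable outright, by
  a monotonicity argument. Two obstacles shape the details. At \<open>\<eta> = 0\<close> the pair
  (v, w) is determined only up to scaling, so only scaling invariant quantities can be
  differentiated. And \<open>x (1 - x)\<close> is increasing only below 1/2, so the analysis is
  restricted to \<open>s < smax\<close>, where a crude bound of X by a multiple of
  \<open>1 / (- s)\<close> forces \<open>x \<le> 1/4\<close>. The upper bound on dX/ds, absent from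
  the overview, is \<open>dX/ds \<le> X\<close>, from concavity of the value in
  \<open>\<tau>\<close>.\<close>

text \<open>The right-hand side is the tangent-line remainder of \<open>exp\<close> at
  \<open>ln a\<close>, evaluated at \<open>ln b\<close>. Bounding it below by a squared distance
  makes minimality quantitative.\<close>

lemma sqrt_diff_sq_le:
  fixes a b :: real
  assumes "0 < a" "0 < b"
  shows "(sqrt b - sqrt a)\<^sup>2 \<le> b - a - a * (ln b - ln a)"
proof -
  have "ln (sqrt (b / a)) \<le> sqrt (b / a) - 1"
    using assms by (intro ln_le_minus_one) auto
  then have "ln b - ln a \<le> 2 * (sqrt (b / a) - 1)"
    using assms by (simp add: ln_sqrt ln_div)
  then have "a * (ln b - ln a) \<le> a * (2 * (sqrt (b / a) - 1))"
    using assms by (intro mult_left_mono) auto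
  also have "\<dots> = 2 * sqrt a * sqrt b - 2 * a"
    using assms by (simp add: real_sqrt_divide algebra_simps)
      (metis less_le mult.commute mult.left_commute nonzero_mult_div_cancel_left real_div_sqrt real_sqrt_eq_zero_cancel_iff times_divide_eq_right)
  finally show ?thesis
    using assms by (simp add: power2_eq_square algebra_simps)
qed

locale irreducible_support =
  fixes S :: "'n::finite sqmat"
  assumes nonneg: "nonneg_matrix S" and irr: "irreducible_matrix S" and supp: "has_support S"
begin

definition S_app :: "real ^ 'n \<Rightarrow> 'n \<Rightarrow> real" where "S_app w i = (\<Sum>j\<in>UNIV. S $ i $ j * w $ j)"
definition St_app :: "real ^ 'n \<Rightarrow> 'n \<Rightarrow> real" where "St_app v j = (\<Sum>i\<in>UNIV. S $ i $ j * v $ i)"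

lemma S_nonneg [simp]: "0 \<le> S $ i $ j"
  using nonneg by (simp add: nonneg_matrix_def)

lemma S_app_eq: "(S *v w) $ i = S_app w i"
  by (simp add: S_app_def matrix_vector_mult_def)

lemma St_app_eq: "(transpose S *v v) $ i = St_app v i"
  by (simp add: St_app_def matrix_vector_mult_def transpose_def)

definition supp_perm :: "'n \<Rightarrow> 'n" where
  "supp_perm = (SOME p. p permutes UNIV \<and> (\<forall>i. 0 < S $ i $ p i))"

lemma supp_perm: "supp_perm permutes UNIV" "0 < S $ i $ supp_perm i"
  using supp someI_ex[of "\<lambda>p. p permutes UNIV \<and> (\<forall>i. 0 < S $ i $ p i)"]
  unfolding has_support_def supp_perm_def by blast+

lemma S_app_pos: assumes "\<And>i. 0 < w $ i" shows "0 < S_app w i"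
proof -
  have "0 < S $ i $ supp_perm i * w $ supp_perm i"
    using assms supp_perm by simp
  also have "\<dots> \<le> S_app w i" unfolding S_app_def
    using assms by (intro member_le_sum) (auto simp: less_imp_le)
  finally show ?thesis .
qed

lemma St_app_pos: assumes "\<And>i. 0 < v $ i" shows "0 < St_app v j"
proof -
  obtain i where i: "j = supp_perm i"
    using supp_perm(1) by (metis permutes_univ)
  have "0 < S $ i $ j * v $ i"
    using assms supp_perm i by simp
  also have "\<dots> \<le> St_app v j" unfolding St_app_def
    using assms by (intro member_le_sum) (auto simp: less_imp_le)
  finally show ?thesis .
qed

lemma sum_S_app_St_app: "(\<Sum>i\<in>UNIV. v $ i * S_app w i) = (\<Sum>j\<in>UNIV. w $ j * St_app v j)"
  unfolding S_app_def St_app_def sum_distrib_left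
  by (subst sum.swap) (simp add: mult_ac)

text \<open>The Dyson system with denominators cleared. In this polynomial form it survives limits
  in \<open>v\<close>, \<open>w\<close> and \<open>\<eta>\<close>, and it keeps its meaning at
  \<open>\<eta> = 0\<close>.\<close>

definition sol :: "real \<Rightarrow> real \<Rightarrow> real ^ 'n \<Rightarrow> real ^ 'n \<Rightarrow> bool" where
  "sol \<tau> \<eta> v w \<longleftrightarrow> (\<forall>i. 0 < v $ i \<and> 0 < w $ i \<and>
     v $ i * (\<tau> + (\<eta> + S_app w i) * (\<eta> + St_app v i)) = \<eta> + St_app v i \<and>
     w $ i * (\<tau> + (\<eta> + S_app w i) * (\<eta> + St_app v i)) = \<eta> + S_app w i)"

text \<open>The \<open>u\<close> of the overview, solved for: \<open>sol\<close> says
  \<open>v = c / (\<tau> + a c)\<close> with \<open>a = \<eta> + S w\<close> and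
  \<open>c = \<eta> + S\<^sup>t v\<close>.\<close>

definition ucoef :: "real \<Rightarrow> real \<Rightarrow> real ^ 'n \<Rightarrow> real ^ 'n \<Rightarrow> 'n \<Rightarrow> real" where
  "ucoef \<tau> \<eta> v w i = 1 / (\<tau> + (\<eta> + S_app w i) * (\<eta> + St_app v i))"

lemma dyson_solution_iff_sol:
  assumes "0 < \<tau>" "0 \<le> \<eta>"
  shows "dyson_solution S \<tau> \<eta> v w \<longleftrightarrow> sol \<tau> \<eta> v w"
proof -
  have *: "(1 / x = a + \<tau> / c) \<longleftrightarrow> x * (\<tau> + a * c) = c" if "0 < x" "0 < a" "0 < c" for x a c :: real
  proof -
    have "a + \<tau> / c = (\<tau> + a * c) / c" using that by (simp add: field_simps)
    moreover have "0 < \<tau> + a * c" using that assms by (simp add: add_pos_pos)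
    ultimately show ?thesis using that by (auto simp: field_simps)
  qed
  have "dyson_solution S \<tau> \<eta> v w \<longleftrightarrow> (\<forall>i. (0 < v $ i \<and> 0 < w $ i) \<and>
     1 / v $ i = \<eta> + S_app w i + \<tau> / (\<eta> + St_app v i) \<and> 1 / w $ i = \<eta> + St_app v i + \<tau> / (\<eta> + S_app w i))"
    unfolding dyson_solution_def S_app_eq St_app_eq by simp
  also have "\<dots> \<longleftrightarrow> (\<forall>i. 0 < v $ i \<and> 0 < w $ i) \<and> (\<forall>i. 
     1 / v $ i = \<eta> + S_app w i + \<tau> / (\<eta> + St_app v i) \<and> 1 / w $ i = \<eta> + St_app v i + \<tau> / (\<eta> + S_app w i))"
    by blast
  also have "\<dots> \<longleftrightarrow> (\<forall>i. 0 < v $ i \<and> 0 < w $ i) \<and> (\<forall>i. v $ i * (\<tau> + (\<eta> + S_app w i) * (\<eta> + St_app v i)) = \<eta> + St_app v i \<and>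
     w $ i * (\<tau> + (\<eta> + S_app w i) * (\<eta> + St_app v i)) = \<eta> + S_app w i)"
  proof (intro conj_cong refl all_cong1)
    fix i assume "\<forall>i. 0 < v $ i \<and> 0 < w $ i"
    then have p: "0 < v $ i" "0 < w $ i" "0 < \<eta> + S_app w i" "0 < \<eta> + St_app v i"
      using S_app_pos St_app_pos assms by (auto intro: add_nonneg_pos)
    show "1 / v $ i = \<eta> + S_app w i + \<tau> / (\<eta> + St_app v i) \<longleftrightarrow> v $ i * (\<tau> + (\<eta> + S_app w i) * (\<eta> + St_app v i)) = \<eta> + St_app v i"
      by (rule *) (use p in auto)
    show "1 / w $ i = \<eta> + St_app v i + \<tau> / (\<eta> + S_app w i) \<longleftrightarrow> w $ i * (\<tau> + (\<eta> + S_app w i) * (\<eta> + St_app v i)) = \<eta> + S_app w i"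
      using *[of "w $ i" "\<eta> + St_app v i" "\<eta> + S_app w i"] p by (simp add: mult.commute)
  qed
  also have "\<dots> \<longleftrightarrow> sol \<tau> \<eta> v w" unfolding sol_def by blast
  finally show ?thesis .
qed

section \<open>Identities and minimality of a positive solution\<close>

context
  fixes \<tau> \<eta> v w
  assumes sol: "sol \<tau> \<eta> v w" and \<tau>: "0 < \<tau>" and \<eta>: "0 \<le> \<eta>"
begin

lemma sol_pos: "0 < v $ i" "0 < w $ i"
  using sol by (auto simp: sol_def)

lemma sol_ac_pos: "0 < \<eta> + S_app w i" "0 < \<eta> + St_app v i"
  using sol_pos S_app_pos St_app_pos \<eta> by (auto intro: add_nonneg_pos)

lemma sol_ucoef_pos: "0 < ucoef \<tau> \<eta> v w i"
  using sol_ac_pos \<tau> by (simp add: ucoef_def add_pos_pos)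

lemma sol_v_eq: "v $ i = ucoef \<tau> \<eta> v w i * (\<eta> + St_app v i)"
  and sol_w_eq: "w $ i = ucoef \<tau> \<eta> v w i * (\<eta> + S_app w i)"
proof -
  have "0 < \<tau> + (\<eta> + S_app w i) * (\<eta> + St_app v i)"
    using sol_ac_pos \<tau> by (simp add: add_pos_pos)
  then show "v $ i = ucoef \<tau> \<eta> v w i * (\<eta> + St_app v i)" "w $ i = ucoef \<tau> \<eta> v w i * (\<eta> + S_app w i)"
    using sol by (auto simp: sol_def ucoef_def field_simps)
qed

lemma sol_ucoef_eq: "ucoef \<tau> \<eta> v w i * (\<eta> + S_app w i) * (\<eta> + St_app v i) = 1 - \<tau> * ucoef \<tau> \<eta> v w i"
proof -
  have "0 < \<tau> + (\<eta> + S_app w i) * (\<eta> + St_app v i)"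
    using sol_ac_pos \<tau> by (simp add: add_pos_pos)
  then show ?thesis by (simp add: ucoef_def field_simps)
qed

text \<open>At \<open>\<eta> = 0\<close> this and the next identity are the row and column sums of
  the matrix \<open>m\<close> of the overview.\<close>

lemma sol_va: "v $ i * (\<eta> + S_app w i) = 1 - \<tau> * ucoef \<tau> \<eta> v w i"
  using sol_ucoef_eq[of i] by (subst sol_v_eq) (simp add: mult_ac)

lemma sol_wc: "w $ i * (\<eta> + St_app v i) = 1 - \<tau> * ucoef \<tau> \<eta> v w i"
  using sol_ucoef_eq[of i] by (subst sol_w_eq) (simp add: mult_ac)

lemma sol_vw: "v $ i * w $ i = ucoef \<tau> \<eta> v w i * (1 - \<tau> * ucoef \<tau> \<eta> v w i)"
  using sol_va[of i] by (subst sol_w_eq) (simp add: mult_ac)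

lemma sol_x_less_1: "\<tau> * ucoef \<tau> \<eta> v w i < 1"
  using sol_va[of i] sol_pos[of i] sol_ac_pos[of i]
  by (metis diff_gt_0_iff_gt mult_pos_pos)

text \<open>By duality the two bilinear terms agree, leaving \<open>\<eta>\<close> times the sums.
  At \<open>\<eta> = 0\<close> the argument gives nothing, in accordance with the freedom to scale
  \<open>v\<close> against \<open>w\<close>.\<close>

lemma sol_sum_eq: assumes "0 < \<eta>" shows "(\<Sum>i\<in>UNIV. v $ i) = (\<Sum>i\<in>UNIV. w $ i)"
proof -
  have "(\<Sum>i\<in>UNIV. v $ i * (\<eta> + S_app w i)) = (\<Sum>i\<in>UNIV. w $ i * (\<eta> + St_app v i))"
    using sol_va sol_wc by simp
  then have "\<eta> * (\<Sum>i\<in>UNIV. v $ i) + (\<Sum>i\<in>UNIV. v $ i * S_app w i) = \<eta> * (\<Sum>i\<in>UNIV. w $ i) + (\<Sum>i\<in>UNIV. w $ i * St_app v i)"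
    by (simp add: algebra_simps sum.distrib sum_distrib_left)
  then show ?thesis using assms sum_S_app_St_app by simp
qed

text \<open>The constraint \<open>u' (\<eta> + S w') \<le> w'\<close> becomes a sum of exponentials of linear forms in the
  logarithmic increments, so that \<open>exp x \<ge> 1 + x\<close> linearizes it; \<open>v\<close> is the Lagrange multiplier.\<close>

lemma key_inequality:
  assumes "\<And>i. 0 < u' i" "\<And>i. 0 < w' $ i" "\<And>i. u' i * (\<eta> + S_app w' i) \<le> w' $ i"
  shows "(\<Sum>i\<in>UNIV. (1 - \<tau> * ucoef \<tau> \<eta> v w i) * (ln (u' i) - ln (ucoef \<tau> \<eta> v w i)))
    \<le> \<eta> * (\<Sum>i\<in>UNIV. w $ i * (ln (w' $ i) - ln (w $ i)))"
proof -
  define u where "u = ucoef \<tau> \<eta> v w"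
  define d where "d i = ln (u' i) - ln (u i)" for i
  define e where "e i = ln (w' $ i) - ln (w $ i)" for i
  have u: "0 < u i" for i using sol_ucoef_pos by (simp add: u_def)
  have u': "u' i = u i * exp (d i)" for i
    using assms(1)[of i] u[of i] by (simp add: d_def exp_diff)
  have w': "w' $ i = w $ i * exp (e i)" for i
    using assms(2)[of i] sol_pos(2)[of i] by (simp add: e_def exp_diff)
  have 1: "(\<eta> + S_app w i) * (d i - e i) + (\<Sum>j\<in>UNIV. S $ i $ j * w $ j * e j) \<le> 0" for i
  proof -
    have "\<eta> * (1 + (d i - e i)) + (\<Sum>j\<in>UNIV. S $ i $ j * w $ j * (1 + (d i - e i + e j)))
       \<le> \<eta> * exp (d i - e i) + (\<Sum>j\<in>UNIV. S $ i $ j * w $ j * exp (d i - e i + e j))"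
      using sol_pos(2) by (intro add_mono mult_left_mono sum_mono exp_ge_add_one_self)
        (auto simp: \<eta> less_imp_le)
    also have "\<dots> = exp (d i - e i) * (\<eta> + S_app w' i)"
      unfolding S_app_def w' exp_add by (simp add: sum_distrib_left distrib_left mult_ac)
    also have "\<dots> = u' i * (\<eta> + S_app w' i) * (\<eta> + S_app w i) / (w $ i * exp (e i))"
    proof -
      have "exp (d i - e i) = u' i * (\<eta> + S_app w i) / (w $ i * exp (e i))"
        using u[of i] sol_ac_pos(1)[of i]
        by (subst sol_w_eq) (simp add: u' u_def[symmetric] exp_diff)
      then show ?thesis by (simp add: mult_ac)
    qed
    also have "\<dots> \<le> w' $ i * (\<eta> + S_app w i) / (w $ i * exp (e i))"
      using assms(3)[of i] sol_ac_pos(1)[of i] sol_pos(2)[of i]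
      by (intro divide_right_mono mult_right_mono) auto
    also have "\<dots> = \<eta> + S_app w i" using sol_pos(2)[of i] by (simp add: w')
    finally show ?thesis
      by (simp add: S_app_def algebra_simps sum.distrib sum_subtractf sum_distrib_left)
  qed
  \<comment> \<open>Weighting row \<open>i\<close> by \<open>v $ i\<close> makes
    \<open>sol_va\<close> and \<open>sol_wc\<close> produce the same coefficient
    \<open>1 - \<tau> u\<close> for \<open>e\<close>, with opposite signs; only the
    \<open>\<eta>\<close> term in \<open>e\<close> survives.\<close>
  have "0 \<ge> (\<Sum>i\<in>UNIV. v $ i * ((\<eta> + S_app w i) * (d i - e i) + (\<Sum>j\<in>UNIV. S $ i $ j * w $ j * e j)))"
    using 1 sol_pos(1) by (intro sum_nonpos mult_nonneg_nonpos) (auto simp: less_imp_le)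
  also have "(\<Sum>i\<in>UNIV. v $ i * ((\<eta> + S_app w i) * (d i - e i) + (\<Sum>j\<in>UNIV. S $ i $ j * w $ j * e j)))
     = (\<Sum>i\<in>UNIV. v $ i * (\<eta> + S_app w i) * (d i - e i)) + (\<Sum>i\<in>UNIV. v $ i * (\<Sum>j\<in>UNIV. S $ i $ j * w $ j * e j))"
    by (simp only: distrib_left[of "v $ i" "(\<eta> + S_app w i) * (d i - e i)" for i] sum.distrib mult.assoc)
  also have "(\<Sum>i\<in>UNIV. v $ i * (\<Sum>j\<in>UNIV. S $ i $ j * w $ j * e j)) = (\<Sum>j\<in>UNIV. w $ j * St_app v j * e j)"
    unfolding St_app_def sum_distrib_left sum_distrib_right
    by (subst sum.swap) (simp add: mult_ac)
  also have "\<dots> = (\<Sum>j\<in>UNIV. (1 - \<tau> * u j) * e j) - \<eta> * (\<Sum>j\<in>UNIV. w $ j * e j)"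
    unfolding u_def sol_wc[symmetric] by (simp add: algebra_simps sum.distrib sum_distrib_left)
  also have "(\<Sum>i\<in>UNIV. v $ i * (\<eta> + S_app w i) * (d i - e i)) = (\<Sum>i\<in>UNIV. (1 - \<tau> * u i) * (d i - e i))"
    by (simp add: sol_va u_def)
  finally have "(\<Sum>i\<in>UNIV. (1 - \<tau> * u i) * (d i - e i)) + ((\<Sum>j\<in>UNIV. (1 - \<tau> * u j) * e j) - \<eta> * (\<Sum>j\<in>UNIV. w $ j * e j)) \<le> 0" .
  then show ?thesis
    by (simp add: u_def d_def e_def algebra_simps sum.distrib sum_subtractf)
qed

text \<open>\<open>key_inequality\<close> handles the logarithms, which are linear in the chosen
  coordinates; the exponential terms \<open>\<tau> u'\<close> and \<open>\<eta> w'\<close>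
  contribute their tangent-line remainders. The resulting quadratic gap is what yields uniqueness
  and continuity.\<close>

lemma value_le:
  assumes "\<And>i. 0 < u' i" "\<And>i. 0 < w' $ i" "\<And>i. u' i * (\<eta> + S_app w' i) \<le> w' $ i"
  shows "(\<Sum>i\<in>UNIV. \<tau> * ucoef \<tau> \<eta> v w i - ln (ucoef \<tau> \<eta> v w i)) + \<eta> * (\<Sum>i\<in>UNIV. w $ i)
      + \<tau> * (\<Sum>i\<in>UNIV. (sqrt (u' i) - sqrt (ucoef \<tau> \<eta> v w i))\<^sup>2)
      + \<eta> * (\<Sum>i\<in>UNIV. (sqrt (w' $ i) - sqrt (w $ i))\<^sup>2)
    \<le> (\<Sum>i\<in>UNIV. \<tau> * u' i - ln (u' i)) + \<eta> * (\<Sum>i\<in>UNIV. w' $ i)"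
proof -
  define u where "u = ucoef \<tau> \<eta> v w"
  have u: "0 < u i" for i using sol_ucoef_pos by (simp add: u_def)
  have 1: "\<tau> * (\<Sum>i\<in>UNIV. (sqrt (u' i) - sqrt (u i))\<^sup>2) \<le> \<tau> * (\<Sum>i\<in>UNIV. u' i - u i - u i * (ln (u' i) - ln (u i)))"
    using u assms(1) \<tau> by (intro mult_left_mono sum_mono sqrt_diff_sq_le) auto
  have 2: "\<eta> * (\<Sum>i\<in>UNIV. (sqrt (w' $ i) - sqrt (w $ i))\<^sup>2) \<le> \<eta> * (\<Sum>i\<in>UNIV. w' $ i - w $ i - w $ i * (ln (w' $ i) - ln (w $ i)))"
    using sol_pos assms(2) \<eta> by (intro mult_left_mono sum_mono sqrt_diff_sq_le) auto
  have 3: "(\<Sum>i\<in>UNIV. (1 - \<tau> * u i) * (ln (u' i) - ln (u i)))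
    \<le> \<eta> * (\<Sum>i\<in>UNIV. w $ i * (ln (w' $ i) - ln (w $ i)))"
    unfolding u_def using assms by (rule key_inequality)
  show ?thesis using 1 2 3 unfolding u_def[symmetric]
    by (simp add: algebra_simps sum.distrib sum_subtractf sum_distrib_left)
qed

end


section \<open>Existence for positive regularization\<close>

lemma continuous_on_S_app [continuous_intros]:
  "continuous_on A f \<Longrightarrow> continuous_on A (\<lambda>x. S_app (f x) i)"
  unfolding S_app_def by (intro continuous_intros)

text \<open>With \<open>u = w / (\<eta> + S w)\<close> the constraint is an equality and the problem
  is to minimize \<open>f\<close> over positive \<open>w\<close>. The sublevel set through the
  constant vector 1 lies in a box away from the boundary, so a minimizer exists; its stationarity is
  the missing half of the system.\<close>

lemma exists_sol:
  assumes \<tau>: "0 < \<tau>" and \<eta>: "0 < \<eta>"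
  shows "\<exists>v w. sol \<tau> \<eta> v w"
proof -
  define K where "K = real CARD('n)"
  \<comment> \<open>\<open>1 + ln \<tau>\<close> is the minimum of \<open>\<tau> u - ln u\<close>,
    attained at \<open>u = 1 / \<tau>\<close>. Subtracting it makes every summand non-negative, so
    that a bound on the sum bounds each of them.\<close>
  define l where "l = 1 + ln \<tau>"
  define g where "g w i = \<tau> * (w $ i / (\<eta> + S_app w i)) - ln (w $ i) + ln (\<eta> + S_app w i) - l + \<eta> * w $ i" for w :: "real ^ 'n" and i
  define f where "f w = (\<Sum>i\<in>UNIV. g w i)" for w
  define P where "P w \<longleftrightarrow> (\<forall>i. 0 < w $ i)" for w :: "real ^ 'n"
  have a_pos: "0 < \<eta> + S_app w i" if "P w" for w i
    using that \<eta> S_app_pos[of w i] by (auto simp: P_def intro: add_pos_pos)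
  have g1: "\<eta> * w $ i \<le> g w i" and g2: "- ln (w $ i / (\<eta> + S_app w i)) - l \<le> g w i" if "P w" for w i
  proof -
    define u where "u = w $ i / (\<eta> + S_app w i)"
    have w: "0 < w $ i" using that by (simp add: P_def)
    have a: "0 < \<eta> + S_app w i" using a_pos[OF that] .
    have u: "0 < u" using a w by (simp add: u_def)
    have "ln (\<tau> * u) \<le> \<tau> * u - 1" using u \<tau> by (intro ln_le_minus_one) auto
    then have "0 \<le> \<tau> * u - ln u - l" using u \<tau> by (simp add: ln_mult l_def)
    moreover have "g w i = \<tau> * u - ln u - l + \<eta> * w $ i"
      using ln_divide_pos[OF w a] unfolding g_def u_def by simp
    moreover have "0 \<le> \<tau> * u" "0 \<le> \<eta> * w $ i" using u w \<tau> \<eta> by auto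
    ultimately show "\<eta> * w $ i \<le> g w i" "- ln (w $ i / (\<eta> + S_app w i)) - l \<le> g w i"
      unfolding u_def[symmetric] by linarith+
  qed
  have g_nonneg: "0 \<le> g w i" if "P w" for w i
  proof -
    have "0 \<le> \<eta> * w $ i" using that \<eta> by (simp add: P_def less_imp_le)
    then show ?thesis using g1[OF that, of i] by linarith
  qed
  have gf: "g w i \<le> f w" if "P w" for w i
    unfolding f_def using g_nonneg[OF that] by (intro member_le_sum) auto
  define C where "C = f (\<chi> i. 1)"
  \<comment> \<open>From \<open>f w \<le> C\<close>: the term \<open>\<eta> w\<close> gives
    \<open>hi\<close>, and \<open>u \<ge> exp (- C - l)\<close> together with
    \<open>w \<ge> u \<eta>\<close> gives \<open>lo\<close>.\<close>
  define lo where "lo = \<eta> * exp (- C - l)"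
  define hi where "hi = C / \<eta>"
  have lo: "0 < lo" using \<eta> by (simp add: lo_def)
  define B where "B = (cbox (\<chi> i. lo) (\<chi> i. hi) :: (real ^ 'n) set)"
  have inB: "w \<in> B \<longleftrightarrow> (\<forall>i. lo \<le> w $ i \<and> w $ i \<le> hi)" for w :: "real ^ 'n"
    by (simp add: B_def mem_box_cart)
  have BP: "P w" if "w \<in> B" for w using that lo unfolding inB P_def by (meson less_le_trans)
  have sub: "w \<in> B" if w: "P w" and "f w \<le> C" for w
    unfolding inB
  proof (intro allI conjI)
    fix i
    have "\<eta> * w $ i \<le> C" using g1[OF w, of i] gf[OF w, of i] that by linarith
    then show "w $ i \<le> hi" using \<eta> by (simp add: hi_def field_simps)
    let ?u = "w $ i / (\<eta> + S_app w i)"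
    have wi: "0 < w $ i" using w by (simp add: P_def)
    have u: "0 < ?u" using a_pos[OF w] wi by simp
    have "- C - l \<le> ln ?u" using g2[OF w, of i] gf[OF w, of i] that by linarith
    then have "exp (- C - l) \<le> ?u" using u by (simp add: ln_ge_iff)
    then have "exp (- C - l) * (\<eta> + S_app w i) \<le> w $ i" using a_pos[OF w, of i] by (simp add: field_simps)
    moreover have "exp (- C - l) * \<eta> \<le> exp (- C - l) * (\<eta> + S_app w i)"
      using S_app_pos[of w i] w by (intro mult_left_mono) (auto simp: P_def less_imp_le)
    ultimately show "lo \<le> w $ i" unfolding lo_def by (subst mult.commute) (rule order_trans)
  qed
  have one: "P (\<chi> i. 1)" by (simp add: P_def)
  have oneB: "(\<chi> i. 1) \<in> B" by (rule sub) (auto simp: P_def C_def)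
  have cont: "continuous_on B f" unfolding f_def g_def
    using BP a_pos by (intro continuous_intros) (auto simp: P_def less_le)
  have "compact B" by (simp add: B_def)
  from continuous_attains_inf[OF this _ cont] oneB
  obtain w where wB: "w \<in> B" and wmin: "\<And>y. y \<in> B \<Longrightarrow> f w \<le> f y" by blast
  have wP: "P w" using BP wB .
  have wpos: "0 < w $ i" for i using wP by (simp add: P_def)
  have fw: "f w \<le> f y" if "P y" for y
    using sub[OF that] wmin oneB wmin[OF oneB] unfolding C_def by fastforce
  define a where "a i = \<eta> + S_app w i" for i
  have a: "0 < a i" for i using a_pos[OF wP] by (simp add: a_def)
  define u where "u i = w $ i / a i" for i
  have u: "0 < u i" for i using a wpos by (simp add: u_def)
  \<comment> \<open>\<open>v\<close> is defined so that the identity \<open>sol_va\<close> holds;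
    its sign is not known yet.\<close>
  define v :: "real ^ 'n" where "v = (\<chi> i. (1 - \<tau> * u i) / a i)"
  have stat: "w $ j * (\<eta> + St_app v j) = 1 - \<tau> * u j" for j
  proof -
    define e where "e t = w + t *\<^sub>R axis j 1" for t :: real
    have e: "e t $ i = w $ i + t * (if i = j then 1 else 0)" for t i by (simp add: e_def axis_def)
    have rse: "S_app (e t) i = S_app w i + t * S $ i $ j" for t i
    proof -
      have "S_app (e t) i = S_app w i + (\<Sum>k\<in>UNIV. t * (S $ i $ k * (if k = j then 1 else 0)))"
        unfolding S_app_def e by (simp add: distrib_left sum.distrib mult_ac)
      also have "(\<Sum>k\<in>UNIV. t * (S $ i $ k * (if k = j then 1 else 0))) = (\<Sum>k\<in>UNIV. if k = j then t * S $ i $ j else 0)"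
        by (intro sum.cong) auto
      finally show ?thesis by simp
    qed
    let ?d = "\<lambda>i. if i = j then 1 else 0 :: real"
    let ?D = "\<lambda>i. \<tau> * ((?d i * a i - w $ i * S $ i $ j) / (a i * a i)) - ?d i / w $ i + S $ i $ j / a i + \<eta> * ?d i"
    have "((\<lambda>t. f (e t)) has_field_derivative (\<Sum>i\<in>UNIV. ?D i)) (at 0)"
      unfolding f_def
    proof (rule DERIV_sum)
      fix i
      show "((\<lambda>t. g (e t) i) has_field_derivative ?D i) (at 0)"
        unfolding g_def e rse
        using a[of i] wpos[of i] \<eta>
        by (auto intro!: derivative_eq_intros simp: a_def right_diff_distrib mult.assoc)
    qed
    moreover have "f (e 0) \<le> f (e t)" if "\<bar>0 - t\<bar> < w $ j" for t
    proof -
      have "P (e t)" unfolding P_def e using that wpos by auto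
      then show ?thesis using fw by (simp add: e_def)
    qed
    ultimately have "(\<Sum>i\<in>UNIV. ?D i) = 0"
      using DERIV_local_min[of "\<lambda>t. f (e t)" _ 0 "w $ j"] wpos[of j] by blast
    moreover have "?D i = S $ i $ j * v $ i + (if i = j then \<tau> / a j - 1 / w $ j + \<eta> else 0)" for i
      using a[of i] wpos[of i] by (auto simp: v_def u_def field_simps)
    ultimately have "(\<Sum>i\<in>UNIV. S $ i $ j * v $ i + (if i = j then \<tau> / a j - 1 / w $ j + \<eta> else 0)) = 0"
      by (simp only:)
    then have "St_app v j + (\<tau> / a j - 1 / w $ j + \<eta>) = 0"
      by (simp add: sum.distrib St_app_def)
    then have "\<eta> + St_app v j = 1 / w $ j - \<tau> / a j" by linarith
    then show ?thesis using wpos[of j] a[of j] by (simp add: u_def field_simps)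
  qed
  have v_eq: "v $ i = u i * (\<eta> + St_app v i)" for i
  proof -
    have "w $ i = u i * a i" using a[of i] by (simp add: u_def)
    then show ?thesis using stat[of i] a[of i] by (simp add: v_def field_simps)
  qed
  \<comment> \<open>Stationarity leaves the sign of \<open>v\<close> open. The negative part
    \<open>n\<close> satisfies \<open>a n \<le> w (S\<^sup>t n)\<close> entrywise; summation and
    duality then give \<open>\<eta> \<Sum> n \<le> 0\<close>.\<close>
  define n :: "real ^ 'n" where "n = (\<chi> i. max 0 (- v $ i))"
  have n0: "0 \<le> n $ i" for i by (simp add: n_def)
  have cn: "0 \<le> St_app n i" for i unfolding St_app_def using n0 by (intro sum_nonneg) auto
  have "a i * n $ i \<le> w $ i * St_app n i" for i
  proof (cases "v $ i < 0")
    case True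
    have "- St_app v i \<le> St_app n i" unfolding St_app_def sum_negf[symmetric]
      by (intro sum_mono) (auto simp: n_def max_def intro: order_trans[of _ 0] mult_nonneg_nonneg)
    then have "- (\<eta> + St_app v i) \<le> St_app n i" using \<eta> by linarith
    have "n $ i = u i * (- (\<eta> + St_app v i))" using True v_eq[of i] by (simp add: n_def algebra_simps)
    also have "\<dots> \<le> u i * St_app n i" using \<open>- (\<eta> + St_app v i) \<le> St_app n i\<close> u[of i] by (intro mult_left_mono) auto
    finally show ?thesis using a[of i] by (simp add: u_def field_simps)
  next
    case False
    then show ?thesis using cn[of i] wpos[of i] by (simp add: n_def)
  qed
  then have "(\<Sum>i\<in>UNIV. a i * n $ i) \<le> (\<Sum>i\<in>UNIV. w $ i * St_app n i)"
    by (intro sum_mono) auto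
  also have "\<dots> = (\<Sum>i\<in>UNIV. n $ i * S_app w i)" by (rule sum_S_app_St_app[symmetric])
  finally have "\<eta> * (\<Sum>i\<in>UNIV. n $ i) \<le> 0"
    by (simp add: a_def algebra_simps sum.distrib sum_distrib_left)
  then have "(\<Sum>i\<in>UNIV. n $ i) \<le> 0" using \<eta> by (simp add: mult_le_0_iff)
  then have "n $ i = 0" for i
    using n0 by (metis (no_types, lifting) sum_nonneg_eq_0_iff UNIV_I finite order_antisym sum_nonneg)
  then have "0 \<le> v $ i" for i by (metis max.cobounded2 neg_le_0_iff_le n_def vec_lambda_beta)
  then have "0 \<le> St_app v i" for i unfolding St_app_def by (intro sum_nonneg) auto
  then have c: "0 < \<eta> + St_app v i" for i using \<eta> by (simp add: add_pos_nonneg)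
  have vpos: "0 < v $ i" for i by (subst v_eq) (simp add: u c)
  have "u i * (\<tau> + a i * (\<eta> + St_app v i)) = 1" for i
    using stat[of i] a[of i] by (simp add: u_def field_simps)
  then have *: "x * u i * (\<tau> + a i * (\<eta> + St_app v i)) = x" for x i
    by (simp add: mult.assoc)
  have "sol \<tau> \<eta> v w" unfolding sol_def a_def[symmetric]
  proof (intro allI conjI vpos wpos)
    fix i
    show "v $ i * (\<tau> + a i * (\<eta> + St_app v i)) = \<eta> + St_app v i"
      using *[of "\<eta> + St_app v i" i] v_eq[of i] by (simp add: mult.commute)
    have "w $ i = u i * a i" using a[of i] by (simp add: u_def)
    then show "w $ i * (\<tau> + a i * (\<eta> + St_app v i)) = a i"
      using *[of "a i" i] by (simp add: mult.commute)
  qed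
  then show ?thesis by blast
qed

end

section \<open>Dependence on the regularization\<close>

lemma tendsto_of_sqrt_diff_sq:
  fixes f :: "'a \<Rightarrow> real"
  assumes "((\<lambda>x. (sqrt (f x) - sqrt a)\<^sup>2) \<longlongrightarrow> 0) F" "eventually (\<lambda>x. 0 \<le> f x) F" "0 \<le> a"
  shows "(f \<longlongrightarrow> a) F"
proof -
  have "((\<lambda>x. sqrt ((sqrt (f x) - sqrt a)\<^sup>2)) \<longlongrightarrow> sqrt 0) F"
    by (intro tendsto_intros assms(1))
  then have "((\<lambda>x. sqrt (f x) - sqrt a) \<longlongrightarrow> 0) F"
    by (simp add: tendsto_rabs_zero_iff)
  then have "((\<lambda>x. sqrt (f x)) \<longlongrightarrow> sqrt a) F"
    by (rule Lim_null[THEN iffD2])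
  then have "((\<lambda>x. (sqrt (f x))\<^sup>2) \<longlongrightarrow> (sqrt a)\<^sup>2) F"
    by (rule tendsto_power)
  then have "((\<lambda>x. (sqrt (f x))\<^sup>2) \<longlongrightarrow> a) F" using assms(3) by (simp only: real_sqrt_pow2)
  moreover have "eventually (\<lambda>x. (sqrt (f x))\<^sup>2 = f x) F"
    using assms(2) by eventually_elim simp
  ultimately show ?thesis by (rule Lim_transform_eventually)
qed

context irreducible_support begin

definition val :: "real \<Rightarrow> real \<Rightarrow> real ^ 'n \<Rightarrow> real ^ 'n \<Rightarrow> real" where
  "val \<tau> \<eta> v w = (\<Sum>i\<in>UNIV. \<tau> * ucoef \<tau> \<eta> v w i - ln (ucoef \<tau> \<eta> v w i)) + \<eta> * (\<Sum>i\<in>UNIV. w $ i)"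

lemma S_app_scale: "S_app (c *\<^sub>R w) i = c * S_app w i"
  by (simp add: S_app_def sum_distrib_left mult_ac)

text \<open>The constraint is homogeneous in \<open>(\<eta>, w)\<close>, so
  \<open>(\<eta> / \<eta>') w'\<close> is feasible at \<open>\<eta>\<close> with the same
  \<open>u\<close> as \<open>w'\<close> at \<open>\<eta>'\<close>. As a competitor it changes the
  objective by an exact multiple of \<open>\<eta>\<^sup>2 - \<eta>'\<^sup>2\<close>.\<close>

lemma val_scaling:
  assumes "sol \<tau> \<eta> v w" "sol \<tau> \<eta>' v' w'" "0 < \<tau>" "0 < \<eta>" "0 < \<eta>'"
  shows "val \<tau> \<eta> v w + \<eta> * (\<Sum>i\<in>UNIV. (sqrt (\<eta> / \<eta>' * w' $ i) - sqrt (w $ i))\<^sup>2)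
    \<le> val \<tau> \<eta>' v' w' + (\<eta>\<^sup>2 - \<eta>'\<^sup>2) * ((\<Sum>i\<in>UNIV. w' $ i) / \<eta>')"
proof -
  define c where "c = \<eta> / \<eta>'"
  have c: "0 < c" "c * \<eta>' = \<eta>" using assms by (auto simp: c_def)
  have le: "ucoef \<tau> \<eta>' v' w' i * (\<eta> + S_app (c *\<^sub>R w') i) \<le> (c *\<^sub>R w') $ i" for i
  proof -
    have "ucoef \<tau> \<eta>' v' w' i * (\<eta> + S_app (c *\<^sub>R w') i) = c * (ucoef \<tau> \<eta>' v' w' i * (\<eta>' + S_app w' i))"
      using c(2) by (simp add: S_app_scale algebra_simps)
    also have "\<dots> = c * w' $ i" using sol_w_eq[OF assms(2), of i] assms by simp
    finally show ?thesis by simp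
  qed
  have "0 \<le> \<tau> * (\<Sum>i\<in>UNIV. (sqrt (ucoef \<tau> \<eta>' v' w' i) - sqrt (ucoef \<tau> \<eta> v w i))\<^sup>2)"
    using assms by (simp add: sum_nonneg)
  then have "val \<tau> \<eta> v w + \<eta> * (\<Sum>i\<in>UNIV. (sqrt ((c *\<^sub>R w') $ i) - sqrt (w $ i))\<^sup>2)
    \<le> (\<Sum>i\<in>UNIV. \<tau> * ucoef \<tau> \<eta>' v' w' i - ln (ucoef \<tau> \<eta>' v' w' i)) + \<eta> * (\<Sum>i\<in>UNIV. (c *\<^sub>R w') $ i)"
    using value_le[OF assms(1,3) less_imp_le[OF assms(4)], of "ucoef \<tau> \<eta>' v' w'" "c *\<^sub>R w'"] le
      sol_ucoef_pos[OF assms(2)] sol_pos[OF assms(2)] assms c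
    by (simp add: val_def)
  also have "\<eta> * (\<Sum>i\<in>UNIV. (c *\<^sub>R w') $ i) = \<eta>\<^sup>2 * ((\<Sum>i\<in>UNIV. w' $ i) / \<eta>')"
    by (simp add: c_def sum_distrib_left sum_divide_distrib power2_eq_square mult_ac)
  also have "\<dots> = (\<eta>\<^sup>2 - \<eta>'\<^sup>2) * ((\<Sum>i\<in>UNIV. w' $ i) / \<eta>') + \<eta>' * (\<Sum>i\<in>UNIV. w' $ i)"
    using assms(5) by (simp add: field_simps power2_eq_square)
  finally show ?thesis by (simp add: val_def c_def)
qed

text \<open>Lowering \<open>\<eta>'\<close> to 0 relaxes the constraint, so the minimizer at
  \<open>\<eta>'\<close> is a competitor at 0.\<close>

lemma val_zero_le:
  assumes "sol \<tau> 0 v w" "sol \<tau> \<eta>' v' w'" "0 < \<tau>" "0 < \<eta>'"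
  shows "val \<tau> 0 v w \<le> val \<tau> \<eta>' v' w'"
proof -
  have le: "ucoef \<tau> \<eta>' v' w' i * (0 + S_app w' i) \<le> w' $ i" for i
  proof -
    have "ucoef \<tau> \<eta>' v' w' i * (0 + S_app w' i) \<le> ucoef \<tau> \<eta>' v' w' i * (\<eta>' + S_app w' i)"
      using sol_ucoef_pos[OF assms(2,3)] assms(4) by (intro mult_left_mono) (auto simp: less_imp_le)
    also have "\<dots> = w' $ i" using sol_w_eq[OF assms(2,3), of i] assms(4) by simp
    finally show ?thesis .
  qed
  have "0 \<le> \<tau> * (\<Sum>i\<in>UNIV. (sqrt (ucoef \<tau> \<eta>' v' w' i) - sqrt (ucoef \<tau> 0 v w i))\<^sup>2)"
    using assms by (simp add: sum_nonneg)
  then have "val \<tau> 0 v w \<le> (\<Sum>i\<in>UNIV. \<tau> * ucoef \<tau> \<eta>' v' w' i - ln (ucoef \<tau> \<eta>' v' w' i))"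
    using value_le[OF assms(1,3), of "ucoef \<tau> \<eta>' v' w'" w'] le
      sol_ucoef_pos[OF assms(2,3)] sol_pos[OF assms(2,3)] assms
    by (simp add: val_def)
  also have "\<dots> \<le> val \<tau> \<eta>' v' w'"
    using sol_pos[OF assms(2,3)] assms(4) by (simp add: val_def sum_nonneg less_imp_le)
  finally show ?thesis .
qed

text \<open>Each solution is a competitor for the other, so both gaps in \<open>value_le\<close>
  vanish; then \<open>sol_va\<close> determines \<open>v\<close>. The gap in \<open>w\<close>
  carries the factor \<open>\<eta>\<close>, whence \<open>\<eta> > 0\<close>.\<close>

lemma sol_unique:
  assumes "sol \<tau> \<eta> v w" "sol \<tau> \<eta> v' w'" "0 < \<tau>" "0 < \<eta>"
  shows "v' = v" "w' = w"
proof -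
  define u where "u = ucoef \<tau> \<eta> v w"
  define u' where "u' = ucoef \<tau> \<eta> v' w'"
  have nn: "0 \<le> \<eta>" using assms by simp
  note pos = sol_ucoef_pos[OF assms(1,3) nn, folded u_def] sol_ucoef_pos[OF assms(2,3) nn, folded u'_def]
    sol_pos[OF assms(1,3) nn] sol_pos[OF assms(2,3) nn]
  define p where "p = (\<Sum>i\<in>UNIV. (sqrt (u' i) - sqrt (u i))\<^sup>2)"
  define q where "q = (\<Sum>i\<in>UNIV. (sqrt (w' $ i) - sqrt (w $ i))\<^sup>2)"
  have pq: "0 \<le> p" "0 \<le> q" by (auto simp: p_def q_def sum_nonneg)
  have "val \<tau> \<eta> v w + \<tau> * p + \<eta> * q \<le> val \<tau> \<eta> v' w'"
    using value_le[OF assms(1,3) nn, of u' w'] pos sol_w_eq[OF assms(2,3) nn]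
    by (simp add: val_def p_def q_def u_def u'_def)
  moreover have "val \<tau> \<eta> v' w' + \<tau> * (\<Sum>i\<in>UNIV. (sqrt (u i) - sqrt (u' i))\<^sup>2)
      + \<eta> * (\<Sum>i\<in>UNIV. (sqrt (w $ i) - sqrt (w' $ i))\<^sup>2) \<le> val \<tau> \<eta> v w"
    using value_le[OF assms(2,3) nn, of u w] pos sol_w_eq[OF assms(1,3) nn]
    by (simp add: val_def u_def u'_def)
  then have "val \<tau> \<eta> v' w' + \<tau> * p + \<eta> * q \<le> val \<tau> \<eta> v w"
    unfolding p_def q_def by (simp only: power2_commute)
  moreover have "0 \<le> \<tau> * p" "0 \<le> \<eta> * q" using pq assms by auto
  ultimately have "\<tau> * p = 0" "\<eta> * q = 0" by linarith+
  then have "p = 0" "q = 0" using assms by auto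
  then have eq: "u' i = u i" "w' $ i = w $ i" for i
    unfolding p_def q_def by (auto simp: sum_nonneg_eq_0_iff)
  then show "w' = w" by (simp add: vec_eq_iff)
  have "v' $ i * (\<eta> + S_app w i) = v $ i * (\<eta> + S_app w i)" for i
    using sol_va[OF assms(1,3) nn, of i] sol_va[OF assms(2,3) nn, of i] eq(1)[of i] \<open>w' = w\<close>
    by (simp add: u_def u'_def)
  moreover have "\<eta> + S_app w i \<noteq> 0" for i using sol_ac_pos(1)[OF assms(1,3) nn, of i] by simp
  ultimately show "v' = v" by (simp add: vec_eq_iff)
qed

definition dyson_w :: "real \<Rightarrow> real \<Rightarrow> real ^ 'n" where
  "dyson_w \<tau> \<eta> = snd (THE (v, w). dyson_solution S \<tau> \<eta> v w)"

lemma sol_dyson: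
  assumes "0 < \<tau>" "0 < \<eta>"
  shows "sol \<tau> \<eta> (dyson_v S \<tau> \<eta>) (dyson_w \<tau> \<eta>)"
proof -
  obtain v w where vw: "sol \<tau> \<eta> v w" using exists_sol assms by blast
  have "(THE (v, w). dyson_solution S \<tau> \<eta> v w) = (v, w)"
  proof (rule the_equality)
    show "case (v, w) of (v, w) \<Rightarrow> dyson_solution S \<tau> \<eta> v w"
      using vw assms by (simp add: dyson_solution_iff_sol)
    show "p = (v, w)" if "case p of (v, w) \<Rightarrow> dyson_solution S \<tau> \<eta> v w" for p
      using that sol_unique[OF vw _ assms] assms by (cases p) (simp add: dyson_solution_iff_sol)
  qed
  then show ?thesis using vw by (simp add: dyson_v_def dyson_w_def)
qed

definition S_total :: real where "S_total = (\<Sum>i\<in>UNIV. \<Sum>j\<in>UNIV. S $ i $ j)"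

lemma S_total_nonneg: "0 \<le> S_total"
  by (simp add: S_total_def sum_nonneg)

lemma S_app_le: assumes "\<And>j. w $ j \<le> c" "0 \<le> c" shows "S_app w i \<le> S_total * c"
proof -
  have "S_app w i \<le> (\<Sum>j\<in>UNIV. S $ i $ j * c)"
    unfolding S_app_def using assms by (intro sum_mono mult_left_mono) auto
  also have "\<dots> = (\<Sum>j\<in>UNIV. S $ i $ j) * c" by (simp add: sum_distrib_right)
  also have "\<dots> \<le> S_total * c"
    unfolding S_total_def using assms(2)
    by (intro mult_right_mono member_le_sum[of i UNIV "\<lambda>i. \<Sum>j\<in>UNIV. S $ i $ j"]) (auto simp: sum_nonneg)
  finally show ?thesis .
qed

lemma St_app_le: assumes "\<And>j. v $ j \<le> c" "0 \<le> c" shows "St_app v i \<le> S_total * c"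
proof -
  have "St_app v i \<le> (\<Sum>j\<in>UNIV. S $ j $ i * c)"
    unfolding St_app_def using assms by (intro sum_mono mult_left_mono) auto
  also have "\<dots> = (\<Sum>j\<in>UNIV. S $ j $ i) * c" by (simp add: sum_distrib_right)
  also have "\<dots> \<le> S_total * c"
    unfolding S_total_def using assms(2)
    by (subst sum.swap, intro mult_right_mono member_le_sum[of i UNIV "\<lambda>i. \<Sum>j\<in>UNIV. S $ j $ i"]) (auto simp: sum_nonneg)
  finally show ?thesis .
qed

lemma sol_le_inverse:
  assumes "sol \<tau> \<eta> v w" "0 < \<tau>" "0 < \<eta>"
  shows "v $ i \<le> 1 / \<eta>" "w $ i \<le> 1 / \<eta>"
proof -
  have nn: "0 \<le> \<eta>" using assms by simp
  have u: "\<tau> * ucoef \<tau> \<eta> v w i > 0" using sol_ucoef_pos[OF assms(1,2) nn, of i] assms by simp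
  have "v $ i * \<eta> \<le> v $ i * (\<eta> + S_app w i)" "w $ i * \<eta> \<le> w $ i * (\<eta> + St_app v i)"
    using S_app_pos St_app_pos sol_pos[OF assms(1,2) nn] by (auto intro!: mult_left_mono simp: less_imp_le)
  then show "v $ i \<le> 1 / \<eta>" "w $ i \<le> 1 / \<eta>"
    using sol_va[OF assms(1,2) nn, of i] sol_wc[OF assms(1,2) nn, of i] u assms(3)
    by (auto simp: field_simps)
qed

section \<open>The minimal value as a function of \<open>\<eta>\<close>\<close>

context fixes \<tau> :: real assumes \<tau>: "0 < \<tau>" begin

definition Val :: "real \<Rightarrow> real" where "Val \<eta> = val \<tau> \<eta> (dyson_v S \<tau> \<eta>) (dyson_w \<tau> \<eta>)"
definition W_sum :: "real \<Rightarrow> real" where "W_sum \<eta> = (\<Sum>i\<in>UNIV. dyson_w \<tau> \<eta> $ i)"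

lemma W_sum_pos: "0 < \<eta> \<Longrightarrow> 0 < W_sum \<eta>"
  unfolding W_sum_def using sol_pos[OF sol_dyson] \<tau> by (intro sum_pos) auto

lemma W_sum_le: assumes "0 < \<eta>" shows "W_sum \<eta> \<le> real CARD('n) / \<eta>"
proof -
  have "W_sum \<eta> \<le> (\<Sum>i\<in>(UNIV :: 'n set). 1 / \<eta>)" unfolding W_sum_def
    using sol_le_inverse(2)[OF sol_dyson] \<tau> assms by (intro sum_mono) auto
  then show ?thesis by simp
qed

lemma avg_dyson_v: assumes "0 < \<eta>" shows "avg (dyson_v S \<tau> \<eta>) = W_sum \<eta> / real CARD('n)"
  using sol_sum_eq[OF sol_dyson[OF \<tau> assms]] \<tau> assms by (simp add: avg_def W_sum_def)

lemma Val_diff_le: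
  assumes "0 < \<eta>" "0 < \<eta>'"
  shows "Val \<eta> - Val \<eta>' \<le> (\<eta>\<^sup>2 - \<eta>'\<^sup>2) * (W_sum \<eta>' / \<eta>')"
proof -
  have "0 \<le> \<eta> * (\<Sum>i\<in>UNIV. (sqrt (\<eta> / \<eta>' * dyson_w \<tau> \<eta>' $ i) - sqrt (dyson_w \<tau> \<eta> $ i))\<^sup>2)"
    using assms by (simp add: sum_nonneg)
  then show ?thesis
    using val_scaling[OF sol_dyson sol_dyson, of \<tau> \<eta> \<eta>'] assms \<tau> by (simp add: Val_def W_sum_def)
qed

lemma Val_mono: assumes "0 < \<eta>" "\<eta> \<le> \<eta>'" shows "Val \<eta> \<le> Val \<eta>'"
proof -
  have "(\<eta>\<^sup>2 - \<eta>'\<^sup>2) * (W_sum \<eta>' / \<eta>') \<le> 0"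
    using assms W_sum_pos[of \<eta>'] by (intro mult_nonpos_nonneg) (auto simp: power_mono)
  then show ?thesis using Val_diff_le[of \<eta> \<eta>'] assms by simp
qed

text \<open>Comparing \<open>y\<close> with \<open>\<eta>\<close> and back makes the values cancel;
  what remains bounds the quadratic gap by a multiple of the distance of \<open>y\<^sup>2\<close>
  and \<open>\<eta>\<^sup>2\<close>.\<close>

lemma dyson_w_cont: assumes \<eta>: "0 < \<eta>" shows "isCont (\<lambda>\<eta>. dyson_w \<tau> \<eta> $ i) \<eta>"
proof -
  define q where "q y = (sqrt (\<eta> / y * dyson_w \<tau> y $ i) - sqrt (dyson_w \<tau> \<eta> $ i))\<^sup>2" for y
  define r where "r y = \<bar>y\<^sup>2 - \<eta>\<^sup>2\<bar> * (W_sum \<eta> / \<eta> + real CARD('n) / y / y) / \<eta>" for y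
  have ev: "eventually (\<lambda>y. 0 < y) (at \<eta>)"
    using eventually_at_in_open'[of "{0<..}" \<eta>] \<eta> by auto
  have "eventually (\<lambda>y. q y \<le> r y) (at \<eta>)"
    using ev
  proof eventually_elim
    fix y :: real assume y: "0 < y"
    have "q y \<le> (\<Sum>i\<in>UNIV. (sqrt (\<eta> / y * dyson_w \<tau> y $ i) - sqrt (dyson_w \<tau> \<eta> $ i))\<^sup>2)"
      unfolding q_def by (rule member_le_sum[where f = "\<lambda>i. (sqrt (\<eta> / y * dyson_w \<tau> y $ i) - sqrt (dyson_w \<tau> \<eta> $ i))\<^sup>2"]) auto
    then have "\<eta> * q y \<le> \<eta> * (\<Sum>i\<in>UNIV. (sqrt (\<eta> / y * dyson_w \<tau> y $ i) - sqrt (dyson_w \<tau> \<eta> $ i))\<^sup>2)"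
      using \<eta> by simp
    also have "\<dots> \<le> Val y - Val \<eta> + (\<eta>\<^sup>2 - y\<^sup>2) * (W_sum y / y)"
      using val_scaling[OF sol_dyson[OF \<tau> \<eta>] sol_dyson[OF \<tau> y] \<tau> \<eta> y] by (simp add: Val_def W_sum_def)
    also have "\<dots> \<le> (y\<^sup>2 - \<eta>\<^sup>2) * (W_sum \<eta> / \<eta>) + (\<eta>\<^sup>2 - y\<^sup>2) * (W_sum y / y)"
      using Val_diff_le[OF y \<eta>] by simp
    also have "\<dots> \<le> \<bar>y\<^sup>2 - \<eta>\<^sup>2\<bar> * (W_sum \<eta> / \<eta>) + \<bar>y\<^sup>2 - \<eta>\<^sup>2\<bar> * (W_sum y / y)"
      using W_sum_pos[OF \<eta>] W_sum_pos[OF y] \<eta> y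
      by (intro add_mono mult_right_mono) auto
    also have "\<dots> \<le> \<bar>y\<^sup>2 - \<eta>\<^sup>2\<bar> * (W_sum \<eta> / \<eta>) + \<bar>y\<^sup>2 - \<eta>\<^sup>2\<bar> * (real CARD('n) / y / y)"
      using W_sum_le[OF y] y \<eta> by (intro add_mono mult_left_mono divide_right_mono) auto
    finally show "q y \<le> r y" using \<eta> by (simp add: r_def field_simps)
  qed
  moreover have "(r \<longlongrightarrow> \<bar>\<eta>\<^sup>2 - \<eta>\<^sup>2\<bar> * (W_sum \<eta> / \<eta> + real CARD('n) / \<eta> / \<eta>) / \<eta>) (at \<eta>)"
    unfolding r_def using \<eta> by (intro tendsto_intros) auto
  then have "(r \<longlongrightarrow> 0) (at \<eta>)" by simp
  ultimately have "(q \<longlongrightarrow> 0) (at \<eta>)"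
    by (intro tendsto_sandwich[of "\<lambda>_. 0" q _ r]) (auto simp: q_def)
  then have "((\<lambda>y. \<eta> / y * dyson_w \<tau> y $ i) \<longlongrightarrow> dyson_w \<tau> \<eta> $ i) (at \<eta>)"
    unfolding q_def
  proof (rule tendsto_of_sqrt_diff_sq)
    show "\<forall>\<^sub>F y in at \<eta>. 0 \<le> \<eta> / y * dyson_w \<tau> y $ i"
      using ev by eventually_elim (use sol_pos(2)[OF sol_dyson] \<tau> \<eta> in \<open>auto simp: less_imp_le\<close>)
    show "0 \<le> dyson_w \<tau> \<eta> $ i" using sol_pos(2)[OF sol_dyson] \<tau> \<eta> by (auto simp: less_imp_le)
  qed
  then have "((\<lambda>y. y / \<eta> * (\<eta> / y * dyson_w \<tau> y $ i)) \<longlongrightarrow> \<eta> / \<eta> * dyson_w \<tau> \<eta> $ i) (at \<eta>)"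
    using \<eta> by (intro tendsto_intros) auto
  then have "((\<lambda>y. y / \<eta> * (\<eta> / y * dyson_w \<tau> y $ i)) \<longlongrightarrow> dyson_w \<tau> \<eta> $ i) (at \<eta>)"
    using \<eta> by simp
  moreover have "eventually (\<lambda>y. y / \<eta> * (\<eta> / y * dyson_w \<tau> y $ i) = dyson_w \<tau> y $ i) (at \<eta>)"
    using ev by eventually_elim (use \<eta> in simp)
  ultimately have "((\<lambda>y. dyson_w \<tau> y $ i) \<longlongrightarrow> dyson_w \<tau> \<eta> $ i) (at \<eta>)"
    by (rule Lim_transform_eventually)
  then show ?thesis by (simp add: isCont_def)
qed

lemma W_sum_cont: "0 < \<eta> \<Longrightarrow> isCont W_sum \<eta>"
  unfolding W_sum_def[abs_def] by (intro continuous_sum dyson_w_cont)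

text \<open>The competitor inequality in both directions encloses the difference quotient between
  \<open>(y + \<eta>) * g y\<close> and \<open>(y + \<eta>) * g \<eta>\<close>, and \<open>g\<close>
  is continuous.\<close>

lemma Val_DERIV:
  assumes \<eta>: "0 < \<eta>"
  shows "(Val has_field_derivative 2 * W_sum \<eta>) (at \<eta>)"
proof -
  define g where "g y = W_sum y / y" for y
  define d where "d y = (y + \<eta>) * \<bar>g y - g \<eta>\<bar>" for y
  have gcont: "(g \<longlongrightarrow> g \<eta>) (at \<eta>)"
    unfolding g_def using W_sum_cont[OF \<eta>] \<eta> by (intro tendsto_intros) (auto simp: isCont_def)
  have "eventually (\<lambda>y. 0 < y) (at \<eta>)"
    using eventually_at_in_open'[of "{0<..}" \<eta>] \<eta> by auto
  moreover have "eventually (\<lambda>y. y \<noteq> \<eta>) (at \<eta>)" by (simp add: eventually_at_filter)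
  ultimately have "eventually (\<lambda>y. norm ((Val y - Val \<eta>) / (y - \<eta>) - (y + \<eta>) * g \<eta>) \<le> d y) (at \<eta>)"
  proof eventually_elim
    case (elim y)
    have sq: "y\<^sup>2 - \<eta>\<^sup>2 = (y - \<eta>) * (y + \<eta>)" by (simp add: power2_eq_square algebra_simps)
    have 1: "Val y - Val \<eta> \<le> (y - \<eta>) * (y + \<eta>) * g \<eta>"
      using Val_diff_le[of y \<eta>] elim \<eta> unfolding sq g_def by simp
    have sq': "\<eta>\<^sup>2 - y\<^sup>2 = - ((y - \<eta>) * (y + \<eta>))" by (simp add: power2_eq_square algebra_simps)
    have 2: "Val y - Val \<eta> \<ge> (y - \<eta>) * (y + \<eta>) * g y"
      using Val_diff_le[of \<eta> y] elim \<eta> unfolding sq' g_def by simp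
    have "\<bar>Val y - Val \<eta> - (y - \<eta>) * (y + \<eta>) * g \<eta>\<bar> \<le> \<bar>(y - \<eta>) * (y + \<eta>) * g y - (y - \<eta>) * (y + \<eta>) * g \<eta>\<bar>"
      using 1 2 by linarith
    also have "\<dots> = \<bar>y - \<eta>\<bar> * d y"
      using elim \<eta> by (simp add: d_def abs_mult[symmetric] right_diff_distrib[symmetric]) (simp add: abs_mult)
    finally have "\<bar>Val y - Val \<eta> - (y - \<eta>) * (y + \<eta>) * g \<eta>\<bar> / \<bar>y - \<eta>\<bar> \<le> d y"
      using elim by (simp add: field_simps)
    then have "\<bar>(Val y - Val \<eta> - (y - \<eta>) * (y + \<eta>) * g \<eta>) / (y - \<eta>)\<bar> \<le> d y" by (simp add: abs_divide)
    also have "(Val y - Val \<eta> - (y - \<eta>) * (y + \<eta>) * g \<eta>) / (y - \<eta>) = (Val y - Val \<eta>) / (y - \<eta>) - (y + \<eta>) * g \<eta>"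
      using elim by (simp add: diff_divide_distrib)
    finally show ?case by simp
  qed
  moreover have "(d \<longlongrightarrow> (\<eta> + \<eta>) * \<bar>g \<eta> - g \<eta>\<bar>) (at \<eta>)"
    unfolding d_def by (intro tendsto_intros gcont)
  then have "(d \<longlongrightarrow> 0) (at \<eta>)" by simp
  ultimately have "((\<lambda>y. (Val y - Val \<eta>) / (y - \<eta>) - (y + \<eta>) * g \<eta>) \<longlongrightarrow> 0) (at \<eta>)"
    by (rule Lim_null_comparison)
  moreover have "((\<lambda>y. (y + \<eta>) * g \<eta>) \<longlongrightarrow> (\<eta> + \<eta>) * g \<eta>) (at \<eta>)"
    by (intro tendsto_intros)
  ultimately have "((\<lambda>y. ((Val y - Val \<eta>) / (y - \<eta>) - (y + \<eta>) * g \<eta>) + (y + \<eta>) * g \<eta>) \<longlongrightarrow> 0 + (\<eta> + \<eta>) * g \<eta>) (at \<eta>)"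
    by (rule tendsto_add)
  then show ?thesis using \<eta> by (simp add: has_field_derivative_iff g_def)
qed

text \<open>For large \<open>\<eta>\<close> the terms \<open>S w\<close> and
  \<open>S\<^sup>t v\<close> are negligible against \<open>\<eta>\<close>, so \<open>u\<close>
  behaves like \<open>1 / \<eta>\<^sup>2\<close>: each index contributes \<open>2 ln \<eta>\<close>
  from \<open>- ln u\<close> and 1 from \<open>\<eta> w\<close>.\<close>

lemma Val_at_top:
  "((\<lambda>\<eta>. Val \<eta> - 2 * real CARD('n) * ln (1 + \<eta>)) \<longlongrightarrow> real CARD('n)) at_top"
proof -
  define u where "u \<eta> i = ucoef \<tau> \<eta> (dyson_v S \<tau> \<eta>) (dyson_w \<tau> \<eta>) i" for \<eta> i
  define a where "a \<eta> i = \<eta> + S_app (dyson_w \<tau> \<eta>) i" for \<eta> i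
  define c where "c \<eta> i = \<eta> + St_app (dyson_v S \<tau> \<eta>) i" for \<eta> i
  have lim0: "((\<lambda>\<eta>. S_total * (1 / \<eta>) / \<eta>) \<longlongrightarrow> 0) at_top" by real_asymp
  have pos: "eventually (\<lambda>\<eta>::real. 0 < \<eta>) at_top" by (rule eventually_gt_at_top)
  have a: "((\<lambda>\<eta>. a \<eta> i / \<eta>) \<longlongrightarrow> 1) at_top" for i
  proof -
    have "((\<lambda>\<eta>. S_app (dyson_w \<tau> \<eta>) i / \<eta>) \<longlongrightarrow> 0) at_top"
    proof (rule tendsto_sandwich[OF _ _ tendsto_const lim0])
      show "\<forall>\<^sub>F \<eta> in at_top. 0 \<le> S_app (dyson_w \<tau> \<eta>) i / \<eta>"
        using pos by eventually_elim (use S_app_pos[OF sol_pos(2)[OF sol_dyson]] \<tau> in \<open>auto simp: less_imp_le\<close>)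
      show "\<forall>\<^sub>F \<eta> in at_top. S_app (dyson_w \<tau> \<eta>) i / \<eta> \<le> S_total * (1 / \<eta>) / \<eta>"
        using pos by eventually_elim
          (intro divide_right_mono S_app_le; use sol_le_inverse(2)[OF sol_dyson] \<tau> in auto)
    qed
    then have "((\<lambda>\<eta>. 1 + S_app (dyson_w \<tau> \<eta>) i / \<eta>) \<longlongrightarrow> 1 + 0) at_top" by (intro tendsto_intros)
    then have "((\<lambda>\<eta>. 1 + S_app (dyson_w \<tau> \<eta>) i / \<eta>) \<longlongrightarrow> 1) at_top" by simp
    moreover have "eventually (\<lambda>\<eta>. 1 + S_app (dyson_w \<tau> \<eta>) i / \<eta> = a \<eta> i / \<eta>) at_top"
      using pos by eventually_elim (simp add: a_def add_divide_distrib)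
    ultimately show ?thesis by (rule Lim_transform_eventually)
  qed
  have c: "((\<lambda>\<eta>. c \<eta> i / \<eta>) \<longlongrightarrow> 1) at_top" for i
  proof -
    have "((\<lambda>\<eta>. St_app (dyson_v S \<tau> \<eta>) i / \<eta>) \<longlongrightarrow> 0) at_top"
    proof (rule tendsto_sandwich[OF _ _ tendsto_const lim0])
      show "\<forall>\<^sub>F \<eta> in at_top. 0 \<le> St_app (dyson_v S \<tau> \<eta>) i / \<eta>"
        using pos by eventually_elim (use St_app_pos[OF sol_pos(1)[OF sol_dyson]] \<tau> in \<open>auto simp: less_imp_le\<close>)
      show "\<forall>\<^sub>F \<eta> in at_top. St_app (dyson_v S \<tau> \<eta>) i / \<eta> \<le> S_total * (1 / \<eta>) / \<eta>"
        using pos by eventually_elim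
          (intro divide_right_mono St_app_le; use sol_le_inverse(1)[OF sol_dyson] \<tau> in auto)
    qed
    then have "((\<lambda>\<eta>. 1 + St_app (dyson_v S \<tau> \<eta>) i / \<eta>) \<longlongrightarrow> 1 + 0) at_top" by (intro tendsto_intros)
    then have "((\<lambda>\<eta>. 1 + St_app (dyson_v S \<tau> \<eta>) i / \<eta>) \<longlongrightarrow> 1) at_top" by simp
    moreover have "eventually (\<lambda>\<eta>. 1 + St_app (dyson_v S \<tau> \<eta>) i / \<eta> = c \<eta> i / \<eta>) at_top"
      using pos by eventually_elim (simp add: c_def add_divide_distrib)
    ultimately show ?thesis by (rule Lim_transform_eventually)
  qed
  have u: "((\<lambda>\<eta>. \<eta>\<^sup>2 * u \<eta> i) \<longlongrightarrow> 1) at_top" for i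
  proof -
    have "((\<lambda>\<eta>. 1 / (\<tau> / \<eta>\<^sup>2 + (a \<eta> i / \<eta>) * (c \<eta> i / \<eta>))) \<longlongrightarrow> 1 / (0 + 1 * 1)) at_top"
      by (intro tendsto_intros a c) (real_asymp, simp)
    then have "((\<lambda>\<eta>. 1 / (\<tau> / \<eta>\<^sup>2 + (a \<eta> i / \<eta>) * (c \<eta> i / \<eta>))) \<longlongrightarrow> 1) at_top" by simp
    then show ?thesis
    proof (rule Lim_transform_eventually)
      show "\<forall>\<^sub>F \<eta> in at_top. 1 / (\<tau> / \<eta>\<^sup>2 + (a \<eta> i / \<eta>) * (c \<eta> i / \<eta>)) = \<eta>\<^sup>2 * u \<eta> i"
        using pos
      proof eventually_elim
        case (elim \<eta>)
        have "\<tau> / \<eta>\<^sup>2 + (a \<eta> i / \<eta>) * (c \<eta> i / \<eta>) = (\<tau> + a \<eta> i * c \<eta> i) / \<eta>\<^sup>2"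
          by (simp add: power2_eq_square add_divide_distrib)
        then show ?case by (simp add: u_def ucoef_def a_def c_def)
      qed
    qed
  qed
  have upos: "0 < u \<eta> i" if "0 < \<eta>" for \<eta> i
    using sol_ucoef_pos[OF sol_dyson[OF \<tau> that] \<tau>] that by (simp add: u_def)
  have "((\<lambda>\<eta>. (\<Sum>i\<in>UNIV. \<tau> * (\<eta>\<^sup>2 * u \<eta> i) * (1 / \<eta>\<^sup>2) - ln (\<eta>\<^sup>2 * u \<eta> i) + (\<eta>\<^sup>2 * u \<eta> i) * (a \<eta> i / \<eta>))
      - 2 * real CARD('n) * (ln (1 + \<eta>) - ln \<eta>))
     \<longlongrightarrow> (\<Sum>i\<in>(UNIV :: 'n set). \<tau> * 1 * 0 - ln 1 + 1 * 1) - 2 * real CARD('n) * 0) at_top"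
  proof (intro tendsto_diff tendsto_sum tendsto_add tendsto_mult tendsto_ln tendsto_const u a)
    show "((\<lambda>\<eta>::real. 1 / \<eta>\<^sup>2) \<longlongrightarrow> 0) at_top" by real_asymp
    show "((\<lambda>\<eta>::real. ln (1 + \<eta>) - ln \<eta>) \<longlongrightarrow> 0) at_top" by real_asymp
  qed auto
  then have "((\<lambda>\<eta>. (\<Sum>i\<in>UNIV. \<tau> * (\<eta>\<^sup>2 * u \<eta> i) * (1 / \<eta>\<^sup>2) - ln (\<eta>\<^sup>2 * u \<eta> i) + (\<eta>\<^sup>2 * u \<eta> i) * (a \<eta> i / \<eta>))
      - 2 * real CARD('n) * (ln (1 + \<eta>) - ln \<eta>)) \<longlongrightarrow> real CARD('n)) at_top" by simp
  then show ?thesis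
  proof (rule Lim_transform_eventually)
    show "\<forall>\<^sub>F \<eta> in at_top. (\<Sum>i\<in>UNIV. \<tau> * (\<eta>\<^sup>2 * u \<eta> i) * (1 / \<eta>\<^sup>2) - ln (\<eta>\<^sup>2 * u \<eta> i) + (\<eta>\<^sup>2 * u \<eta> i) * (a \<eta> i / \<eta>))
      - 2 * real CARD('n) * (ln (1 + \<eta>) - ln \<eta>) = Val \<eta> - 2 * real CARD('n) * ln (1 + \<eta>)"
      using pos
    proof eventually_elim
      case (elim \<eta>)
      have w: "dyson_w \<tau> \<eta> $ i = u \<eta> i * a \<eta> i" for i
        using sol_w_eq[OF sol_dyson[OF \<tau> elim] \<tau>] elim by (simp add: u_def a_def)
      have "\<tau> * (\<eta>\<^sup>2 * u \<eta> i) * (1 / \<eta>\<^sup>2) - ln (\<eta>\<^sup>2 * u \<eta> i) + (\<eta>\<^sup>2 * u \<eta> i) * (a \<eta> i / \<eta>)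
         = (\<tau> * u \<eta> i - ln (u \<eta> i)) + \<eta> * dyson_w \<tau> \<eta> $ i - 2 * ln \<eta>" for i
      proof -
        have "ln (\<eta>\<^sup>2 * u \<eta> i) = 2 * ln \<eta> + ln (u \<eta> i)"
          using elim upos[OF elim, of i] by (simp add: ln_mult_pos ln_realpow)
        moreover have "\<tau> * (\<eta>\<^sup>2 * u \<eta> i) * (1 / \<eta>\<^sup>2) = \<tau> * u \<eta> i"
          using elim by simp
        moreover have "(\<eta>\<^sup>2 * u \<eta> i) * (a \<eta> i / \<eta>) = \<eta> * dyson_w \<tau> \<eta> $ i"
          using elim unfolding w by (simp add: power2_eq_square)
        ultimately show ?thesis by (simp only:)
      qed
      then have "(\<Sum>i\<in>UNIV. \<tau> * (\<eta>\<^sup>2 * u \<eta> i) * (1 / \<eta>\<^sup>2) - ln (\<eta>\<^sup>2 * u \<eta> i) + (\<eta>\<^sup>2 * u \<eta> i) * (a \<eta> i / \<eta>))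
        = (\<Sum>i\<in>UNIV. (\<tau> * u \<eta> i - ln (u \<eta> i)) + \<eta> * dyson_w \<tau> \<eta> $ i - 2 * ln \<eta>)"
        by (intro sum.cong refl)
      also have "\<dots> = Val \<eta> - 2 * real CARD('n) * ln \<eta>"
        unfolding Val_def val_def u_def sum.distrib sum_subtractf sum_distrib_left sum_constant by simp
      finally show ?case by (simp add: right_diff_distrib)
    qed
  qed
qed

end
end

section \<open>Evaluation of the integral in the definition of the density\<close>

lemma set_integral_FTC_Ioi_nonneg:
  fixes f F :: "real \<Rightarrow> real"
  assumes "\<And>x. 0 < x \<Longrightarrow> (F has_field_derivative f x) (at x)" "\<And>x. 0 < x \<Longrightarrow> isCont f x"
    "\<And>x. 0 < x \<Longrightarrow> 0 \<le> f x" "(F \<longlongrightarrow> A) (at_right 0)" "(F \<longlongrightarrow> B) at_top"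
  shows "set_integrable lborel {0<..} f" "set_lebesgue_integral lborel {0<..} f = B - A"
proof -
  have A: "((F \<circ> real_of_ereal) \<longlongrightarrow> A) (at_right 0)"
    using assms(4) by (simp add: ereal_tendsto_simps zero_ereal_def)
  have B: "((F \<circ> real_of_ereal) \<longlongrightarrow> B) (at_left \<infinity>)"
    using assms(5) by (simp add: ereal_tendsto_simps)
  have *: "set_integrable lborel (einterval 0 \<infinity>) f"
    by (rule interval_integral_FTC_nonneg(1)[OF _ _ _ _ A B]) (use assms in auto)
  have **: "(LBINT x=0..\<infinity>. f x) = B - A"
    by (rule interval_integral_FTC_nonneg(2)[OF _ _ _ _ A B]) (use assms in auto)
  have "einterval 0 \<infinity> = {0::real<..}" by (auto simp: einterval_def)
  then show "set_integrable lborel {0<..} f" "set_lebesgue_integral lborel {0<..} f = B - A"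
    using * ** by (simp_all add: interval_lebesgue_integral_def)
qed

context irreducible_support begin

text \<open>The integrand need not have a fixed sign, while the fundamental theorem on the half-line
  is used for non-negative functions. Adding \<open>p \<eta> = C / (1 + \<eta>)\<^sup>2\<close>
  makes it non-negative; the integral of \<open>p\<close> is computed separately and
  subtracted.\<close>

lemma integral_eq:
  assumes \<tau>: "0 < \<tau>" and lim: "(Val \<tau> \<longlongrightarrow> V0) (at_right 0)"
  shows "set_lebesgue_integral lborel {0<..} (\<lambda>\<eta>. avg (dyson_v S \<tau> \<eta>) - 1 / (1 + \<eta>))
     = 1 / 2 - V0 / (2 * real CARD('n))"
proof -
  define K where "K = real CARD('n)"
  have K: "0 < K" by (simp add: K_def)
  define D where "D = S_total + \<tau>"
  have D: "0 < D" using S_total_nonneg \<tau> by (simp add: D_def add_nonneg_pos)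
  \<comment> \<open>By \<open>v \<ge> \<eta> / (\<eta>\<^sup>2 + D)\<close> the integrand is at
    least \<open>- (D - \<eta>) / ((\<eta>\<^sup>2 + D) (1 + \<eta>))\<close>, and
    \<open>C = D + 2\<close> is enough for \<open>p\<close> to compensate this.\<close>
  define C where "C = D + 2"
  define f where "f \<eta> = W_sum \<tau> \<eta> / K - 1 / (1 + \<eta>)" for \<eta>
  define p where "p \<eta> = C / (1 + \<eta>)\<^sup>2" for \<eta> :: real
  define G where "G \<eta> = Val \<tau> \<eta> / (2 * K) - ln (1 + \<eta>) - C / (1 + \<eta>)" for \<eta>
  have fp: "0 \<le> f \<eta> + p \<eta>" if \<eta>: "0 < \<eta>" for \<eta>
  proof -
    note sol = sol_dyson[OF \<tau> \<eta>]
    have lower: "\<eta> / (\<eta>\<^sup>2 + D) \<le> dyson_v S \<tau> \<eta> $ i" for i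
    proof -
      define a where "a = \<eta> + S_app (dyson_w \<tau> \<eta>) i"
      define c where "c = \<eta> + St_app (dyson_v S \<tau> \<eta>) i"
      have a: "\<eta> \<le> a" and c: "\<eta> \<le> c"
        using S_app_pos[OF sol_pos(2)[OF sol \<tau>]] St_app_pos[OF sol_pos(1)[OF sol \<tau>]] \<eta>
        by (auto simp: a_def c_def less_imp_le)
      have "a \<le> \<eta> + S_total * (1 / \<eta>)"
        unfolding a_def using sol_le_inverse(2)[OF sol \<tau> \<eta>] \<eta> by (intro add_left_mono S_app_le) auto
      then have "a * \<eta> \<le> (\<eta> + S_total * (1 / \<eta>)) * \<eta>" using \<eta> by (intro mult_right_mono) auto
      also have "(\<eta> + S_total * (1 / \<eta>)) * \<eta> = \<eta>\<^sup>2 + S_total"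
        using \<eta> by (simp add: distrib_right power2_eq_square)
      finally have ae: "a * \<eta> \<le> \<eta>\<^sup>2 + S_total" .
      have "\<eta> * (\<tau> + a * c) \<le> c * \<tau> + c * (a * \<eta>)"
        using mult_right_mono[OF c less_imp_le[OF \<tau>]] by (simp add: algebra_simps)
      also have "\<dots> \<le> c * \<tau> + c * (\<eta>\<^sup>2 + S_total)"
        using ae c \<eta> by (intro add_left_mono mult_left_mono) auto
      also have "\<dots> = c * (\<eta>\<^sup>2 + D)" by (simp add: D_def algebra_simps)
      finally have *: "\<eta> * (\<tau> + a * c) \<le> c * (\<eta>\<^sup>2 + D)" .
      have pos: "0 < \<eta>\<^sup>2 + D" using D by (simp add: add_nonneg_pos)
      have "0 < a * c" using a c \<eta> by auto
      then have pos2: "0 < \<tau> + a * c" using \<tau> by simp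
      have "dyson_v S \<tau> \<eta> $ i = c / (\<tau> + a * c)"
        using sol_v_eq[OF sol \<tau>, of i] \<eta> by (simp add: ucoef_def a_def c_def)
      moreover have "\<eta> / (\<eta>\<^sup>2 + D) \<le> c / (\<tau> + a * c)"
        using * pos pos2 by (simp add: frac_le_eq divide_le_eq le_divide_eq)
      ultimately show ?thesis by simp
    qed
    have "K * (\<eta> / (\<eta>\<^sup>2 + D)) = (\<Sum>i\<in>(UNIV :: 'n set). \<eta> / (\<eta>\<^sup>2 + D))" by (simp add: K_def)
    also have "\<dots> \<le> (\<Sum>i\<in>UNIV. dyson_v S \<tau> \<eta> $ i)" using lower by (intro sum_mono) auto
    also have "\<dots> = W_sum \<tau> \<eta>" using sol_sum_eq[OF sol \<tau>] \<eta> by (simp add: W_sum_def[OF \<tau>])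
    finally have 1: "\<eta> / (\<eta>\<^sup>2 + D) \<le> W_sum \<tau> \<eta> / K" using K by (simp add: field_simps)
    have pos: "0 < \<eta>\<^sup>2 + D" using D by (simp add: add_nonneg_pos)
    have "2 * \<eta> \<le> \<eta>\<^sup>2 + 1" using sum_squares_ge_zero[of "\<eta> - 1" 0] by (simp add: power2_eq_square algebra_simps)
    then have "D * (2 * \<eta>) \<le> D * (\<eta>\<^sup>2 + 1)" using D by (intro mult_left_mono) auto
    moreover have "0 \<le> D * \<eta>" using D \<eta> by simp
    ultimately have "D * \<eta> \<le> D * \<eta>\<^sup>2 + D" by (simp add: distrib_left)
    moreover have "0 \<le> 2 * \<eta>\<^sup>2" "0 < D * D" "0 < \<eta> * \<eta>" using \<eta> D by auto
    moreover have "C * (\<eta>\<^sup>2 + D) - (D - \<eta>) * (1 + \<eta>)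
      = (D * \<eta>\<^sup>2 + D - D * \<eta>) + 3 * (\<eta> * \<eta>) + D * D + \<eta>"
      by (simp add: C_def power2_eq_square algebra_simps)
    ultimately have "(D - \<eta>) * (1 + \<eta>) \<le> C * (\<eta>\<^sup>2 + D)"
      using \<eta> by linarith
    then have "(\<eta>\<^sup>2 + D) * (1 + \<eta>) \<le> \<eta> * (1 + \<eta>)\<^sup>2 + C * (\<eta>\<^sup>2 + D)"
      by (simp add: algebra_simps power2_eq_square)
    then have "(\<eta>\<^sup>2 + D) * (1 + \<eta>) / ((\<eta>\<^sup>2 + D) * (1 + \<eta>)\<^sup>2) \<le> (\<eta> * (1 + \<eta>)\<^sup>2 + C * (\<eta>\<^sup>2 + D)) / ((\<eta>\<^sup>2 + D) * (1 + \<eta>)\<^sup>2)"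
      using pos by (intro divide_right_mono) auto
    also have "(\<eta>\<^sup>2 + D) * (1 + \<eta>) / ((\<eta>\<^sup>2 + D) * (1 + \<eta>)\<^sup>2) = 1 / (1 + \<eta>)"
      using pos \<eta> by (simp add: power2_eq_square)
    also have "(\<eta> * (1 + \<eta>)\<^sup>2 + C * (\<eta>\<^sup>2 + D)) / ((\<eta>\<^sup>2 + D) * (1 + \<eta>)\<^sup>2) = \<eta> / (\<eta>\<^sup>2 + D) + p \<eta>"
      using pos \<eta> by (simp add: p_def add_divide_distrib)
    finally show ?thesis using 1 by (simp add: f_def)
  qed
  have dG: "(G has_field_derivative f x + p x) (at x)" if "0 < x" for x
    unfolding G_def f_def p_def
    using that K by (auto intro!: derivative_eq_intros Val_DERIV[OF \<tau>] simp: power2_eq_square)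
  have cont: "isCont (\<lambda>x. f x + p x) x" if "0 < x" for x
    unfolding f_def p_def using that K W_sum_cont[OF \<tau>] by (intro continuous_intros) auto
  have "(G \<longlongrightarrow> V0 / (2 * K) - ln (1 + 0) - C / (1 + 0)) (at_right 0)"
    unfolding G_def using K by (intro tendsto_intros lim) auto
  then have G0: "(G \<longlongrightarrow> V0 / (2 * K) - C) (at_right 0)" by simp
  have "((\<lambda>\<eta>. (Val \<tau> \<eta> - 2 * K * ln (1 + \<eta>)) / (2 * K) - C / (1 + \<eta>)) \<longlongrightarrow> K / (2 * K) - 0) at_top"
    using K Val_at_top[OF \<tau>] by (intro tendsto_intros) (auto simp: K_def, real_asymp)
  moreover have "(\<lambda>\<eta>. (Val \<tau> \<eta> - 2 * K * ln (1 + \<eta>)) / (2 * K) - C / (1 + \<eta>)) = G"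
    using K by (auto simp: G_def fun_eq_iff diff_divide_distrib)
  ultimately have Gtop: "(G \<longlongrightarrow> 1 / 2) at_top" using K by simp
  note I1 = set_integral_FTC_Ioi_nonneg[OF dG cont fp G0 Gtop]
  define H where "H \<eta> = - C / (1 + \<eta>)" for \<eta> :: real
  have dH: "(H has_field_derivative p x) (at x)" if "0 < x" for x
    unfolding H_def p_def using that by (auto intro!: derivative_eq_intros simp: power2_eq_square)
  have contp: "isCont p x" if "0 < x" for x
    unfolding p_def using that by (intro continuous_intros) auto
  have p: "0 \<le> p x" for x using D by (simp add: p_def C_def)
  have "(H \<longlongrightarrow> - C / (1 + 0)) (at_right 0)" unfolding H_def by (intro tendsto_intros) auto
  then have H0: "(H \<longlongrightarrow> - C) (at_right 0)" by simp
  have Htop: "(H \<longlongrightarrow> 0) at_top" unfolding H_def by real_asymp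
  note I2 = set_integral_FTC_Ioi_nonneg[OF dH contp p H0 Htop]
  have "set_lebesgue_integral lborel {0<..} (\<lambda>\<eta>. avg (dyson_v S \<tau> \<eta>) - 1 / (1 + \<eta>))
    = set_lebesgue_integral lborel {0<..} (\<lambda>\<eta>. (f \<eta> + p \<eta>) - p \<eta>)"
    by (rule set_lebesgue_integral_cong) (auto simp: f_def avg_dyson_v[OF \<tau>] K_def)
  also have "\<dots> = (1 / 2 - (V0 / (2 * K) - C)) - (0 - - C)"
    using I1 I2 by (subst set_integral_diff) auto
  finally show ?thesis by (simp add: K_def)
qed


section \<open>The solution without regularization\<close>

definition conn :: "'n \<Rightarrow> 'n \<Rightarrow> nat" where
  "conn i j = (SOME m. 0 < mat_power S m $ i $ j)"

lemma conn: "0 < mat_power S (conn i j) $ i $ j"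
  using irr someI_ex[of "\<lambda>m. 0 < mat_power S m $ i $ j"]
  unfolding irreducible_matrix_def conn_def by blast

text \<open>Only single terms \<open>S $ i $ k * w k\<close> are controlled, not their sum over
  \<open>k\<close>; dividing \<open>c\<close> by the number of indices in each step makes room for
  the sum in the matrix product.\<close>

lemma mat_power_propagate:
  assumes "\<And>i j. c * (S $ i $ j * w j) \<le> w i" "0 \<le> c" "\<And>i. 0 \<le> w i"
  shows "(c / real CARD('n)) ^ m * (mat_power S m $ i $ j * w j) \<le> w i"
proof (induction m arbitrary: i)
  case 0
  show ?case using assms(3) by (simp add: mat_def)
next
  case (Suc m)
  define K where "K = real CARD('n)"
  have K: "0 < K" by (simp add: K_def)
  have "(c / K) ^ Suc m * (mat_power S (Suc m) $ i $ j * w j)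
    = (\<Sum>k\<in>UNIV. (c / K) * (S $ i $ k * ((c / K) ^ m * (mat_power S m $ k $ j * w j))))"
    by (simp add: matrix_matrix_mult_def sum_distrib_left sum_distrib_right mult_ac)
  also have "\<dots> \<le> (\<Sum>k\<in>UNIV. (c / K) * (S $ i $ k * w k))"
    using Suc.IH assms(2) K unfolding K_def by (intro sum_mono mult_left_mono) auto
  also have "\<dots> \<le> (\<Sum>k\<in>(UNIV :: 'n set). w i / K)"
    using assms(1)[of i] K by (intro sum_mono) (simp add: divide_right_mono)
  also have "\<dots> = w i" using K by (simp add: K_def)
  finally show ?case by (simp add: K_def)
qed

text \<open>A Harnack inequality: irreducibility joins any two indices by a chain of positive
  entries, along which the one-step bounds multiply. \<open>C\<close> depends on \<open>c\<close>
  and \<open>S\<close> only, and this uniformity is what the compactness argument uses.\<close>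

lemma comparable:
  assumes "0 < c"
  shows "\<exists>C>0. \<forall>w. (\<forall>i. 0 < w i) \<longrightarrow>
    ((\<forall>i j. c * (S $ i $ j * w j) \<le> w i) \<longrightarrow> (\<forall>i j. C * w j \<le> w i)) \<and>
    ((\<forall>i j. c * (S $ j $ i * w j) \<le> w i) \<longrightarrow> (\<forall>i j. C * w j \<le> w i))"
proof -
  define g where "g = (\<lambda>(i, j). (c / real CARD('n)) ^ conn i j * mat_power S (conn i j) $ i $ j)"
  define C where "C = Min (range g)"
  have g: "0 < g p" for p
    using conn assms by (cases p) (simp add: g_def)
  then have C: "0 < C" unfolding C_def by (subst Min_gr_iff) auto
  have Cg: "C \<le> g (i, j)" for i j unfolding C_def by (intro Min_le) auto
  have 1: "C * w j \<le> w i" if "\<And>i j. c * (S $ i $ j * w j) \<le> w i" and w: "\<And>i. 0 < w i" for w i j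
  proof -
    have "C * w j \<le> g (i, j) * w j" using Cg w[of j] by (intro mult_right_mono) auto
    also have "\<dots> \<le> w i"
      using mat_power_propagate[OF that(1), where m = "conn i j" and i = i and j = j] w assms
      by (simp add: g_def mult.assoc less_imp_le)
    finally show ?thesis .
  qed
  have 2: "C * w j \<le> w i" if le: "\<And>i j. c * (S $ j $ i * w j) \<le> w i" and w: "\<And>i. 0 < w i" for w i j
  proof -
    text \<open>The reciprocals satisfy the inequality of the first case.\<close>
    have "c * (S $ i $ j * (1 / w j)) \<le> 1 / w i" for i j
      using le[of i j] w[of i] w[of j] by (simp add: field_simps)
    then have "C * (1 / w i) \<le> 1 / w j" using w by (intro 1[of "\<lambda>i. 1 / w i"]) auto
    then show ?thesis using w[of i] w[of j] by (simp add: field_simps)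
  qed
  show ?thesis by (rule exI[of _ C]) (simp add: C 1 2)
qed

section \<open>A priori bounds and the limit of vanishing regularization\<close>

text \<open>Keeping from \<open>S w\<close> only the term on the support permutation and multiplying
  over all rows, every \<open>w\<close> cancels.\<close>

lemma prod_ucoef_le:
  assumes "sol \<tau> \<eta> v w" "0 < \<tau>" "0 \<le> \<eta>"
  shows "(\<Prod>i\<in>UNIV. ucoef \<tau> \<eta> v w i) * (\<Prod>i\<in>UNIV. S $ i $ supp_perm i) \<le> 1"
proof -
  define u where "u = ucoef \<tau> \<eta> v w"
  note u = sol_ucoef_pos[OF assms, folded u_def] and w = sol_pos(2)[OF assms]
  have "u i * S $ i $ supp_perm i * w $ supp_perm i \<le> w $ i" for i
  proof -
    have "S $ i $ supp_perm i * w $ supp_perm i \<le> S_app w i" unfolding S_app_def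
      using w by (intro member_le_sum[of "supp_perm i" UNIV "\<lambda>j. S $ i $ j * w $ j"]) (auto simp: less_imp_le)
    then have "u i * (S $ i $ supp_perm i * w $ supp_perm i) \<le> u i * (\<eta> + S_app w i)"
      using u[of i] assms(3) by (intro mult_left_mono) auto
    then show ?thesis using sol_w_eq[OF assms, of i] by (simp add: u_def mult.assoc)
  qed
  then have "(\<Prod>i\<in>UNIV. u i * S $ i $ supp_perm i * w $ supp_perm i) \<le> (\<Prod>i\<in>UNIV. w $ i)"
    using u w by (intro prod_mono) (auto simp: less_imp_le)
  also have "(\<Prod>i\<in>UNIV. u i * S $ i $ supp_perm i * w $ supp_perm i)
     = ((\<Prod>i\<in>UNIV. u i) * (\<Prod>i\<in>UNIV. S $ i $ supp_perm i)) * (\<Prod>i\<in>UNIV. w $ supp_perm i)"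
    by (simp add: prod.distrib)
  also have "(\<Prod>i\<in>UNIV. w $ supp_perm i) = (\<Prod>i\<in>UNIV. w $ i)"
    using prod.permute[OF supp_perm(1), of "($) w"] by (simp add: comp_def)
  finally show ?thesis using w by (simp add: u_def prod_pos)
qed

text \<open>If every \<open>\<tau> u\<close> exceeded 1/2, then \<open>prod_ucoef_le\<close> would
  bound the second argument of \<open>min\<close> by \<open>\<tau> ^ CARD('n) \<le> \<tau>\<close>;
  below \<open>\<tau>0\<close> this is impossible. The first argument serves the last
  inequality.\<close>

definition \<tau>0 :: real where
  "\<tau>0 = min 1 ((\<Prod>i\<in>UNIV. S $ i $ supp_perm i) * (1 / 2) ^ CARD('n))"

lemma \<tau>0: "0 < \<tau>0" "\<tau>0 \<le> 1"
  using supp_perm(2) by (auto simp: \<tau>0_def prod_pos)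

text \<open>An index with \<open>x \<le> 1/2\<close> has \<open>v (\<eta> + S w) \<ge> 1/2\<close>,
  which prevents \<open>v\<close> and \<open>w\<close> from collapsing to 0 as \<open>\<eta>\<close>
  tends to 0.\<close>

lemma exists_small_x:
  assumes "sol \<tau> \<eta> v w" "0 < \<tau>" "0 \<le> \<eta>" "\<tau> < \<tau>0"
  shows "\<exists>i. \<tau> * ucoef \<tau> \<eta> v w i \<le> 1 / 2"
proof (rule ccontr)
  define u where "u = ucoef \<tau> \<eta> v w"
  define P where "P = (\<Prod>i\<in>UNIV. S $ i $ supp_perm i)"
  have P: "0 < P" using supp_perm(2) by (simp add: P_def prod_pos)
  assume "\<not> ?thesis"
  then have "1 / 2 \<le> \<tau> * u i" for i by (auto simp: u_def not_le less_imp_le)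
  then have "(\<Prod>i\<in>(UNIV :: 'n set). 1 / 2) \<le> (\<Prod>i\<in>UNIV. \<tau> * u i)"
    by (intro prod_mono) auto
  also have "\<dots> = \<tau> ^ CARD('n) * (\<Prod>i\<in>UNIV. u i)" by (simp add: prod.distrib)
  finally have "(1 / 2) ^ CARD('n) * P \<le> \<tau> ^ CARD('n) * (\<Prod>i\<in>UNIV. u i) * P"
    using P by (intro mult_right_mono) auto
  also have "\<dots> \<le> \<tau> ^ CARD('n) * 1"
    using prod_ucoef_le[OF assms(1-3)] assms(2) unfolding mult.assoc u_def P_def
    by (intro mult_left_mono) auto
  also have "\<dots> \<le> \<tau> ^ 1"
    using assms(2,4) \<tau>0 power_decreasing[of 1 "CARD('n)" \<tau>] by (simp add: Suc_leI)
  finally show False using assms(4) by (simp add: \<tau>0_def P_def mult.commute)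
qed

text \<open>A bound for the objective at the competitor \<open>w = 1\<close>,
  \<open>u = 1 / (1 + S 1)\<close>, with \<open>\<tau>\<close> and \<open>\<eta>\<close> replaced by
  their upper bound 1.\<close>

definition C_val :: real where
  "C_val = (\<Sum>i\<in>UNIV. 1 / (1 + S_app 1 i) + ln (1 + S_app 1 i)) + real CARD('n)"

lemma val_le_C_val:
  assumes "sol \<tau> \<eta> v w" "0 < \<tau>" "0 \<le> \<eta>" "\<tau> \<le> 1" "\<eta> \<le> 1"
  shows "val \<tau> \<eta> v w \<le> C_val"
proof -
  define r where "r i = S_app 1 i" for i
  have r: "0 < r i" for i unfolding r_def by (rule S_app_pos) simp
  have "val \<tau> \<eta> v w \<le> val \<tau> \<eta> v w
      + \<tau> * (\<Sum>i\<in>UNIV. (sqrt (1 / (1 + r i)) - sqrt (ucoef \<tau> \<eta> v w i))\<^sup>2)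
      + \<eta> * (\<Sum>i\<in>UNIV. (sqrt ((1 :: real ^ 'n) $ i) - sqrt (w $ i))\<^sup>2)"
    using assms by (simp add: sum_nonneg)
  also have "\<dots> \<le> (\<Sum>i\<in>UNIV. \<tau> * (1 / (1 + r i)) - ln (1 / (1 + r i))) + \<eta> * (\<Sum>i\<in>UNIV. (1 :: real ^ 'n) $ i)"
    unfolding val_def
  proof (rule value_le[OF assms(1-3)])
    show "0 < 1 / (1 + r i)" "0 < (1 :: real ^ 'n) $ i" for i using r[of i] by auto
    show "1 / (1 + r i) * (\<eta> + S_app 1 i) \<le> (1 :: real ^ 'n) $ i" for i
      using r[of i] assms(5) by (simp add: r_def)
  qed
  also have "\<dots> \<le> (\<Sum>i\<in>UNIV. 1 / (1 + r i) + ln (1 + r i)) + real CARD('n)"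
  proof (rule add_mono[OF sum_mono])
    fix i
    have "\<tau> * (1 / (1 + r i)) \<le> 1 * (1 / (1 + r i))" using r[of i] assms(4) by (intro mult_right_mono) auto
    then show "\<tau> * (1 / (1 + r i)) - ln (1 / (1 + r i)) \<le> 1 / (1 + r i) + ln (1 + r i)"
      using r[of i] by (simp add: ln_div)
  qed (use assms in auto)
  finally show ?thesis by (simp add: C_val_def r_def)
qed

lemma sum_neg_ln_ucoef_le:
  assumes "sol \<tau> \<eta> v w" "0 < \<tau>" "0 \<le> \<eta>" "\<tau> \<le> 1" "\<eta> \<le> 1"
  shows "(\<Sum>i\<in>UNIV. - ln (ucoef \<tau> \<eta> v w i)) \<le> C_val"
proof -
  have "(\<Sum>i\<in>UNIV. - ln (ucoef \<tau> \<eta> v w i)) \<le> (\<Sum>i\<in>UNIV. \<tau> * ucoef \<tau> \<eta> v w i - ln (ucoef \<tau> \<eta> v w i))"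
    using sol_ucoef_pos[OF assms(1-3)] assms by (intro sum_mono) (simp add: less_imp_le)
  also have "\<dots> \<le> val \<tau> \<eta> v w"
    using sol_pos(2)[OF assms(1-3)] assms by (simp add: val_def sum_nonneg less_imp_le)
  finally show ?thesis using val_le_C_val[OF assms] by linarith
qed

text \<open>Solutions along \<open>\<eta> = 1 / (n + 1)\<close> stay in a compact box of positive
  vectors, and a limit point solves the system at 0. The scaling freedom does no harm because
  \<open>v\<close> and \<open>w\<close> have equal sums along the sequence.\<close>

lemma exists_sol_zero:
  assumes \<tau>: "0 < \<tau>" "\<tau> < \<tau>0"
  shows "\<exists>v w. sol \<tau> 0 v w \<and> (Val \<tau> \<longlongrightarrow> val \<tau> 0 v w) (at_right 0)"
proof -
  define K where "K = real CARD('n)"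
  have K: "1 \<le> K" by (simp add: K_def Suc_leI)
  define eta where "eta n = 1 / real (Suc n)" for n
  have eta: "0 < eta n" "eta n \<le> 1" for n by (auto simp: eta_def)
  have \<tau>1: "\<tau> \<le> 1" using \<tau> \<tau>0 by simp
  define v where "v n = dyson_v S \<tau> (eta n)" for n
  define w where "w n = dyson_w \<tau> (eta n)" for n
  have sol: "sol \<tau> (eta n) (v n) (w n)" for n
    unfolding v_def w_def using sol_dyson \<tau>(1) eta by auto
  define u where "u n = ucoef \<tau> (eta n) (v n) (w n)" for n
  note facts = sol[unfolded u_def] \<tau>(1) less_imp_le[OF eta(1)]
  note u_pos = sol_ucoef_pos[OF facts, folded u_def] and vw_pos = sol_pos[OF facts]
  \<comment> \<open>No \<open>ln u\<close> exceeds \<open>- ln \<tau>\<close>, and the sum of the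
    \<open>- ln u\<close> is at most \<open>C_val\<close>; so each single \<open>u\<close> is
    bounded below, uniformly in \<open>n\<close> for fixed \<open>\<tau>\<close>.\<close>
  define c where "c = exp (- (C_val - K * ln \<tau>))"
  have c: "0 < c" by (simp add: c_def)
  have uc: "c \<le> u n i" for n i
  proof -
    have ul: "ln (u n i) \<le> - ln \<tau>" for i
    proof -
      have "\<tau> * u n i < 1" using sol_x_less_1[OF facts] by (simp add: u_def)
      then have "ln (\<tau> * u n i) \<le> 0" using u_pos[of n i] \<tau>(1) by (simp add: ln_le_zero_iff)
      then show ?thesis using u_pos[of n i] \<tau>(1) by (simp add: ln_mult_pos)
    qed
    have lt: "ln \<tau> \<le> 0" using \<tau>1 \<tau>(1) by (simp add: ln_le_zero_iff)
    have "- ln (u n i) - ln \<tau> \<le> (\<Sum>i\<in>UNIV. - ln (u n i) - ln \<tau>)"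
      using ul by (intro member_le_sum[of i UNIV "\<lambda>i. - ln (u n i) - ln \<tau>"]) (auto simp: le_diff_eq le_minus_iff)
    also have "\<dots> \<le> C_val - K * ln \<tau>"
      using sum_neg_ln_ucoef_le[OF facts \<tau>1 eta(2)] by (simp add: u_def sum_subtractf K_def)
    finally have "- (C_val - K * ln \<tau>) \<le> ln (u n i)" using lt by linarith
    then show ?thesis using u_pos[of n i] by (simp add: c_def ln_ge_iff)
  qed
  obtain C where C: "0 < C" and comp: "\<And>w. (\<And>i. 0 < w i) \<Longrightarrow>
    ((\<forall>i j. c * (S $ i $ j * w j) \<le> w i) \<longrightarrow> (\<forall>i j. C * w j \<le> w i)) \<and>
    ((\<forall>i j. c * (S $ j $ i * w j) \<le> w i) \<longrightarrow> (\<forall>i j. C * w j \<le> w i))"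
    using comparable[OF c] by auto
  have Cw: "C * w n $ j \<le> w n $ i" for n i j
  proof (rule comp[of "($) (w n)", THEN conjunct1, rule_format])
    fix i j
    have "S $ i $ j * w n $ j \<le> S_app (w n) i" unfolding S_app_def
      using vw_pos(2) by (intro member_le_sum[of j UNIV "\<lambda>j. S $ i $ j * w n $ j"]) (auto simp: less_imp_le)
    then have "c * (S $ i $ j * w n $ j) \<le> u n i * (eta n + S_app (w n) i)"
      using uc[of n i] c eta(1)[of n] vw_pos(2)[of n j] by (intro mult_mono) (auto simp: less_imp_le)
    then show "c * (S $ i $ j * w n $ j) \<le> w n $ i"
      using sol_w_eq[OF facts, of n i] by (simp add: u_def)
  qed (rule vw_pos)
  have Cv: "C * v n $ j \<le> v n $ i" for n i j
  proof (rule comp[of "($) (v n)", THEN conjunct2, rule_format])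
    fix i j
    have "S $ j $ i * v n $ j \<le> St_app (v n) i" unfolding St_app_def
      using vw_pos(1) by (intro member_le_sum[of j UNIV "\<lambda>j. S $ j $ i * v n $ j"]) (auto simp: less_imp_le)
    then have "c * (S $ j $ i * v n $ j) \<le> u n i * (eta n + St_app (v n) i)"
      using uc[of n i] c eta(1)[of n] vw_pos(1)[of n j] by (intro mult_mono) (auto simp: less_imp_le)
    then show "c * (S $ j $ i * v n $ j) \<le> v n $ i"
      using sol_v_eq[OF facts, of n i] by (simp add: u_def)
  qed (rule vw_pos)
  \<comment> \<open>By \<open>Cv\<close> and \<open>Cw\<close> all entries of \<open>v\<close> and
    \<open>w\<close> are comparable to this common sum, so it is enough to bound \<open>T\<close>
    from both sides.\<close>
  define T where "T n = (\<Sum>i\<in>UNIV. w n $ i)" for n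
  have Tv: "T n = (\<Sum>i\<in>UNIV. v n $ i)" for n
    using sol_sum_eq[OF facts eta(1)] by (simp add: T_def)
  have T_pos: "0 < T n" for n unfolding T_def using vw_pos by (intro sum_pos) auto
  have w_le: "w n $ i \<le> T n" for n i unfolding T_def
    using vw_pos(2) by (intro member_le_sum) (auto simp: less_imp_le)
  have v_le: "v n $ i \<le> T n" for n i unfolding Tv
    using vw_pos(1) by (intro member_le_sum) (auto simp: less_imp_le)
  have sum_le: "C * T n \<le> K * x" if "\<And>j. C * y $ j \<le> x" "T n = (\<Sum>i\<in>UNIV. y $ i)" for n x and y :: "real ^ 'n"
  proof -
    have "C * T n = (\<Sum>j\<in>UNIV. C * y $ j)" using that(2) by (simp add: sum_distrib_left)
    also have "\<dots> \<le> (\<Sum>j\<in>(UNIV :: 'n set). x)" using that(1) by (intro sum_mono)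
    finally show ?thesis by (simp add: K_def)
  qed
  have w_ge: "C * T n / K \<le> w n $ i" and v_ge: "C * T n / K \<le> v n $ i" for n i
    using sum_le[OF Cw[of n _ i]] sum_le[OF Cv[of n _ i]] K Tv
    by (auto simp: T_def divide_le_eq mult.commute)
  \<comment> \<open>\<open>v w \<le> u \<le> 1 / \<tau>\<close>, while \<open>v w\<close> is at
    least of order \<open>T\<^sup>2\<close>.\<close>
  have T_le: "T n \<le> K / C * (1 / \<tau> + 1)" for n
  proof -
    fix i :: 'n
    have "v n $ i * w n $ i = u n i * (1 - \<tau> * u n i)"
      using sol_vw[OF facts] by (simp add: u_def)
    also have "\<dots> \<le> u n i" using u_pos[of n i] \<tau>(1) by (simp add: mult_le_cancel_left1)
    also have "u n i \<le> 1 / \<tau>" using sol_x_less_1[OF facts, of n i] \<tau>(1) by (simp add: u_def field_simps)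
    finally have vw: "v n $ i * w n $ i \<le> 1 / \<tau>" .
    have "(C * T n / K) * (C * T n / K) \<le> v n $ i * w n $ i"
      using w_ge[of n i] v_ge[of n i] C T_pos[of n] K vw_pos[of n i]
      by (intro mult_mono) (auto simp: less_imp_le)
    then have sq: "(C * T n / K)\<^sup>2 \<le> 1 / \<tau>" using vw by (simp add: power2_eq_square)
    have "C * T n / K \<le> 1 / \<tau> + 1"
    proof (rule ccontr)
      assume "\<not> ?thesis"
      then have *: "1 / \<tau> + 1 < C * T n / K" by simp
      moreover have "0 < 1 / \<tau>" using \<tau>(1) by simp
      ultimately have "1 \<le> C * T n / K" by linarith
      then have "(C * T n / K) * 1 \<le> (C * T n / K) * (C * T n / K)"
        by (intro mult_left_mono) auto
      then show False using * sq by (simp add: power2_eq_square)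
    qed
    then show ?thesis using C K by (simp add: field_simps)
  qed
  define H where "H = K / C * (1 / \<tau> + 1)"
  have H: "0 < H" using K C \<tau>(1) by (simp add: H_def add_pos_pos)
  \<comment> \<open>If \<open>T\<close> were below \<open>T0\<close>, then
    \<open>v (\<eta> + S w) \<le> T (1 + S_total) < 1/2\<close> at every index, against
    \<open>exists_small_x\<close>.\<close>
  define T0 where "T0 = min 1 (1 / (2 * (1 + S_total)))"
  have T0: "0 < T0" using S_total_nonneg by (simp add: T0_def)
  have T_ge: "T0 \<le> T n" for n
  proof (rule ccontr)
    assume "\<not> T0 \<le> T n"
    then have lt: "T n < 1" "T n < 1 / (2 * (1 + S_total))" by (auto simp: T0_def)
    obtain i where i: "\<tau> * u n i \<le> 1 / 2"
      using exists_small_x[OF facts \<tau>(2), of n] by (auto simp: u_def)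
    have "S_app (w n) i \<le> S_total * 1" using w_le[of n] lt T_pos[of n] by (intro S_app_le) (auto intro: order_trans less_imp_le)
    then have "v n $ i * (eta n + S_app (w n) i) \<le> T n * (1 + S_total)"
      using v_le[of n i] eta[of n] vw_pos[of n] S_app_pos[of "w n" i] T_pos[of n]
      by (intro mult_mono) (auto simp: less_imp_le)
    also have "\<dots> < 1 / 2" using lt(2) S_total_nonneg by (simp add: field_simps)
    finally show False using sol_va[OF facts, of n i] i by (simp add: u_def)
  qed
  define lo where "lo = C * T0 / K"
  have lo: "0 < lo" using C T0 K by (simp add: lo_def)
  define B where "B = (cbox (\<chi> i. lo) (\<chi> i. H) :: (real ^ 'n) set)"
  have inB: "x \<in> B \<longleftrightarrow> (\<forall>i. lo \<le> x $ i \<and> x $ i \<le> H)" for x by (simp add: B_def mem_box_cart)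
  have loT: "lo \<le> C * T n / K" for n unfolding lo_def using T_ge[of n] C K
    by (intro divide_right_mono mult_left_mono) auto
  have vB: "v n \<in> B" and wB: "w n \<in> B" for n
    unfolding inB using order_trans[OF loT v_ge] order_trans[OF loT w_ge]
      order_trans[OF v_le T_le[folded H_def]] order_trans[OF w_le T_le[folded H_def]] by simp_all
  have "seq_compact (B \<times> B)" by (intro compact_imp_seq_compact compact_Times) (auto simp: B_def)
  moreover have "\<forall>n. (v n, w n) \<in> B \<times> B" using vB wB by auto
  ultimately obtain l r where l: "l \<in> B \<times> B" "strict_mono r" "((\<lambda>n. (v n, w n)) \<circ> r) \<longlonglongrightarrow> l"
    by (rule seq_compactE)
  obtain v0 w0 where l_eq: "l = (v0, w0)" by (cases l)
  have vl: "(\<lambda>n. v (r n) $ i) \<longlonglongrightarrow> v0 $ i" and wl: "(\<lambda>n. w (r n) $ i) \<longlonglongrightarrow> w0 $ i" for i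
    using tendsto_fst[OF l(3)] tendsto_snd[OF l(3)] by (auto simp: l_eq comp_def intro: tendsto_vec_nth)
  have "eta \<longlonglongrightarrow> 0" unfolding eta_def by (rule LIMSEQ_Suc[OF lim_1_over_n])
  then have el: "(\<lambda>n. eta (r n)) \<longlonglongrightarrow> 0" using LIMSEQ_subseq_LIMSEQ[OF _ l(2)] by (auto simp: comp_def)
  have al: "(\<lambda>n. eta (r n) + S_app (w (r n)) i) \<longlonglongrightarrow> 0 + S_app w0 i" for i
    unfolding S_app_def by (intro tendsto_intros el wl)
  have cl: "(\<lambda>n. eta (r n) + St_app (v (r n)) i) \<longlonglongrightarrow> 0 + St_app v0 i" for i
    unfolding St_app_def by (intro tendsto_intros el vl)
  have pos0: "0 < v0 $ i" "0 < w0 $ i" for i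
    using l(1) lo unfolding l_eq by (auto simp: inB intro: less_le_trans)
  have sol0: "sol \<tau> 0 v0 w0" unfolding sol_def
  proof (intro allI conjI pos0)
    fix i
    have "(\<lambda>n. v (r n) $ i * (\<tau> + (eta (r n) + S_app (w (r n)) i) * (eta (r n) + St_app (v (r n)) i)))
      \<longlonglongrightarrow> v0 $ i * (\<tau> + (0 + S_app w0 i) * (0 + St_app v0 i))"
      by (intro tendsto_intros vl al cl)
    moreover have "v (r n) $ i * (\<tau> + (eta (r n) + S_app (w (r n)) i) * (eta (r n) + St_app (v (r n)) i)) = eta (r n) + St_app (v (r n)) i" for n
      using sol[of "r n"] by (simp add: sol_def)
    ultimately have "(\<lambda>n. eta (r n) + St_app (v (r n)) i) \<longlonglongrightarrow> v0 $ i * (\<tau> + (0 + S_app w0 i) * (0 + St_app v0 i))"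
      by (simp only:)
    then show "v0 $ i * (\<tau> + (0 + S_app w0 i) * (0 + St_app v0 i)) = 0 + St_app v0 i"
      by (rule LIMSEQ_unique[OF _ cl])
    have "(\<lambda>n. w (r n) $ i * (\<tau> + (eta (r n) + S_app (w (r n)) i) * (eta (r n) + St_app (v (r n)) i)))
      \<longlonglongrightarrow> w0 $ i * (\<tau> + (0 + S_app w0 i) * (0 + St_app v0 i))"
      by (intro tendsto_intros wl al cl)
    moreover have "w (r n) $ i * (\<tau> + (eta (r n) + S_app (w (r n)) i) * (eta (r n) + St_app (v (r n)) i)) = eta (r n) + S_app (w (r n)) i" for n
      using sol[of "r n"] by (simp add: sol_def)
    ultimately have "(\<lambda>n. eta (r n) + S_app (w (r n)) i) \<longlonglongrightarrow> w0 $ i * (\<tau> + (0 + S_app w0 i) * (0 + St_app v0 i))"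
      by (simp only:)
    then show "w0 $ i * (\<tau> + (0 + S_app w0 i) * (0 + St_app v0 i)) = 0 + S_app w0 i"
      by (rule LIMSEQ_unique[OF _ al])
  qed
  have "\<tau> + (0 + S_app w0 i) * (0 + St_app v0 i) \<noteq> 0" for i
    using add_pos_pos[OF \<tau>(1) mult_pos_pos[OF S_app_pos[OF pos0(2), of i] St_app_pos[OF pos0(1), of i]]]
    by simp
  then have ul: "(\<lambda>n. u (r n) i) \<longlonglongrightarrow> ucoef \<tau> 0 v0 w0 i" for i
    unfolding u_def ucoef_def
    by (intro tendsto_divide tendsto_add[OF tendsto_const] tendsto_mult[OF al cl] tendsto_const) auto
  have Vl: "(\<lambda>n. Val \<tau> (eta (r n))) \<longlonglongrightarrow> val \<tau> 0 v0 w0"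
  proof -
    have "(\<lambda>n. (\<Sum>i\<in>UNIV. \<tau> * u (r n) i - ln (u (r n) i)) + eta (r n) * (\<Sum>i\<in>UNIV. w (r n) $ i))
      \<longlonglongrightarrow> (\<Sum>i\<in>UNIV. \<tau> * ucoef \<tau> 0 v0 w0 i - ln (ucoef \<tau> 0 v0 w0 i)) + 0 * (\<Sum>i\<in>UNIV. w0 $ i)"
      using sol_ucoef_pos[OF sol0 \<tau>(1)]
      by (intro tendsto_add tendsto_mult tendsto_sum tendsto_diff tendsto_ln tendsto_const ul el wl) (auto simp: less_imp_neq[symmetric])
    then show ?thesis by (simp add: Val_def[OF \<tau>(1)] val_def u_def v_def w_def)
  qed
  \<comment> \<open>Convergence of the whole family, not only along the subsequence:
    \<open>val_zero_le\<close> bounds \<open>Val\<close> from below, and monotonicity carries the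
    upper bound from one \<open>eta (r n)\<close> to all smaller \<open>\<eta>\<close>.\<close>
  have "(Val \<tau> \<longlongrightarrow> val \<tau> 0 v0 w0) (at_right 0)"
  proof (rule order_tendstoI)
    fix a assume a: "a < val \<tau> 0 v0 w0"
    show "eventually (\<lambda>\<eta>. a < Val \<tau> \<eta>) (at_right 0)"
      using eventually_at_right_less[of "0::real"]
    proof eventually_elim
      case (elim \<eta>)
      show ?case using a val_zero_le[OF sol0 sol_dyson[OF \<tau>(1) elim] \<tau>(1) elim]
        by (simp add: Val_def[OF \<tau>(1)])
    qed
  next
    fix a assume a: "val \<tau> 0 v0 w0 < a"
    then have "eventually (\<lambda>n. Val \<tau> (eta (r n)) < a) sequentially"
      using Vl by (simp add: order_tendsto_iff)
    then obtain n where n: "Val \<tau> (eta (r n)) < a" by (auto simp: eventually_sequentially)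
    have "eventually (\<lambda>\<eta>. \<eta> \<in> {0<..<eta (r n)}) (at_right 0)"
      using eta(1) by (intro eventually_at_right_real)
    then show "eventually (\<lambda>\<eta>. Val \<tau> \<eta> < a) (at_right 0)"
    proof eventually_elim
      case (elim \<eta>)
      then show ?case using n Val_mono[OF \<tau>(1), of \<eta> "eta (r n)"] by auto
    qed
  qed
  with sol0 show ?thesis by blast
qed

end

section \<open>Dependence on the spectral parameter\<close>

lemma tendsto_of_cauchy:
  fixes q :: "real \<Rightarrow> real"
  assumes "\<And>e. 0 < e \<Longrightarrow> \<exists>P. eventually P (at a) \<and> (\<forall>x y. P x \<and> P y \<longrightarrow> dist (q x) (q y) < e)"
  shows "\<exists>l. (q \<longlongrightarrow> l) (at a)"
proof -
  have "cauchy_filter (filtermap q (at a))"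
    unfolding cauchy_filter_metric_filtermap using assms by blast
  moreover have "filtermap q (at a) \<noteq> bot" by (simp add: filtermap_bot_iff)
  ultimately show ?thesis
    using complete_UNIV[where 'a=real] unfolding complete_uniform filterlim_def by auto
qed

text \<open>The orthogonality relation makes the difference quotients a Cauchy family: its left factor
  lies in a space orthogonal to that of the right factor, and to first order the two are related
  by the positive diagonal matrix \<open>k\<close>.\<close>

lemma orthogonal_curves_differentiable:
  fixes y :: "real \<Rightarrow> 'e \<Rightarrow> real" and f :: "'e \<Rightarrow> real \<Rightarrow> real"
  assumes "finite E" "open U" "a \<in> U" "0 < c"
    and orth: "\<And>s t. s \<in> U \<Longrightarrow> t \<in> U \<Longrightarrow>
      (\<Sum>e\<in>E. (y s e - y a e) * (f e (y t e) - f e (y a e) - n e * (t - a))) = 0"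
    and deriv: "\<And>e. e \<in> E \<Longrightarrow> (f e has_field_derivative k e) (at (y a e))"
    and k: "\<And>e. e \<in> E \<Longrightarrow> 0 < k e"
    and mono: "\<And>e s. e \<in> E \<Longrightarrow> s \<in> U \<Longrightarrow>
      c * (y s e - y a e)\<^sup>2 \<le> (y s e - y a e) * (f e (y s e) - f e (y a e))"
    and n: "\<And>e. e \<in> E \<Longrightarrow> \<bar>n e\<bar> \<le> 1"
    and e: "e \<in> E"
  shows "\<exists>D. ((\<lambda>s. y s e) has_field_derivative D) (at a)"
proof -
  define N where "N = real (card E)"
  define L where "L = N / c"
  have L0: "0 \<le> L" using assms(4) by (simp add: L_def N_def)
  \<comment> \<open>Orthogonality for \<open>s = t\<close> and strong monotonicity give a Lipschitz
    bound; Cauchy-Schwarz passes between the sum of squares and \<open>T\<close>.\<close>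
  have Lip: "\<bar>y s e - y a e\<bar> \<le> L * \<bar>s - a\<bar>" if s: "s \<in> U" and e: "e \<in> E" for s e
  proof -
    define T where "T = (\<Sum>e\<in>E. \<bar>y s e - y a e\<bar>)"
    have T: "0 \<le> T" by (simp add: T_def sum_nonneg)
    have "c * (\<Sum>e\<in>E. (y s e - y a e)\<^sup>2) \<le> (\<Sum>e\<in>E. (y s e - y a e) * (f e (y s e) - f e (y a e)))"
      unfolding sum_distrib_left using mono s by (intro sum_mono)
    also have "\<dots> = (\<Sum>e\<in>E. (y s e - y a e) * (n e * (s - a)))"
      using orth[OF s s] by (simp add: right_diff_distrib sum_subtractf)
    also have "\<dots> \<le> (\<Sum>e\<in>E. \<bar>y s e - y a e\<bar> * \<bar>s - a\<bar>)"
    proof (rule sum_mono)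
      fix e assume "e \<in> E"
      have "(y s e - y a e) * (n e * (s - a)) \<le> \<bar>y s e - y a e\<bar> * (\<bar>n e\<bar> * \<bar>s - a\<bar>)"
        using abs_ge_self[of "(y s e - y a e) * (n e * (s - a))"] unfolding abs_mult .
      also have "\<dots> \<le> \<bar>y s e - y a e\<bar> * (1 * \<bar>s - a\<bar>)"
        using n[OF \<open>e \<in> E\<close>] by (intro mult_left_mono mult_right_mono) auto
      finally show "(y s e - y a e) * (n e * (s - a)) \<le> \<bar>y s e - y a e\<bar> * \<bar>s - a\<bar>" by simp
    qed
    also have "\<dots> = T * \<bar>s - a\<bar>" by (simp add: T_def sum_distrib_right)
    finally have 1: "c * (\<Sum>e\<in>E. (y s e - y a e)\<^sup>2) \<le> T * \<bar>s - a\<bar>" .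
    have "T\<^sup>2 \<le> (\<Sum>e\<in>E. \<bar>y s e - y a e\<bar>\<^sup>2) * N"
      using sum_squared_le_sum_of_squares[of "\<lambda>e. \<bar>y s e - y a e\<bar>" E] assms(1) by (simp add: T_def N_def)
    then have "c * T\<^sup>2 \<le> N * (c * (\<Sum>e\<in>E. (y s e - y a e)\<^sup>2))"
      using assms(4) by (simp add: mult_ac)
    also have "\<dots> \<le> N * (T * \<bar>s - a\<bar>)" using 1 by (intro mult_left_mono) (auto simp: N_def)
    finally have 2: "T * (c * T) \<le> T * (N * \<bar>s - a\<bar>)" by (simp add: power2_eq_square mult_ac)
    have "T \<le> L * \<bar>s - a\<bar>"
    proof (cases "T = 0")
      case True
      then show ?thesis using L0 by simp
    next
      case False
      then have "c * T \<le> N * \<bar>s - a\<bar>" using 2 T by (simp add: mult_le_cancel_left)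
      then show ?thesis using assms(4) by (simp add: L_def field_simps)
    qed
    moreover have "\<bar>y s e - y a e\<bar> \<le> T" unfolding T_def
      using e assms(1) by (intro member_le_sum[of e E "\<lambda>e. \<bar>y s e - y a e\<bar>"]) auto
    ultimately show ?thesis by linarith
  qed
  have U: "eventually (\<lambda>s. s \<in> U \<and> s \<noteq> a) (at a)"
    using eventually_at_in_open[OF assms(2,3)] by (rule eventually_mono) auto
  define q where "q s e = (y s e - y a e) / (s - a)" for s e
  define r where "r s e = (f e (y s e) - f e (y a e)) / (s - a) - k e * q s e" for s e
  define \<rho> where "\<rho> s = (\<Sum>e\<in>E. \<bar>r s e\<bar>)" for s
  have q: "\<bar>q s e\<bar> \<le> L" if "s \<in> U \<and> s \<noteq> a" "e \<in> E" for s e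
    using Lip[of s e] that by (simp add: q_def abs_divide divide_le_eq)
  have r0: "((\<lambda>s. r s e) \<longlongrightarrow> 0) (at a)" if e: "e \<in> E" for e
  proof -
    obtain g where g: "\<And>z. f e z - f e (y a e) = g z * (z - y a e)" "isCont g (y a e)" "g (y a e) = k e"
      using deriv[OF e] unfolding CARAT_DERIV by blast
    have "((\<lambda>s. L * \<bar>s - a\<bar>) \<longlongrightarrow> L * \<bar>a - a\<bar>) (at a)" by (intro tendsto_intros)
    then have "((\<lambda>s. L * \<bar>s - a\<bar>) \<longlongrightarrow> 0) (at a)" by simp
    moreover have "eventually (\<lambda>s. norm (y s e - y a e) \<le> L * \<bar>s - a\<bar>) (at a)"
      using U by eventually_elim (simp add: Lip e)
    ultimately have "((\<lambda>s. y s e - y a e) \<longlongrightarrow> 0) (at a)"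
      by (rule Lim_null_comparison[rotated])
    then have "((\<lambda>s. y s e) \<longlongrightarrow> y a e) (at a)" by (rule Lim_null[THEN iffD2])
    then have "((\<lambda>s. g (y s e)) \<longlongrightarrow> k e) (at a)" using isCont_tendsto_compose[OF g(2)] by (simp add: g(3))
    then have "((\<lambda>s. L * \<bar>g (y s e) - k e\<bar>) \<longlongrightarrow> L * \<bar>k e - k e\<bar>) (at a)" by (intro tendsto_intros)
    then have lim: "((\<lambda>s. L * \<bar>g (y s e) - k e\<bar>) \<longlongrightarrow> 0) (at a)" by simp
    have "eventually (\<lambda>s. norm (r s e) \<le> L * \<bar>g (y s e) - k e\<bar>) (at a)"
      using U
    proof eventually_elim
      case (elim s)
      have "(f e (y s e) - f e (y a e)) / (s - a) = g (y s e) * q s e"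
        by (simp add: q_def g(1))
      then have "r s e = (g (y s e) - k e) * q s e"
        by (simp add: r_def left_diff_distrib)
      then have "norm (r s e) = \<bar>q s e\<bar> * \<bar>g (y s e) - k e\<bar>" by (simp add: abs_mult)
      also have "\<dots> \<le> L * \<bar>g (y s e) - k e\<bar>" using q[OF elim e] by (intro mult_right_mono) auto
      finally show ?case .
    qed
    then show ?thesis using lim by (rule Lim_null_comparison)
  qed
  have "(\<rho> \<longlongrightarrow> (\<Sum>e\<in>E. \<bar>0\<bar>)) (at a)"
    unfolding \<rho>_def using r0 by (intro tendsto_sum tendsto_rabs)
  then have \<rho>: "(\<rho> \<longlongrightarrow> 0) (at a)" by simp
  have key: "k e * (q s e - q t e)\<^sup>2 \<le> 2 * L * (\<rho> s + \<rho> t)"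
    if s: "s \<in> U \<and> s \<noteq> a" and t: "t \<in> U \<and> t \<noteq> a" for s t
  proof -
    define F where "F s e = k e * q s e + r s e - n e" for s e
    have zero: "(\<Sum>e\<in>E. q s e * F t e) = 0" if s: "s \<in> U \<and> s \<noteq> a" and t: "t \<in> U \<and> t \<noteq> a" for s t
    proof -
      have "(\<Sum>e\<in>E. q s e * F t e)
        = (\<Sum>e\<in>E. (y s e - y a e) * (f e (y t e) - f e (y a e) - n e * (t - a)) / ((s - a) * (t - a)))"
      proof (rule sum.cong[OF refl])
        fix e
        have "F t e = (f e (y t e) - f e (y a e) - n e * (t - a)) / (t - a)"
          using t by (simp add: F_def r_def diff_divide_distrib)
        then show "q s e * F t e = (y s e - y a e) * (f e (y t e) - f e (y a e) - n e * (t - a)) / ((s - a) * (t - a))"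
          by (simp add: q_def)
      qed
      also have "\<dots> = 0" using orth[of s t] s t by (simp add: sum_divide_distrib[symmetric])
      finally show ?thesis .
    qed
    \<comment> \<open>Bilinearity combines the four relations for pairs from \<open>s\<close> and
      \<open>t\<close> into one for \<open>q s - q t\<close> against \<open>F s - F t\<close>. The
      constants \<open>n\<close> drop out, and the positive form with weights \<open>k\<close> is
      left, up to the linearization errors \<open>r\<close>.\<close>
    have "(\<Sum>e\<in>E. (q s e - q t e) * (F s e - F t e)) = 0"
      using zero[OF s s] zero[OF s t] zero[OF t s] zero[OF t t]
      by (simp add: algebra_simps sum.distrib sum_subtractf)
    moreover have "(q s e - q t e) * (F s e - F t e) = k e * (q s e - q t e)\<^sup>2 + (q s e - q t e) * (r s e - r t e)" for e
      by (simp add: F_def power2_eq_square algebra_simps)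
    ultimately have "(\<Sum>e\<in>E. k e * (q s e - q t e)\<^sup>2) = - (\<Sum>e\<in>E. (q s e - q t e) * (r s e - r t e))"
      by (simp add: sum.distrib eq_neg_iff_add_eq_0)
    also have "\<dots> = (\<Sum>e\<in>E. - (q s e - q t e) * (r s e - r t e))"
      unfolding sum_negf[symmetric] by (simp only: mult_minus_left)
    also have "\<dots> \<le> (\<Sum>e\<in>E. (2 * L) * (\<bar>r s e\<bar> + \<bar>r t e\<bar>))"
    proof (rule sum_mono)
      fix e assume e: "e \<in> E"
      have "- (q s e - q t e) * (r s e - r t e) \<le> \<bar>q s e - q t e\<bar> * \<bar>r s e - r t e\<bar>"
        using abs_ge_self[of "- (q s e - q t e) * (r s e - r t e)"] unfolding abs_mult abs_minus_cancel .
      also have "\<dots> \<le> (2 * L) * (\<bar>r s e\<bar> + \<bar>r t e\<bar>)"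
        using q[OF s e] q[OF t e] by (intro mult_mono) auto
      finally show "- (q s e - q t e) * (r s e - r t e) \<le> (2 * L) * (\<bar>r s e\<bar> + \<bar>r t e\<bar>)" .
    qed
    also have "\<dots> = 2 * L * (\<rho> s + \<rho> t)" by (simp add: \<rho>_def sum_distrib_left sum.distrib distrib_left)
    finally have "(\<Sum>e\<in>E. k e * (q s e - q t e)\<^sup>2) \<le> 2 * L * (\<rho> s + \<rho> t)" .
    moreover have "k e * (q s e - q t e)\<^sup>2 \<le> (\<Sum>e\<in>E. k e * (q s e - q t e)\<^sup>2)"
      using assms(1) e k by (intro member_le_sum[of e E "\<lambda>e. k e * (q s e - q t e)\<^sup>2"]) (auto simp: less_imp_le)
    ultimately show ?thesis by linarith
  qed
  have "\<exists>l. ((\<lambda>s. q s e) \<longlongrightarrow> l) (at a)"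
  proof (rule tendsto_of_cauchy)
    fix \<epsilon> :: real assume \<epsilon>: "0 < \<epsilon>"
    define d where "d = k e * \<epsilon>\<^sup>2 / (4 * L + 1)"
    have d: "0 < d" using \<epsilon> k[OF e] L0 by (simp add: d_def)
    have "eventually (\<lambda>s. \<rho> s < d) (at a)" using \<rho> d by (rule order_tendstoD)
    with U have "eventually (\<lambda>s. (s \<in> U \<and> s \<noteq> a) \<and> \<rho> s < d) (at a)" by (rule eventually_conj)
    moreover have "dist (q s e) (q t e) < \<epsilon>"
      if "((s \<in> U \<and> s \<noteq> a) \<and> \<rho> s < d) \<and> ((t \<in> U \<and> t \<noteq> a) \<and> \<rho> t < d)" for s t
    proof -
      have "k e * (q s e - q t e)\<^sup>2 \<le> 2 * L * (\<rho> s + \<rho> t)" using key that by blast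
      also have "\<dots> \<le> 2 * L * (d + d)" using that L0 by (intro mult_left_mono) auto
      also have "\<dots> < (4 * L + 1) * d" using d by (simp add: algebra_simps)
      also have "\<dots> = k e * \<epsilon>\<^sup>2" using L0 by (simp add: d_def)
      finally have "(q s e - q t e)\<^sup>2 < \<epsilon>\<^sup>2" using k[OF e] by simp
      then have "\<bar>q s e - q t e\<bar> < \<epsilon>" using \<epsilon> by (simp add: power2_less_imp_less[of "\<bar>q s e - q t e\<bar>"])
      then show ?thesis by (simp add: dist_real_def)
    qed
    ultimately show "\<exists>P. eventually P (at a) \<and> (\<forall>x y. P x \<and> P y \<longrightarrow> dist (q x e) (q y e) < \<epsilon>)"
      by (intro exI[of _ "\<lambda>s. (s \<in> U \<and> s \<noteq> a) \<and> \<rho> s < d"] conjI allI impI)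
  qed
  then show ?thesis by (simp add: has_field_derivative_iff q_def)
qed

section \<open>Strong monotonicity of \<open>ln x\<close> and of
  \<open>ln (x (1 - x))\<close>\<close>

lemma ln_diff_ge:
  fixes a b :: real
  assumes "0 < a" "a \<le> b" shows "(b - a) / b \<le> ln b - ln a" "ln b - ln a \<le> (b - a) / a"
proof -
  have "ln (a / b) \<le> a / b - 1" "ln (b / a) \<le> b / a - 1"
    using assms by (auto intro!: ln_le_minus_one)
  then show "(b - a) / b \<le> ln b - ln a" "ln b - ln a \<le> (b - a) / a"
    using assms by (auto simp: ln_div diff_divide_distrib)
qed

lemma ln_strongly_mono:
  fixes a b :: real
  assumes "0 < a" "a \<le> 1" "0 < b" "b \<le> 1"
  shows "(b - a)\<^sup>2 \<le> (b - a) * (ln b - ln a)"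
proof -
  have *: "(b - a)\<^sup>2 \<le> (b - a) * (ln b - ln a)" if "0 < a" "a \<le> b" "b \<le> 1" for a b :: real
  proof -
    have "(b - a) * b \<le> (b - a) * 1" using that by (intro mult_left_mono) auto
    then have "b - a \<le> (b - a) / b" using that by (simp add: field_simps)
    then have "b - a \<le> ln b - ln a" using ln_diff_ge(1)[of a b] that by linarith
    then show ?thesis unfolding power2_eq_square using that by (intro mult_left_mono) auto
  qed
  have sym: "(a - b) * (ln a - ln b) = (b - a) * (ln b - ln a)" by (simp add: algebra_simps)
  show ?thesis
  proof (cases "a \<le> b")
    case True
    then show ?thesis using *[of a b] assms by simp
  next
    case False
    then show ?thesis using *[of b a, unfolded sym] assms power2_commute[of a b]
      by (simp only: not_le less_imp_le)
  qed
qed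

text \<open>The logarithm of \<open>x (1 - x)\<close>, which at \<open>\<eta> = 0\<close> is
  \<open>\<tau> v w\<close>: along the solution it is exactly \<open>s\<close> plus the logarithms
  of \<open>v\<close> and \<open>w\<close>, a formula that \<open>ln x\<close> does not
  satisfy.\<close>

definition log_logistic :: "real \<Rightarrow> real" where "log_logistic x = ln x + ln (1 - x)"

text \<open>On \<open>(0, 1/4]\<close> the slope \<open>1/x - 1/(1 - x)\<close> lies between 1 and
  \<open>1/x\<close>: the first term is at least 4 and the second at most 2.\<close>

lemma log_logistic_diff:
  assumes "0 < a" "a \<le> b" "b \<le> 1 / 4"
  shows "b - a \<le> log_logistic b - log_logistic a" "log_logistic b - log_logistic a \<le> ln b - ln a"
proof -
  have "4 * (b - a) \<le> (b - a) / b"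
    using mult_right_mono[of "4 * b" 1 "b - a"] assms by (simp add: le_divide_eq mult_ac)
  then have 1: "4 * (b - a) \<le> ln b - ln a" using ln_diff_ge(1)[of a b] assms by linarith
  have "(b - a) / (1 - b) \<le> 2 * (b - a)"
    using mult_right_mono[of 1 "2 * (1 - b)" "b - a"] assms by (subst pos_divide_le_eq) (auto simp: algebra_simps)
  moreover have "ln (1 - a) - ln (1 - b) \<le> ((1 - a) - (1 - b)) / (1 - b)"
    using assms by (intro ln_diff_ge) auto
  ultimately show "b - a \<le> log_logistic b - log_logistic a"
    using 1 assms by (simp add: log_logistic_def)
  show "log_logistic b - log_logistic a \<le> ln b - ln a"
    using assms by (simp add: log_logistic_def)
qed

lemma log_logistic_strongly_mono:
  assumes "0 < a" "a \<le> 1 / 4" "0 < b" "b \<le> 1 / 4"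
  shows "(b - a)\<^sup>2 \<le> (b - a) * (log_logistic b - log_logistic a)"
proof -
  have *: "(b - a)\<^sup>2 \<le> (b - a) * (log_logistic b - log_logistic a)" if "0 < a" "a \<le> b" "b \<le> 1 / 4" for a b
    unfolding power2_eq_square using that log_logistic_diff(1)[of a b] by (intro mult_left_mono) auto
  have sym: "(a - b) * (log_logistic a - log_logistic b) = (b - a) * (log_logistic b - log_logistic a)" by (simp add: algebra_simps)
  show ?thesis
  proof (cases "a \<le> b")
    case True
    then show ?thesis using *[of a b] assms by simp
  next
    case False
    then show ?thesis using *[of b a, unfolded sym] assms power2_commute[of a b]
      by (simp only: not_le less_imp_le)
  qed
qed

text \<open>Between \<open>a\<close> and \<open>b\<close> the logarithm is Lipschitz with constant
  \<open>1 / min a b\<close>. Thus a logarithmic increment on an edge of known weight costs a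
  definite amount of energy.\<close>

lemma min_mult_ln_diff_sq_le:
  fixes a b :: real
  assumes "0 < a" "0 < b"
  shows "min a b * (ln b - ln a)\<^sup>2 \<le> (b - a) * (ln b - ln a)"
proof -
  have *: "a * (ln b - ln a)\<^sup>2 \<le> (b - a) * (ln b - ln a)" if "0 < a" "a \<le> b" for a b :: real
  proof -
    have "a * (ln b - ln a) \<le> b - a" using ln_diff_ge(2)[of a b] that by (simp add: field_simps)
    then have "a * (ln b - ln a) * (ln b - ln a) \<le> (b - a) * (ln b - ln a)"
      using that by (intro mult_right_mono) auto
    then show ?thesis by (simp add: power2_eq_square mult_ac)
  qed
  have sym: "(a - b) * (ln a - ln b) = (b - a) * (ln b - ln a)" by (simp add: algebra_simps)
  show ?thesis
  proof (cases "a \<le> b")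
    case True
    then show ?thesis using *[of a b] assms by simp
  next
    case False
    then show ?thesis using *[of b a, unfolded sym] assms power2_commute[of "ln b" "ln a"]
      by (simp only: not_le less_imp_le min.absorb2)
  qed
qed

lemma min_mult_log_logistic_diff_sq_le:
  assumes "0 < a" "a \<le> 1 / 4" "0 < b" "b \<le> 1 / 4"
  shows "min a b * (log_logistic b - log_logistic a)\<^sup>2 \<le> (b - a) * (log_logistic b - log_logistic a)"
proof -
  have *: "a * (log_logistic b - log_logistic a)\<^sup>2 \<le> (b - a) * (log_logistic b - log_logistic a)"
    if "0 < a" "a \<le> b" "b \<le> 1 / 4" for a b
  proof -
    define d where "d = log_logistic b - log_logistic a"
    have d: "0 \<le> d" "d \<le> ln b - ln a" using log_logistic_diff[OF that] that by (auto simp: d_def)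
    have "a * d \<le> a * (ln b - ln a)" using d that by (intro mult_left_mono) auto
    also have "\<dots> \<le> b - a" using ln_diff_ge(2)[of a b] that by (simp add: field_simps)
    finally have "a * d * d \<le> (b - a) * d" using d by (intro mult_right_mono)
    then show ?thesis by (simp add: power2_eq_square mult_ac d_def)
  qed
  have sym: "(a - b) * (log_logistic a - log_logistic b) = (b - a) * (log_logistic b - log_logistic a)" by (simp add: algebra_simps)
  show ?thesis
  proof (cases "a \<le> b")
    case True
    then show ?thesis using *[of a b] assms by simp
  next
    case False
    then show ?thesis using *[of b a, unfolded sym] assms power2_commute[of "log_logistic b" "log_logistic a"]
      by (simp only: not_le less_imp_le min.absorb2)
  qed
qed

section \<open>The limit solution for small \<open>\<tau>\<close>\<close>

context irreducible_support begin

text \<open>At \<open>\<eta> = 0\<close> the solution is unique only up to \<open>(v, w) \<mapsto> (c v, w / c)\<close>; the quantities \<open>xfrac\<close>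
  and \<open>mweight\<close> below do not see this scaling. From here on \<open>\<tau> = exp s\<close>.\<close>

definition limit_sol :: "real \<Rightarrow> (real ^ 'n) \<times> (real ^ 'n)" where
  "limit_sol s = (SOME p. sol (exp s) 0 (fst p) (snd p) \<and>
     (Val (exp s) \<longlongrightarrow> val (exp s) 0 (fst p) (snd p)) (at_right 0))"

definition v0 :: "real \<Rightarrow> real ^ 'n" where "v0 s = fst (limit_sol s)"
definition w0 :: "real \<Rightarrow> real ^ 'n" where "w0 s = snd (limit_sol s)"
definition V0 :: "real \<Rightarrow> real" where "V0 s = val (exp s) 0 (v0 s) (w0 s)"
definition xfrac :: "real \<Rightarrow> 'n \<Rightarrow> real" where "xfrac s i = exp s * ucoef (exp s) 0 (v0 s) (w0 s) i"
definition mweight :: "real \<Rightarrow> 'n \<Rightarrow> 'n \<Rightarrow> real" where "mweight s i j = v0 s $ i * S $ i $ j * w0 s $ j"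
definition xtotal :: "real \<Rightarrow> real" where "xtotal s = (\<Sum>i\<in>UNIV. xfrac s i)"

definition C_x :: real where
  "C_x = (\<Sum>i\<in>UNIV. \<bar>ln (S_app 1 i)\<bar>) + (\<Sum>i\<in>UNIV. \<bar>ln (S $ i $ supp_perm i)\<bar>) + real CARD('n)"

text \<open>\<open>ln \<tau>0\<close> secures existence of the limit solution;
  \<open>- (4 * C_x)\<close> turns the bound \<open>X (- s) \<le> C_x\<close> into
  \<open>X \<le> 1/4\<close>.\<close>

definition smax :: real where "smax = min (ln \<tau>0) (- (4 * C_x))"

lemma C_x_pos: "0 < C_x"
  unfolding C_x_def by (intro add_nonneg_pos add_nonneg_nonneg sum_nonneg) auto

context fixes s assumes s: "s < smax" begin

lemma exp_less_\<tau>0: "exp s < \<tau>0"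
proof -
  have "s < ln \<tau>0" using s by (simp add: smax_def)
  then show ?thesis using \<tau>0 by (metis exp_less_cancel_iff exp_ln)
qed

lemma exp_le_1: "exp s \<le> 1" using exp_less_\<tau>0 \<tau>0 by linarith

lemma limit_sol: "sol (exp s) 0 (v0 s) (w0 s)" "(Val (exp s) \<longlongrightarrow> V0 s) (at_right 0)"
proof -
  have "\<exists>p. sol (exp s) 0 (fst p) (snd p) \<and>
     (Val (exp s) \<longlongrightarrow> val (exp s) 0 (fst p) (snd p)) (at_right 0)"
    using exists_sol_zero[OF exp_gt_zero exp_less_\<tau>0] by auto
  from someI_ex[OF this]
  show "sol (exp s) 0 (v0 s) (w0 s)" "(Val (exp s) \<longlongrightarrow> V0 s) (at_right 0)"
    by (auto simp: limit_sol_def v0_def w0_def V0_def)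
qed

lemmas limit_sol_facts = limit_sol(1) exp_gt_zero[of s] order_refl[of "0::real"]

lemma v0_pos: "0 < v0 s $ i" and w0_pos: "0 < w0 s $ i"
  using sol_pos[OF limit_sol_facts] by auto

lemma xfrac_pos: "0 < xfrac s i"
  using sol_ucoef_pos[OF limit_sol_facts] by (simp add: xfrac_def)

lemma xfrac_less_1: "xfrac s i < 1"
  using sol_x_less_1[OF limit_sol_facts] by (simp add: xfrac_def)

lemma mweight_nonneg: "0 \<le> mweight s i j"
  using v0_pos w0_pos by (simp add: mweight_def less_imp_le)

lemma mweight_pos: "0 < S $ i $ j \<Longrightarrow> 0 < mweight s i j"
  using v0_pos w0_pos by (simp add: mweight_def)

lemma row_sum: "(\<Sum>j\<in>UNIV. mweight s i j) = 1 - xfrac s i"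
  using sol_va[OF limit_sol_facts, of i]
  by (simp add: mweight_def xfrac_def S_app_def sum_distrib_left mult_ac)

lemma col_sum: "(\<Sum>i\<in>UNIV. mweight s i j) = 1 - xfrac s j"
  using sol_wc[OF limit_sol_facts, of j]
  by (simp add: mweight_def xfrac_def St_app_def sum_distrib_left mult_ac)

lemma mweight_le_1: "mweight s i j \<le> 1"
proof -
  have "mweight s i j \<le> (\<Sum>j\<in>UNIV. mweight s i j)" using mweight_nonneg by (intro member_le_sum) auto
  then show ?thesis using row_sum[of i] xfrac_pos[of i] by simp
qed

lemma xfrac_prod: "xfrac s i * (1 - xfrac s i) = exp s * (v0 s $ i * w0 s $ i)"
  using sol_vw[OF limit_sol_facts, of i] by (simp add: xfrac_def)

lemma xtotal_pos: "0 < xtotal s" unfolding xtotal_def using xfrac_pos by (intro sum_pos) auto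

lemma xfrac_le_xtotal: "xfrac s i \<le> xtotal s"
  unfolding xtotal_def using xfrac_pos by (intro member_le_sum) (auto simp: less_imp_le)

text \<open>The competitor \<open>u = 1 / (S 1)\<close>, \<open>w = 1\<close> bounds the sum of
  \<open>(1 - x) (- ln u)\<close> from above, where \<open>ln u = ln x - s\<close> and
  \<open>- x ln x \<le> 1\<close>; the sum of the \<open>ln u\<close> is bounded through the support
  permutation. This weak decay of X gives \<open>x \<le> 1/4\<close> and, later,
  \<open>\<kappa> > 0\<close>.\<close>

lemma xtotal_bound: "xtotal s * - s \<le> C_x"
proof -
  define u where "u i = ucoef (exp s) 0 (v0 s) (w0 s) i" for i
  define K where "K = real CARD('n)"
  have u: "0 < u i" for i using sol_ucoef_pos[OF limit_sol_facts] by (simp add: u_def)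
  have x: "xfrac s i = exp s * u i" for i by (simp add: xfrac_def u_def)
  have lnx: "ln (u i) = ln (xfrac s i) - s" for i using u[of i] by (simp add: x ln_mult_pos)
  have r: "0 < S_app 1 i" for i by (rule S_app_pos) simp
  have "(\<Sum>i\<in>UNIV. (1 - exp s * u i) * (ln (1 / S_app 1 i) - ln (u i)))
    \<le> 0 * (\<Sum>i\<in>UNIV. w0 s $ i * (ln ((1 :: real ^ 'n) $ i) - ln (w0 s $ i)))"
    unfolding u_def
  proof (rule key_inequality[OF limit_sol_facts])
    show "0 < 1 / S_app 1 i" "0 < (1 :: real ^ 'n) $ i" for i using r[of i] by auto
    show "1 / S_app 1 i * (0 + S_app 1 i) \<le> (1 :: real ^ 'n) $ i" for i using r[of i] by simp
  qed
  then have upper: "(\<Sum>i\<in>UNIV. (1 - xfrac s i) * (- ln (S_app 1 i) - (ln (xfrac s i) - s))) \<le> 0"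
    using r unfolding x[symmetric] lnx by (simp add: ln_div less_imp_neq[symmetric])
  have "- \<bar>ln (S_app 1 i)\<bar> - ln (u i) - 1 - xfrac s i * s \<le> (1 - xfrac s i) * (- ln (S_app 1 i) - (ln (xfrac s i) - s))" for i
  proof -
    have "ln (1 / xfrac s i) \<le> 1 / xfrac s i - 1" using xfrac_pos[of i] by (intro ln_le_minus_one) auto
    then have "xfrac s i * (- ln (xfrac s i)) \<le> xfrac s i * (1 / xfrac s i - 1)"
      using xfrac_pos[of i] by (intro mult_left_mono) (auto simp: ln_div)
    also have "\<dots> \<le> 1" using xfrac_pos[of i] by (simp add: right_diff_distrib)
    finally have 1: "xfrac s i * (- ln (xfrac s i)) \<le> 1" .
    have "(1 - xfrac s i) * ln (S_app 1 i) \<le> (1 - xfrac s i) * \<bar>ln (S_app 1 i)\<bar>"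
      using xfrac_less_1[of i] by (intro mult_left_mono) auto
    also have "\<dots> \<le> 1 * \<bar>ln (S_app 1 i)\<bar>"
      using xfrac_pos[of i] by (intro mult_right_mono) auto
    finally show ?thesis using 1 lnx[of i] by (simp add: algebra_simps)
  qed
  then have "(\<Sum>i\<in>UNIV. - \<bar>ln (S_app 1 i)\<bar> - ln (u i) - 1 - xfrac s i * s)
      \<le> (\<Sum>i\<in>UNIV. (1 - xfrac s i) * (- ln (S_app 1 i) - (ln (xfrac s i) - s)))"
    by (rule sum_mono)
  also note upper
  finally have "(\<Sum>i\<in>UNIV. - \<bar>ln (S_app 1 i)\<bar> - ln (u i) - 1 - xfrac s i * s) \<le> 0" .
  then have 1: "xtotal s * - s \<le> (\<Sum>i\<in>UNIV. \<bar>ln (S_app 1 i)\<bar>) + (\<Sum>i\<in>UNIV. ln (u i)) + K"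
    by (simp add: sum_subtractf sum_negf xtotal_def sum_distrib_right K_def)
  have ln_prod': "ln (\<Prod>i\<in>UNIV. f i) = (\<Sum>i\<in>UNIV. ln (f i))" if "\<And>i. 0 < f i" for f :: "'n \<Rightarrow> real"
    using that by (intro ln_prod) (auto simp: less_imp_neq[symmetric])
  have "ln ((\<Prod>i\<in>UNIV. u i) * (\<Prod>i\<in>UNIV. S $ i $ supp_perm i)) \<le> 0"
    using prod_ucoef_le[OF limit_sol_facts] u supp_perm(2) by (simp add: u_def ln_le_zero_iff prod_pos)
  then have "(\<Sum>i\<in>UNIV. ln (u i)) + (\<Sum>i\<in>UNIV. ln (S $ i $ supp_perm i)) \<le> 0"
    using u supp_perm(2) ln_prod'[of u] ln_prod'[of "\<lambda>i. S $ i $ supp_perm i"]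
    by (simp add: ln_mult_pos prod_pos)
  moreover have "- (\<Sum>i\<in>UNIV. ln (S $ i $ supp_perm i)) \<le> (\<Sum>i\<in>UNIV. \<bar>ln (S $ i $ supp_perm i)\<bar>)"
    unfolding sum_negf[symmetric] by (intro sum_mono) auto
  ultimately show ?thesis using 1 by (simp add: C_x_def K_def)
qed

lemma xtotal_le: "xtotal s \<le> 1 / 4"
proof (rule ccontr)
  assume *: "\<not> ?thesis"
  have "4 * C_x < - s" using s by (simp add: smax_def)
  then have "1 / 4 * (4 * C_x) < xtotal s * - s"
    using * C_x_pos by (intro mult_strict_mono) auto
  then show False using xtotal_bound by simp
qed

lemma xfrac_le: "xfrac s i \<le> 1 / 4" using xfrac_le_xtotal[of i] xtotal_le by simp

end

text \<open>At \<open>\<eta> = 0\<close> the constraint does not involve \<open>\<tau>\<close>, so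
  the minimizer at \<open>t\<close> is a competitor at \<open>s\<close>; the objective changes only
  in the coefficient of the sum of the \<open>u\<close>.\<close>

lemma V0_diff_le:
  assumes s: "s < smax" and t: "t < smax"
  shows "V0 s - V0 t \<le> (exp s - exp t) * (xtotal t * exp (- t))"
proof -
  define u where "u i = ucoef (exp t) 0 (v0 t) (w0 t) i" for i
  have xtotal: "xtotal t * exp (- t) = (\<Sum>i\<in>UNIV. u i)"
    by (simp add: xtotal_def xfrac_def u_def sum_distrib_left[symmetric] exp_minus)
  have "V0 s \<le> V0 s + exp s * (\<Sum>i\<in>UNIV. (sqrt (u i) - sqrt (ucoef (exp s) 0 (v0 s) (w0 s) i))\<^sup>2)"
    by (simp add: sum_nonneg)
  also have "\<dots> \<le> (\<Sum>i\<in>UNIV. exp s * u i - ln (u i))"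
    using value_le[OF limit_sol_facts[OF s], of u "w0 t"] sol_ucoef_pos[OF limit_sol_facts[OF t]] w0_pos[OF t]
      sol_w_eq[OF limit_sol_facts[OF t]]
    by (simp add: V0_def val_def u_def)
  also have "\<dots> = V0 t + (exp s - exp t) * (\<Sum>i\<in>UNIV. u i)"
    by (simp add: V0_def val_def u_def sum_subtractf sum_distrib_left[symmetric] left_diff_distrib)
  finally show ?thesis by (simp add: xtotal)
qed

lemma ln_mweight: assumes "s < smax" "0 < S $ i $ j"
  shows "ln (mweight s i j) = ln (v0 s $ i) + ln (S $ i $ j) + ln (w0 s $ j)"
  using v0_pos[OF assms(1), of i] w0_pos[OF assms(1), of j] assms(2) by (simp add: mweight_def ln_mult_pos)

lemma log_logistic_xfrac: assumes "s < smax"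
  shows "log_logistic (xfrac s i) = s + ln (v0 s $ i) + ln (w0 s $ i)"
proof -
  have "log_logistic (xfrac s i) = ln (xfrac s i * (1 - xfrac s i))"
    using xfrac_pos[OF assms, of i] xfrac_less_1[OF assms, of i] by (simp add: log_logistic_def ln_mult_pos)
  also have "\<dots> = s + ln (v0 s $ i) + ln (w0 s $ i)"
    using v0_pos[OF assms, of i] w0_pos[OF assms, of i] by (simp add: xfrac_prod[OF assms] ln_mult_pos)
  finally show ?thesis .
qed

section \<open>Edge coordinates and differentiability of X\<close>

text \<open>Positive entries of \<open>S\<close> and the variables \<open>x\<close> become
  coordinates of one vector. Along the solution, \<open>edge_log\<close> of each is
  \<open>ln v + ln w\<close> plus a constant plus \<open>edge_degree\<close> times
  \<open>s\<close>.\<close>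

definition S_edges :: "(('n \<times> 'n) + 'n) set" where "S_edges = {p. 0 < S $ fst p $ snd p} <+> UNIV"
definition edge_weight :: "real \<Rightarrow> ('n \<times> 'n) + 'n \<Rightarrow> real" where
  "edge_weight s = case_sum (\<lambda>p. mweight s (fst p) (snd p)) (xfrac s)"
definition edge_log :: "('n \<times> 'n) + 'n \<Rightarrow> real \<Rightarrow> real" where "edge_log = case_sum (\<lambda>_. ln) (\<lambda>_. log_logistic)"
definition edge_degree :: "('n \<times> 'n) + 'n \<Rightarrow> real" where "edge_degree = case_sum (\<lambda>_. 0) (\<lambda>_. 1)"

lemma Inl_S_edges: "0 < S $ i $ j \<Longrightarrow> Inl (i, j) \<in> S_edges"
  and Inr_S_edges: "Inr i \<in> S_edges"
  by (auto simp: S_edges_def)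

lemma sum_S_edges: "(\<Sum>e\<in>S_edges. g e) = (\<Sum>p\<in>{p. 0 < S $ fst p $ snd p}. g (Inl p)) + (\<Sum>i\<in>UNIV. g (Inr i))"
  unfolding S_edges_def by (subst sum.Plus) auto

text \<open>The left factor is an array whose row and column sums, the \<open>x\<close> included,
  vanish; the right factor has the form \<open>\<alpha> i + \<beta> j\<close>. Such arrays are
  orthogonal even when taken at different parameters \<open>s\<close> and \<open>t\<close>, as the
  Cauchy argument demands.\<close>

lemma edge_weight_orth:
  assumes "s < smax" "t < smax" "a < smax"
  shows "(\<Sum>e\<in>S_edges. (edge_weight s e - edge_weight a e) * (edge_log e (edge_weight t e) - edge_log e (edge_weight a e) - edge_degree e * (t - a))) = 0"
proof -
  define \<alpha> where "\<alpha> i = ln (v0 t $ i) - ln (v0 a $ i)" for i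
  define \<beta> where "\<beta> i = ln (w0 t $ i) - ln (w0 a $ i)" for i
  define \<mu> where "\<mu> i j = mweight s i j - mweight a i j" for i j
  define \<xi> where "\<xi> i = xfrac s i - xfrac a i" for i
  have rows: "(\<Sum>j\<in>UNIV. \<mu> i j) = - \<xi> i" and cols: "(\<Sum>j\<in>UNIV. \<mu> j i) = - \<xi> i" for i
    using row_sum col_sum assms by (simp_all add: \<mu>_def \<xi>_def sum_subtractf)
  have "(\<Sum>e\<in>S_edges. (edge_weight s e - edge_weight a e) * (edge_log e (edge_weight t e) - edge_log e (edge_weight a e) - edge_degree e * (t - a)))
    = (\<Sum>p\<in>{p. 0 < S $ fst p $ snd p}. \<mu> (fst p) (snd p) * (\<alpha> (fst p) + \<beta> (snd p))) + (\<Sum>i\<in>UNIV. \<xi> i * (\<alpha> i + \<beta> i))"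
    unfolding sum_S_edges using assms
    by (intro arg_cong2[of _ _ _ _ "(+)"] sum.cong)
      (auto simp: edge_weight_def edge_log_def edge_degree_def ln_mweight log_logistic_xfrac \<alpha>_def \<beta>_def \<mu>_def \<xi>_def)
  also have "(\<Sum>p\<in>{p. 0 < S $ fst p $ snd p}. \<mu> (fst p) (snd p) * (\<alpha> (fst p) + \<beta> (snd p)))
    = (\<Sum>p\<in>UNIV. \<mu> (fst p) (snd p) * (\<alpha> (fst p) + \<beta> (snd p)))"
    by (rule sum.mono_neutral_left) (auto simp: \<mu>_def mweight_def not_less intro: order_antisym)
  also have "\<dots> = (\<Sum>i\<in>UNIV. \<Sum>j\<in>UNIV. \<mu> i j * (\<alpha> i + \<beta> j))"
    by (simp add: sum.cartesian_product case_prod_unfold)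
  also have "\<dots> = (\<Sum>i\<in>UNIV. \<Sum>j\<in>UNIV. \<mu> i j * \<alpha> i) + (\<Sum>i\<in>UNIV. \<Sum>j\<in>UNIV. \<mu> i j * \<beta> j)"
    by (simp add: distrib_left sum.distrib)
  also have "(\<Sum>i\<in>UNIV. \<Sum>j\<in>UNIV. \<mu> i j * \<beta> j) = (\<Sum>j\<in>UNIV. \<Sum>i\<in>UNIV. \<mu> i j * \<beta> j)" by (rule sum.swap)
  also have "(\<Sum>i\<in>UNIV. \<Sum>j\<in>UNIV. \<mu> i j * \<alpha> i) + (\<Sum>j\<in>UNIV. \<Sum>i\<in>UNIV. \<mu> i j * \<beta> j) + (\<Sum>i\<in>UNIV. \<xi> i * (\<alpha> i + \<beta> i)) = 0"
    by (simp add: sum_distrib_right[symmetric] rows cols distrib_left sum.distrib sum_negf)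
  finally show ?thesis .
qed

lemma edge_weight_strongly_mono:
  assumes "e \<in> S_edges" "s < smax" "a < smax"
  shows "(edge_weight s e - edge_weight a e)\<^sup>2 \<le> (edge_weight s e - edge_weight a e) * (edge_log e (edge_weight s e) - edge_log e (edge_weight a e))"
proof (cases e)
  case (Inl p)
  then have "0 < S $ fst p $ snd p" using assms(1) by (auto simp: S_edges_def)
  then show ?thesis
    using ln_strongly_mono[of "mweight a (fst p) (snd p)" "mweight s (fst p) (snd p)"] mweight_pos mweight_le_1 assms Inl
    by (simp add: edge_weight_def edge_log_def)
next
  case (Inr i)
  then show ?thesis
    using log_logistic_strongly_mono[of "xfrac a i" "xfrac s i"] xfrac_pos xfrac_le assms by (simp add: edge_weight_def edge_log_def)
qed

text \<open>For \<open>t = s\<close> orthogonality evaluates the total energy as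
  \<open>(s - a) (X s - X a)\<close>. All its terms are non-negative, so it bounds the energy of
  each single edge.\<close>

lemma energy_term_le:
  assumes "e \<in> S_edges" "s < smax" "a < smax"
  shows "min (edge_weight a e) (edge_weight s e) * (edge_log e (edge_weight s e) - edge_log e (edge_weight a e))\<^sup>2 \<le> (s - a) * (xtotal s - xtotal a)"
proof -
  have "min (edge_weight a e) (edge_weight s e) * (edge_log e (edge_weight s e) - edge_log e (edge_weight a e))\<^sup>2 \<le> (edge_weight s e - edge_weight a e) * (edge_log e (edge_weight s e) - edge_log e (edge_weight a e))"
  proof (cases e)
    case (Inl p)
    then have "0 < S $ fst p $ snd p" using assms(1) by (auto simp: S_edges_def)
    then show ?thesis
      using min_mult_ln_diff_sq_le[of "mweight a (fst p) (snd p)" "mweight s (fst p) (snd p)"] mweight_pos assms Inl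
      by (simp add: edge_weight_def edge_log_def)
  next
    case (Inr i)
    then show ?thesis
      using min_mult_log_logistic_diff_sq_le[of "xfrac a i" "xfrac s i"] xfrac_pos xfrac_le assms by (simp add: edge_weight_def edge_log_def)
  qed
  also have "\<dots> \<le> (\<Sum>e\<in>S_edges. (edge_weight s e - edge_weight a e) * (edge_log e (edge_weight s e) - edge_log e (edge_weight a e)))"
  proof (rule member_le_sum[OF assms(1), where f = "\<lambda>e. (edge_weight s e - edge_weight a e) * (edge_log e (edge_weight s e) - edge_log e (edge_weight a e))"])
    show "0 \<le> (edge_weight s e - edge_weight a e) * (edge_log e (edge_weight s e) - edge_log e (edge_weight a e))" if "e \<in> S_edges - {e'}" for e e'
      using order_trans[OF zero_le_power2 edge_weight_strongly_mono[of e s a]] that assms by simp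
  qed (simp add: S_edges_def)
  also have "\<dots> = (\<Sum>e\<in>S_edges. (edge_weight s e - edge_weight a e) * (edge_degree e * (s - a)))"
    using edge_weight_orth[OF assms(2,2,3)] by (simp add: right_diff_distrib sum_subtractf)
  also have "\<dots> = (s - a) * (xtotal s - xtotal a)"
    by (simp add: sum_S_edges edge_degree_def edge_weight_def xtotal_def sum_distrib_right[symmetric] sum_subtractf)
  finally show ?thesis .
qed

lemma edge_weight_differentiable:
  assumes "e \<in> S_edges" "a < smax"
  shows "\<exists>D. ((\<lambda>s. edge_weight s e) has_field_derivative D) (at a)"
proof (rule orthogonal_curves_differentiable[where E = S_edges and U = "{..<smax}" and c = 1 and f = edge_log and n = edge_degree
      and k = "case_sum (\<lambda>p. 1 / mweight a (fst p) (snd p)) (\<lambda>i. 1 / xfrac a i - 1 / (1 - xfrac a i))"])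
  show "finite S_edges" by (simp add: S_edges_def)
  fix e assume e: "e \<in> S_edges"
  show "(edge_log e has_field_derivative (case e of Inl p \<Rightarrow> 1 / mweight a (fst p) (snd p) | Inr i \<Rightarrow> 1 / xfrac a i - 1 / (1 - xfrac a i))) (at (edge_weight a e))"
    using e mweight_pos[OF assms(2)] xfrac_pos[OF assms(2)] xfrac_less_1[OF assms(2)]
    by (auto simp: edge_log_def edge_weight_def S_edges_def log_logistic_def[abs_def] intro!: derivative_eq_intros)
  show "0 < (case e of Inl p \<Rightarrow> 1 / mweight a (fst p) (snd p) | Inr i \<Rightarrow> 1 / xfrac a i - 1 / (1 - xfrac a i))"
  proof (cases e)
    case (Inl p)
    then show ?thesis using e mweight_pos[OF assms(2)] by (auto simp: S_edges_def)
  next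
    case (Inr i)
    have "1 / (1 - xfrac a i) < 1 / xfrac a i"
      using xfrac_pos[OF assms(2), of i] xfrac_le[OF assms(2), of i] by (intro divide_strict_left_mono) auto
    then show ?thesis by (simp add: Inr)
  qed
  show "\<bar>edge_degree e\<bar> \<le> 1" by (cases e) (auto simp: edge_degree_def)
qed (use assms edge_weight_orth edge_weight_strongly_mono in auto)

lemma xfrac_differentiable: "a < smax \<Longrightarrow> \<exists>D. ((\<lambda>s. xfrac s i) has_field_derivative D) (at a)"
  using edge_weight_differentiable[of "Inr i" a] by (simp add: Inr_S_edges edge_weight_def)

lemma xtotal_differentiable:
  assumes "a < smax" shows "(xtotal has_field_derivative deriv xtotal a) (at a)"
proof -
  have "\<forall>i. \<exists>D. ((\<lambda>s. xfrac s i) has_field_derivative D) (at a)"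
    using xfrac_differentiable[OF assms] by simp
  then obtain D where "\<And>i. ((\<lambda>s. xfrac s i) has_field_derivative D i) (at a)"
    unfolding choice_iff by auto
  then have "(xtotal has_field_derivative (\<Sum>i\<in>UNIV. D i)) (at a)"
    unfolding xtotal_def[abs_def] by (intro DERIV_sum)
  then show ?thesis by (simp add: DERIV_imp_deriv)
qed

lemma ln_less_iff: "0 < (x :: real) \<Longrightarrow> ln x < y \<longleftrightarrow> x < exp y"
  using ln_ge_iff[of x y] by (simp add: not_le[symmetric])

text \<open>The same enclosure as for \<open>Val\<close>, now with the slope
  \<open>X / \<tau>\<close>, which is continuous because X is differentiable.\<close>

lemma V0_ln_DERIV:
  assumes "0 < \<tau>" "ln \<tau> < smax"
  shows "((\<lambda>\<tau>. V0 (ln \<tau>)) has_field_derivative xtotal (ln \<tau>) / \<tau>) (at \<tau>)"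
proof -
  define g where "g t = xtotal (ln t) / t" for t
  have "isCont xtotal (ln \<tau>)" using DERIV_isCont[OF xtotal_differentiable[OF assms(2)]] .
  then have "isCont g \<tau>" unfolding g_def using assms(1)
    by (intro continuous_intros isCont_o2[where f = ln and g = xtotal]) auto
  then have g: "((\<lambda>t. \<bar>g t - g \<tau>\<bar>) \<longlongrightarrow> 0) (at \<tau>)"
    by (intro tendsto_rabs_zero) (simp add: isCont_def LIM_zero)
  have diff: "V0 (ln y) - V0 (ln z) \<le> (y - z) * g z" if "0 < y" "0 < z" "ln y < smax" "ln z < smax" for y z
    using V0_diff_le[OF that(3,4)] that by (simp add: g_def exp_minus divide_inverse)
  have "open {0<..<exp smax}" by simp
  moreover have "\<tau> \<in> {0<..<exp smax}" using assms by (simp add: ln_less_iff)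
  ultimately have "eventually (\<lambda>y. y \<in> {0<..<exp smax} - {\<tau>}) (at \<tau>)"
    by (rule eventually_at_in_open)
  then have "eventually (\<lambda>y. (0 < y \<and> ln y < smax) \<and> y \<noteq> \<tau>) (at \<tau>)"
    by eventually_elim (simp add: ln_less_iff)
  then have "eventually (\<lambda>y. norm ((V0 (ln y) - V0 (ln \<tau>)) / (y - \<tau>) - g \<tau>) \<le> \<bar>g y - g \<tau>\<bar>) (at \<tau>)"
  proof eventually_elim
    case (elim y)
    have 1: "V0 (ln y) - V0 (ln \<tau>) \<le> (y - \<tau>) * g \<tau>" using diff[of y \<tau>] elim assms by simp
    have 2: "(y - \<tau>) * g y \<le> V0 (ln y) - V0 (ln \<tau>)" using diff[of \<tau> y] elim assms by (simp add: algebra_simps)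
    have "\<bar>V0 (ln y) - V0 (ln \<tau>) - (y - \<tau>) * g \<tau>\<bar> \<le> \<bar>(y - \<tau>) * g y - (y - \<tau>) * g \<tau>\<bar>"
      using 1 2 by linarith
    also have "\<dots> = \<bar>y - \<tau>\<bar> * \<bar>g y - g \<tau>\<bar>" unfolding right_diff_distrib[symmetric] abs_mult ..
    finally have "\<bar>V0 (ln y) - V0 (ln \<tau>) - (y - \<tau>) * g \<tau>\<bar> / \<bar>y - \<tau>\<bar> \<le> \<bar>g y - g \<tau>\<bar>"
      using elim by (simp add: divide_le_eq mult.commute)
    moreover have "(V0 (ln y) - V0 (ln \<tau>)) / (y - \<tau>) - g \<tau> = (V0 (ln y) - V0 (ln \<tau>) - (y - \<tau>) * g \<tau>) / (y - \<tau>)"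
      using elim by (simp add: diff_divide_distrib)
    ultimately show ?case by (simp add: abs_divide)
  qed
  then have "((\<lambda>y. (V0 (ln y) - V0 (ln \<tau>)) / (y - \<tau>) - g \<tau>) \<longlongrightarrow> 0) (at \<tau>)"
    using g by (rule Lim_null_comparison)
  then show ?thesis by (simp add: has_field_derivative_iff g_def LIM_zero_iff)
qed

text \<open>\<open>V0\<close> is a minimum of functions affine in \<open>\<tau>\<close>, hence
  concave in \<open>\<tau>\<close>; so its slope \<open>X exp (- s)\<close> does not increase with
  \<open>s\<close>, and differentiating this gives the bound.\<close>

lemma deriv_xtotal_le:
  assumes a: "a < smax" shows "deriv xtotal a \<le> xtotal a"
proof -
  have "mono_on {..<smax} (\<lambda>s. - (xtotal s * exp (- s)))"
  proof (rule mono_onI)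
    fix s t assume st: "s \<in> {..<smax}" "t \<in> {..<smax}" "s \<le> t"
    show "- (xtotal s * exp (- s)) \<le> - (xtotal t * exp (- t))"
    proof (cases "s = t")
      case False
      have "(exp s - exp t) * (xtotal t * exp (- t)) + (exp t - exp s) * (xtotal s * exp (- s)) \<ge> 0"
        using V0_diff_le[of s t] V0_diff_le[of t s] st by simp
      then have "0 \<le> (exp t - exp s) * (xtotal s * exp (- s) - xtotal t * exp (- t))" by (simp add: algebra_simps)
      moreover have "0 < exp t - exp s" using st False by simp
      ultimately have "0 \<le> xtotal s * exp (- s) - xtotal t * exp (- t)"
        using mult_le_cancel_left_pos[of "exp t - exp s" 0] by simp
      then show ?thesis by simp
    qed auto
  qed
  moreover have "((\<lambda>s. - (xtotal s * exp (- s))) has_real_derivative (xtotal a - deriv xtotal a) * exp (- a)) (at a)"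
    by (auto intro!: derivative_eq_intros xtotal_differentiable a simp: algebra_simps)
  moreover have "a \<in> interior {..<smax}" using a by (simp add: interior_open)
  ultimately have "0 \<le> (xtotal a - deriv xtotal a) * exp (- a)" by (rule mono_on_imp_deriv_nonneg)
  then show ?thesis by (simp add: zero_le_mult_iff)
qed

end

section \<open>Cycles in the normal form graph\<close>

lemma relpow_length_bound:
  fixes R :: "('a::finite \<times> 'a) set"
  assumes "(x, y) \<in> R\<^sup>*"
  shows "\<exists>n\<le>CARD('a) * CARD('a). (x, y) \<in> R ^^ n"
proof -
  have "card R \<le> card (UNIV :: ('a \<times> 'a) set)" by (rule card_mono) auto
  then have "card R \<le> CARD('a) * CARD('a)" by (simp add: card_cartesian_product flip: UNIV_Times_UNIV)
  then show ?thesis using assms rtrancl_finite_eq_relpow[of R] by (auto intro: order_trans)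
qed

lemma relpow_potential_le:
  fixes g :: "'a \<Rightarrow> real"
  assumes "(x, y) \<in> R ^^ n" "\<And>x y. (x, y) \<in> R \<Longrightarrow> g y - g x \<le> c"
  shows "g y - g x \<le> real n * c"
  using assms(1)
proof (induction n arbitrary: y)
  case (Suc n)
  then obtain z where z: "(x, z) \<in> R ^^ n" "(z, y) \<in> R" by auto
  then have "g z - g x \<le> real n * c" "g y - g z \<le> c" using Suc.IH assms(2) by auto
  then show ?case by (simp add: distrib_right)
qed simp

text \<open>A matrix with all row and column sums equal to one is a circulation.\<close>

lemma circulation_cut:
  fixes f :: "'a::finite \<Rightarrow> 'a \<Rightarrow> real"
  assumes "\<And>i. (\<Sum>j\<in>UNIV. f i j) = 1" "\<And>j. (\<Sum>i\<in>UNIV. f i j) = 1"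
  shows "(\<Sum>i\<in>A. \<Sum>j\<in>-A. f i j) = (\<Sum>i\<in>-A. \<Sum>j\<in>A. f i j)"
proof -
  have split: "(\<Sum>j\<in>UNIV. g j) = (\<Sum>j\<in>A. g j) + (\<Sum>j\<in>-A. g j)" for g :: "'a \<Rightarrow> real"
    by (subst sum.union_disjoint[symmetric]) (auto simp: Compl_partition)
  have "(\<Sum>i\<in>A. \<Sum>j\<in>A. f i j) + (\<Sum>i\<in>A. \<Sum>j\<in>-A. f i j) = real (card A)"
    using assms(1) unfolding split by (simp add: sum.distrib[symmetric])
  moreover have "(\<Sum>i\<in>A. \<Sum>j\<in>A. f i j) + (\<Sum>i\<in>-A. \<Sum>j\<in>A. f i j) = real (card A)"
  proof -
    have "(\<Sum>j\<in>A. \<Sum>i\<in>A. f i j) + (\<Sum>j\<in>A. \<Sum>i\<in>-A. f i j) = real (card A)"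
      using assms(2) unfolding split by (simp add: sum.distrib[symmetric])
    then show ?thesis by (subst (1 2) sum.swap)
  qed
  ultimately show ?thesis by linarith
qed

lemma cas_snoc:
  assumes "pre_digraph.cas H u \<gamma> v" "tail H e = v" "head H e = w"
  shows "pre_digraph.cas H u (\<gamma> @ [e]) w"
  using assms by (induction \<gamma> arbitrary: u) (auto simp: pre_digraph.cas.simps)

text \<open>The index \<open>i\<close> stands for row \<open>p1 i\<close> and column \<open>p2 i\<close> of \<open>S\<close>, which meet on the diagonal of the
  normal form; a \<open>Prec\<close> edge from \<open>i\<close> to \<open>j\<close> is an equality \<open>p1 i = p2 j\<close>.\<close>

locale block_structure = irreducible_support S for S :: "'n::finite sqmat" +
  fixes p1 p2 :: "'n \<Rightarrow> 'n" and b :: "'n \<Rightarrow> nat"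
  assumes p1: "bij p1" and p2: "bij p2"
    and tri: "\<And>i j. 0 < S $ p1 i $ p2 j \<Longrightarrow> b i \<le> b j"
    and diag: "\<And>i. 0 < S $ p1 i $ p2 i"
    and block_conn: "\<And>i j. b i = b j \<Longrightarrow> (i, j) \<in> {(i, j). 0 < S $ p1 i $ p2 j \<and> b i = b j}\<^sup>*"
begin

text \<open>Only differences of \<open>\<beta>\<close> enter, so the scaling freedom in
  \<open>w\<close> is harmless. Dividing by the diagonal weight at the tail of an edge removes
  \<open>v\<close>, which is why a single potential is enough.\<close>

definition \<beta> :: "real \<Rightarrow> 'n \<Rightarrow> real" where "\<beta> s i = ln (w0 s $ p2 i)"
definition log_diag :: "real \<Rightarrow> 'n \<Rightarrow> real" where "log_diag s i = ln (mweight s (p1 i) (p2 i))"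
definition log_entry :: "'n \<Rightarrow> 'n \<Rightarrow> real" where "log_entry i j = ln (S $ p1 i $ p2 j)"
definition K :: real where "K = real CARD('n)"

lemma K_pos: "1 \<le> K" by (simp add: K_def Suc_leI)

text \<open>Up to constants, the logarithm of an edge weight relative to the diagonal weight at its tail is
  a difference of potentials, plus \<open>s\<close> for a \<open>Prec\<close> edge. The constants \<open>C_k\<close>, \<open>C_d\<close>, \<open>C1\<close>, \<open>...\<close> below
  are uniform in \<open>s\<close>.\<close>

lemma mweight_edge: assumes "s < smax" "0 < S $ p1 i $ p2 j"
  shows "ln (mweight s (p1 i) (p2 j)) - log_diag s i = log_entry i j - log_entry i i + \<beta> s j - \<beta> s i"
  using assms diag by (simp add: log_diag_def ln_mweight log_entry_def \<beta>_def)

lemma xfrac_edge: assumes "s < smax" "p1 i = p2 j"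
  shows "log_logistic (xfrac s (p1 i)) - log_diag s i = s - log_entry i i + \<beta> s j - \<beta> s i"
proof -
  have "log_logistic (xfrac s (p1 i)) = s + ln (v0 s $ p1 i) + ln (w0 s $ p2 j)"
    using assms(2) by (simp add: log_logistic_xfrac[OF assms(1)])
  then show ?thesis using ln_mweight[OF assms(1) diag, of i] by (simp add: log_diag_def log_entry_def \<beta>_def)
qed

lemma ln_1_minus_ge: assumes "s < smax" shows "- 1 \<le> ln (1 - xfrac s i)"
proof -
  have "ln 1 - ln (1 - xfrac s i) \<le> (1 - (1 - xfrac s i)) / (1 - xfrac s i)"
    using xfrac_le[OF assms, of i] xfrac_pos[OF assms, of i] by (intro ln_diff_ge) auto
  also have "\<dots> \<le> 1" using xfrac_le[OF assms, of i] by simp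
  finally show ?thesis by simp
qed

definition C_k :: real where "C_k = (\<Sum>p\<in>UNIV. \<bar>log_entry (fst p) (snd p)\<bar>)"

lemma log_entry_le: "\<bar>log_entry i j\<bar> \<le> C_k"
  unfolding C_k_def using member_le_sum[of "(i, j)" UNIV "\<lambda>p. \<bar>log_entry (fst p) (snd p)\<bar>"] by simp

lemma C_k_nonneg: "0 \<le> C_k" by (simp add: C_k_def sum_nonneg)

definition C_d :: real where "C_d = K * C_k + \<bar>C_val\<bar> + K"

lemma C_d_nonneg: "0 \<le> C_d" using C_k_nonneg K_pos by (simp add: C_d_def)

text \<open>The diagonal of the normal form meets every row and column of \<open>S\<close> once, so
  the sum of \<open>log_diag\<close> contains every \<open>ln v\<close> and \<open>ln w\<close>
  once. These add up to the sum of \<open>ln u + ln (1 - x)\<close>, which the bound on the value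
  controls from below. All terms being at most 0, each one is bounded below.\<close>

lemma log_diag_bounds: assumes "s < smax" shows "- C_d \<le> log_diag s i" "log_diag s i \<le> 0"
proof -
  have nonpos: "log_diag s i \<le> 0" for i
    using mweight_pos[OF assms diag] mweight_le_1[OF assms] by (simp add: log_diag_def ln_le_zero_iff)
  then show "log_diag s i \<le> 0" .
  define u where "u k = ucoef (exp s) 0 (v0 s) (w0 s) k" for k
  have "(\<Sum>i\<in>UNIV. log_diag s i) = (\<Sum>i\<in>UNIV. log_entry i i) + ((\<Sum>i\<in>UNIV. ln (v0 s $ p1 i)) + (\<Sum>i\<in>UNIV. ln (w0 s $ p2 i)))"
    using assms diag by (simp add: log_diag_def ln_mweight log_entry_def sum.distrib)
  also have "(\<Sum>i\<in>UNIV. ln (v0 s $ p1 i)) = (\<Sum>k\<in>UNIV. ln (v0 s $ k))"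
    by (rule sum.reindex_bij_betw[OF p1])
  also have "(\<Sum>i\<in>UNIV. ln (w0 s $ p2 i)) = (\<Sum>k\<in>UNIV. ln (w0 s $ k))"
    by (rule sum.reindex_bij_betw[OF p2])
  also have "(\<Sum>k\<in>UNIV. ln (v0 s $ k)) + (\<Sum>k\<in>UNIV. ln (w0 s $ k)) = (\<Sum>k\<in>UNIV. ln (u k) + ln (1 - xfrac s k))"
    unfolding sum.distrib[symmetric]
  proof (rule sum.cong[OF refl])
    fix k
    have "ln (v0 s $ k) + ln (w0 s $ k) = ln (v0 s $ k * w0 s $ k)"
      using v0_pos[OF assms] w0_pos[OF assms] by (simp add: ln_mult_pos)
    also have "\<dots> = ln (u k) + ln (1 - xfrac s k)"
      using sol_ucoef_pos[OF limit_sol_facts[OF assms]] xfrac_less_1[OF assms, of k]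
      by (simp add: sol_vw[OF limit_sol_facts[OF assms]] u_def xfrac_def ln_mult_pos)
    finally show "ln (v0 s $ k) + ln (w0 s $ k) = ln (u k) + ln (1 - xfrac s k)" .
  qed
  finally have "(\<Sum>i\<in>UNIV. log_diag s i) = (\<Sum>i\<in>UNIV. log_entry i i) + (\<Sum>k\<in>UNIV. ln (u k) + ln (1 - xfrac s k))" .
  moreover have "- C_val - K \<le> (\<Sum>k\<in>UNIV. ln (u k) + ln (1 - xfrac s k))"
  proof -
    have "(\<Sum>k\<in>UNIV. ln (u k)) \<ge> - C_val"
      using sum_neg_ln_ucoef_le[OF limit_sol_facts[OF assms] exp_le_1[OF assms]] by (simp add: u_def sum_negf)
    moreover have "(\<Sum>k\<in>(UNIV :: 'n set). - 1) \<le> (\<Sum>k\<in>UNIV. ln (1 - xfrac s k))"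
      using ln_1_minus_ge[OF assms] by (intro sum_mono)
    ultimately show ?thesis by (simp add: sum.distrib K_def)
  qed
  ultimately have "(\<Sum>i\<in>UNIV. log_entry i i) - C_val - K \<le> (\<Sum>i\<in>UNIV. log_diag s i)" by linarith
  moreover have "(\<Sum>i\<in>(UNIV :: 'n set). - C_k) \<le> (\<Sum>i\<in>UNIV. log_entry i i)"
    using log_entry_le by (intro sum_mono) (simp add: abs_le_iff minus_le_iff)
  moreover have "- log_diag s i \<le> (\<Sum>i\<in>UNIV. - log_diag s i)"
    using nonpos by (intro member_le_sum) auto
  ultimately show "- C_d \<le> log_diag s i" by (simp add: C_d_def sum_negf K_def)
qed

definition C1 :: real where "C1 = C_d + 2 * C_k"

lemma C1_nonneg: "0 \<le> C1" using C_d_nonneg C_k_nonneg by (simp add: C1_def)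

lemma \<beta>_edge_le:
  assumes "s < smax" "0 < S $ p1 i $ p2 j"
  shows "\<beta> s j - \<beta> s i \<le> ln (mweight s (p1 i) (p2 j)) + C1"
  using mweight_edge[OF assms] log_diag_bounds[OF assms(1), of i] log_entry_le[of i j] log_entry_le[of i i] by (simp add: C1_def)

definition C2 :: real where "C2 = K * K * C1"

text \<open>Inside a block one gets from \<open>i\<close> to \<open>j\<close> along at most
  \<open>K * K\<close> positive entries, and as weights are at most 1, each raises
  \<open>\<beta>\<close> by at most \<open>C1\<close>. Applied both ways, \<open>\<beta>\<close> is
  constant on a block up to \<open>C2\<close>.\<close>

lemma \<beta>_block_le:
  assumes "s < smax" "b i = b j"
  shows "\<beta> s j - \<beta> s i \<le> C2"
proof -
  obtain n where n: "n \<le> CARD('n) * CARD('n)" "(i, j) \<in> {(i, j). 0 < S $ p1 i $ p2 j \<and> b i = b j} ^^ n"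
    using relpow_length_bound[OF block_conn[OF assms(2)]] by auto
  have "\<beta> s j - \<beta> s i \<le> real n * C1"
  proof (rule relpow_potential_le[OF n(2)])
    fix x y assume "(x, y) \<in> {(i, j). 0 < S $ p1 i $ p2 j \<and> b i = b j}"
    then have p: "0 < S $ p1 x $ p2 y" by simp
    have "ln (mweight s (p1 x) (p2 y)) \<le> 0"
      using mweight_pos[OF assms(1) p] mweight_le_1[OF assms(1)] by (simp add: ln_le_zero_iff)
    then show "\<beta> s y - \<beta> s x \<le> C1" using \<beta>_edge_le[OF assms(1) p] by simp
  qed
  also have "\<dots> \<le> (K * K) * C1"
    using n(1) C1_nonneg unfolding K_def by (intro mult_right_mono) (simp_all flip: of_nat_mult)
  finally show ?thesis by (simp add: C2_def)
qed

definition block_pot :: "real \<Rightarrow> nat \<Rightarrow> real" where "block_pot s l = \<beta> s (SOME i. b i = l)"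

lemma block_pot_diff: assumes "s < smax" shows "\<bar>block_pot s (b i) - \<beta> s i\<bar> \<le> C2"
proof -
  have "b (SOME j. b j = b i) = b i" by (rule someI) (rule refl)
  then show ?thesis using \<beta>_block_le[OF assms, of i "SOME j. b j = b i"] \<beta>_block_le[OF assms, of "SOME j. b j = b i" i]
    by (simp add: block_pot_def abs_le_iff)
qed

section \<open>The doubly stochastic circulation and its heavy edges\<close>

text \<open>The doubly stochastic matrix of the overview, with rows and columns rearranged as in the
  normal form; both kinds of edge from \<open>i\<close> to \<open>j\<close> are added up.\<close>

definition flow :: "real \<Rightarrow> 'n \<Rightarrow> 'n \<Rightarrow> real" where
  "flow s i j = mweight s (p1 i) (p2 j) + (if p1 i = p2 j then xfrac s (p1 i) else 0)"

lemma ex1_p2: "\<exists>!j. p2 j = k" and ex1_p1: "\<exists>!i. p1 i = k"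
  using bij_pointE[OF p1] bij_pointE[OF p2] by metis+

lemma sum_p2: "(\<Sum>j\<in>UNIV. if p1 i = p2 j then c else 0) = c" for c :: real
proof -
  obtain j0 where j0: "p2 j0 = p1 i" "\<And>j. p2 j = p1 i \<Longrightarrow> j = j0" using ex1_p2[of "p1 i"] by auto
  have "p1 i = p2 j \<longleftrightarrow> j = j0" for j
    using j0(1) j0(2)[of j] by (cases "j = j0") (simp, metis)
  then show ?thesis by simp
qed

lemma sum_p1: "(\<Sum>i\<in>UNIV. if p1 i = p2 j then c else 0) = c" for c :: real
proof -
  obtain i0 where i0: "p1 i0 = p2 j" "\<And>i. p1 i = p2 j \<Longrightarrow> i = i0" using ex1_p1[of "p2 j"] by auto
  have "p1 i = p2 j \<longleftrightarrow> i = i0" for i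
    using i0(1) i0(2)[of i] by (cases "i = i0") (simp, metis)
  then show ?thesis by simp
qed

context fixes s assumes s: "s < smax" begin

lemma flow_nonneg: "0 \<le> flow s i j"
  using mweight_nonneg[OF s] xfrac_pos[OF s] by (simp add: flow_def less_imp_le)

lemma flow_rows: "(\<Sum>j\<in>UNIV. flow s i j) = 1"
proof -
  have "(\<Sum>j\<in>UNIV. mweight s (p1 i) (p2 j)) = (\<Sum>k\<in>UNIV. mweight s (p1 i) k)"
    by (rule sum.reindex_bij_betw[OF p2])
  then show ?thesis unfolding flow_def sum.distrib sum_p2 by (simp add: row_sum[OF s])
qed

lemma flow_cols: "(\<Sum>i\<in>UNIV. flow s i j) = 1"
proof -
  have "(\<Sum>i\<in>UNIV. mweight s (p1 i) (p2 j)) = (\<Sum>k\<in>UNIV. mweight s k (p2 j))"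
    by (rule sum.reindex_bij_betw[OF p1])
  moreover have "(\<Sum>i\<in>UNIV. if p1 i = p2 j then xfrac s (p1 i) else 0) = (\<Sum>i\<in>UNIV. if p1 i = p2 j then xfrac s (p2 j) else 0)"
    by (intro sum.cong) auto
  ultimately show ?thesis unfolding flow_def sum.distrib by (simp add: col_sum[OF s] sum_p1)
qed

text \<open>Cut between the blocks up to \<open>b i\<close> and the later ones. By triangularity
  flow returns only along \<open>x\<close> edges, in total at most X, and a circulation carries as
  much out as back.\<close>

lemma mweight_interblock_le:
  assumes "b i < b j" shows "mweight s (p1 i) (p2 j) \<le> xtotal s"
proof -
  define A where "A = {k. b k \<le> b i}"
  have "flow s i j \<le> (\<Sum>j\<in>-A. flow s i j)"
    using flow_nonneg assms by (intro member_le_sum) (auto simp: A_def)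
  also have "\<dots> \<le> (\<Sum>i\<in>A. \<Sum>j\<in>-A. flow s i j)"
    using flow_nonneg by (intro member_le_sum[of i A "\<lambda>i. \<Sum>j\<in>-A. flow s i j"]) (auto simp: A_def sum_nonneg)
  also have "\<dots> = (\<Sum>i\<in>-A. \<Sum>j\<in>A. flow s i j)" using flow_rows flow_cols by (rule circulation_cut)
  also have "\<dots> \<le> (\<Sum>i\<in>-A. xfrac s (p1 i))"
  proof (rule sum_mono)
    fix i assume i: "i \<in> - A"
    have "mweight s (p1 i) (p2 j) = 0" if "j \<in> A" for j
    proof -
      have "\<not> 0 < S $ p1 i $ p2 j" using tri[of i j] that i by (auto simp: A_def)
      then show ?thesis using S_nonneg[of "p1 i" "p2 j"] by (simp add: mweight_def)
    qed
    then have "(\<Sum>j\<in>A. flow s i j) = (\<Sum>j\<in>A. if p1 i = p2 j then xfrac s (p1 i) else 0)"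
      by (intro sum.cong) (auto simp: flow_def)
    also have "\<dots> \<le> (\<Sum>j\<in>UNIV. if p1 i = p2 j then xfrac s (p1 i) else 0)"
      using xfrac_pos[OF s] by (intro sum_mono2) (auto simp: less_imp_le)
    finally show "(\<Sum>j\<in>A. flow s i j) \<le> xfrac s (p1 i)" by (simp add: sum_p2)
  qed
  also have "\<dots> \<le> (\<Sum>i\<in>UNIV. xfrac s (p1 i))"
    using xfrac_pos[OF s] by (intro sum_mono2) (auto simp: less_imp_le)
  also have "\<dots> = xtotal s" unfolding xtotal_def by (rule sum.reindex_bij_betw[OF p1])
  finally show ?thesis using xfrac_pos[OF s, of "p1 i"] by (simp add: flow_def split: if_splits)
qed

text \<open>The threshold comes from a count: the largest \<open>x\<close> is at least
  \<open>X / K\<close>, while a cut crossed by light edges only carries at most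
  \<open>2 * K * K\<close> times the threshold, that is \<open>X / (2 * K)\<close>.\<close>

definition heavy :: "'n \<Rightarrow> edge_label \<Rightarrow> 'n \<Rightarrow> bool" where
  "heavy i c j \<longleftrightarrow> (case c of
     Lhd \<Rightarrow> 0 < S $ p1 i $ p2 j \<and> xtotal s / (4 * K ^ 3) \<le> mweight s (p1 i) (p2 j)
   | Prec \<Rightarrow> p1 i = p2 j \<and> xtotal s / (4 * K ^ 3) \<le> xfrac s (p1 i))"

definition heavy_rel :: "('n \<times> 'n) set" where "heavy_rel = {(i, j). \<exists>c. heavy i c j}"

lemma flow_less: assumes "(i, j) \<notin> heavy_rel" shows "flow s i j < xtotal s / (2 * K ^ 3)"
proof -
  define \<epsilon> where "\<epsilon> = xtotal s / (4 * K ^ 3)"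
  have \<epsilon>: "0 < \<epsilon>" using xtotal_pos[OF s] K_pos by (simp add: \<epsilon>_def)
  have "\<not> heavy i Lhd j" "\<not> heavy i Prec j" using assms by (auto simp: heavy_rel_def)
  then have "mweight s (p1 i) (p2 j) < \<epsilon>" "(if p1 i = p2 j then xfrac s (p1 i) else 0) < \<epsilon>"
    using \<epsilon> S_nonneg[of "p1 i" "p2 j"] by (auto simp: heavy_def \<epsilon>_def[symmetric] mweight_def)
  then have "flow s i j < \<epsilon> + \<epsilon>" unfolding flow_def by (rule add_strict_mono)
  then show ?thesis by (simp add: \<epsilon>_def)
qed

text \<open>Let \<open>A\<close> be the set reachable from the head of the \<open>Prec\<close> edge
  with the largest \<open>x\<close>. If the tail lay outside, that edge would bring at least
  \<open>X / K\<close> into \<open>A\<close>, while only light edges lead out; the cut balance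
  forbids this.\<close>

lemma heavy_cycle:
  obtains i0 j0 where "heavy i0 Prec j0" "(j0, i0) \<in> heavy_rel\<^sup>*"
proof -
  have "Max (range (xfrac s)) \<in> range (xfrac s)" by (intro Max_in) auto
  then obtain k where k: "Max (range (xfrac s)) = xfrac s k" by (rule rangeE)
  have "xfrac s i \<le> xfrac s k" for i unfolding k[symmetric] by (intro Max_ge) auto
  then have "xtotal s \<le> (\<Sum>i\<in>(UNIV :: 'n set). xfrac s k)" unfolding xtotal_def by (intro sum_mono)
  then have XK: "xtotal s \<le> K * xfrac s k" by (simp add: K_def)
  obtain i0 where i0: "p1 i0 = k" using ex1_p1[of k] by auto
  obtain j0 where j0: "p2 j0 = k" using ex1_p2[of k] by auto
  have K3: "K \<le> K ^ 3" using K_pos power_increasing[of 1 3 K] by simp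
  have "K * xfrac s k \<le> (4 * K ^ 3) * xfrac s k"
    using K3 K_pos xfrac_pos[OF s, of k] by (intro mult_right_mono) auto
  then have "xtotal s / (4 * K ^ 3) \<le> xfrac s k"
    using XK K_pos by (simp add: divide_le_eq mult.commute)
  then have h: "heavy i0 Prec j0" using i0 j0 by (simp add: heavy_def)
  have "(j0, i0) \<in> heavy_rel\<^sup>*"
  proof (rule ccontr)
    assume no: "(j0, i0) \<notin> heavy_rel\<^sup>*"
    define A where "A = {i. (j0, i) \<in> heavy_rel\<^sup>*}"
    have A: "j0 \<in> A" "i0 \<notin> A" using no by (auto simp: A_def)
    have "xfrac s k \<le> flow s i0 j0" using mweight_nonneg[OF s] i0 j0 by (simp add: flow_def)
    also have "\<dots> \<le> (\<Sum>j\<in>A. flow s i0 j)" using A flow_nonneg by (intro member_le_sum) auto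
    also have "\<dots> \<le> (\<Sum>i\<in>-A. \<Sum>j\<in>A. flow s i j)"
      using A flow_nonneg by (intro member_le_sum[of i0 "-A" "\<lambda>i. \<Sum>j\<in>A. flow s i j"]) (auto simp: sum_nonneg)
    also have "\<dots> = (\<Sum>i\<in>A. \<Sum>j\<in>-A. flow s i j)" by (rule circulation_cut[symmetric]) (rule flow_rows flow_cols)+
    also have "\<dots> \<le> (\<Sum>i\<in>A. \<Sum>j\<in>-A. xtotal s / (2 * K ^ 3))"
    proof (intro sum_mono less_imp_le flow_less)
      fix i j assume "i \<in> A" "j \<in> -A"
      then show "(i, j) \<notin> heavy_rel" by (auto simp: A_def intro: rtrancl_into_rtrancl)
    qed
    also have "\<dots> \<le> (\<Sum>i\<in>A. \<Sum>j\<in>(UNIV :: 'n set). xtotal s / (2 * K ^ 3))"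
      using xtotal_pos[OF s] K_pos by (intro sum_mono sum_mono2) auto
    also have "\<dots> \<le> (\<Sum>i\<in>(UNIV :: 'n set). \<Sum>j\<in>(UNIV :: 'n set). xtotal s / (2 * K ^ 3))"
      using xtotal_pos[OF s] K_pos by (intro sum_mono2) (auto intro!: sum_nonneg)
    also have "\<dots> = xtotal s / (2 * K)" using K_pos by (simp add: K_def power3_eq_cube)
    finally have "xfrac s k \<le> xtotal s / (2 * K)" .
    then have "2 * (K * xfrac s k) \<le> xtotal s" using K_pos by (simp add: field_simps)
    then show False using XK xtotal_pos[OF s] by linarith
  qed
  with h show thesis by (rule that)
qed

text \<open>The threshold contributes \<open>ln (4 * K ^ 3)\<close>, the entries of \<open>S\<close>
  contribute \<open>2 * C_k\<close>, and 1 bounds \<open>- ln (1 - x)\<close>.\<close>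

definition C4 :: real where "C4 = ln (4 * K ^ 3) + 2 * C_k + 1"

lemma heavy_\<beta>:
  assumes "heavy i c j"
  shows "ln (xtotal s) - C4 \<le> \<beta> s j - \<beta> s i + (if c = Prec then s else 0)"
proof -
  have xtotal: "ln (xtotal s) - ln (4 * K ^ 3) = ln (xtotal s / (4 * K ^ 3))"
    using xtotal_pos[OF s] K_pos by (simp add: ln_divide_pos)
  have \<epsilon>: "0 < xtotal s / (4 * K ^ 3)" using xtotal_pos[OF s] K_pos by simp
  show ?thesis
  proof (cases c)
    case Lhd
    then have h: "0 < S $ p1 i $ p2 j" "xtotal s / (4 * K ^ 3) \<le> mweight s (p1 i) (p2 j)"
      using assms by (auto simp: heavy_def)
    have "ln (xtotal s / (4 * K ^ 3)) \<le> ln (mweight s (p1 i) (p2 j))"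
      using h(2) \<epsilon> by (intro ln_mono) auto
    then show ?thesis
      using xtotal mweight_edge[OF s h(1)] log_diag_bounds[OF s, of i] log_entry_le[of i j] log_entry_le[of i i] Lhd by (simp add: C4_def)
  next
    case Prec
    then have h: "p1 i = p2 j" "xtotal s / (4 * K ^ 3) \<le> xfrac s (p1 i)"
      using assms by (auto simp: heavy_def)
    have "ln (xtotal s / (4 * K ^ 3)) \<le> ln (xfrac s (p1 i))"
      using h(2) \<epsilon> by (intro ln_mono) auto
    then have "ln (xtotal s / (4 * K ^ 3)) - 1 \<le> log_logistic (xfrac s (p1 i))"
      using ln_1_minus_ge[OF s, of "p1 i"] by (simp add: log_logistic_def)
    then show ?thesis
      using xtotal xfrac_edge[OF s h(1)] log_diag_bounds[OF s, of i] log_entry_le[of i i] C_k_nonneg Prec by (simp add: C4_def)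
  qed
qed

end

section \<open>Closed walks and the size of X\<close>

definition G :: "(nat, labeled_edge) pre_digraph" where
  "G = \<lparr>verts = range b,
     arcs = {(b i, Lhd, b j) | i j. 0 < S $ p1 i $ p2 j \<and> b i \<noteq> b j} \<union> {(b i, Prec, b j) | i j. p1 i = p2 j},
     tail = (\<lambda>(l, c, k). l), head = (\<lambda>(l, c, k). k)\<rparr>"

definition C3 :: real where "C3 = C1 + 2 * C2"

text \<open>Every arc has weight at most X: for \<open>Lhd\<close> this is the bound between
  different blocks, for \<open>Prec\<close> it is \<open>xfrac_le_xtotal\<close>. Passing from
  indices to blocks costs \<open>2 * C2\<close>.\<close>

lemma arc_block_pot_le:
  assumes s: "s < smax" and e: "(l, c, k) \<in> arcs G"
  shows "block_pot s k - block_pot s l + (if c = Prec then s else 0) \<le> ln (xtotal s) + C3"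
proof -
  obtain i j where ij: "l = b i" "k = b j"
    "(c = Lhd \<and> 0 < S $ p1 i $ p2 j \<and> b i \<noteq> b j) \<or> (c = Prec \<and> p1 i = p2 j)"
    using e unfolding G_def by auto
  have "\<beta> s j - \<beta> s i + (if c = Prec then s else 0) \<le> ln (xtotal s) + C1"
    using ij(3)
  proof
    assume h: "c = Lhd \<and> 0 < S $ p1 i $ p2 j \<and> b i \<noteq> b j"
    then have "b i < b j" using tri[of i j] by auto
    then have "ln (mweight s (p1 i) (p2 j)) \<le> ln (xtotal s)"
      using mweight_interblock_le[OF s] mweight_pos[OF s] h by (intro ln_mono) auto
    then show ?thesis using \<beta>_edge_le[OF s, of i j] h by simp
  next
    assume h: "c = Prec \<and> p1 i = p2 j"
    have "ln (xfrac s (p1 i)) \<le> ln (xtotal s)" using xfrac_pos[OF s] xfrac_le_xtotal[OF s] by (intro ln_mono) auto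
    moreover have "ln (1 - xfrac s (p1 i)) \<le> 0"
      using xfrac_pos[OF s, of "p1 i"] xfrac_less_1[OF s, of "p1 i"] by (simp add: ln_le_zero_iff)
    ultimately have "log_logistic (xfrac s (p1 i)) \<le> ln (xtotal s)" by (simp add: log_logistic_def)
    then show ?thesis
      using xfrac_edge[OF s, of i j] h log_diag_bounds[OF s, of i] log_entry_le[of i i] C_k_nonneg by (simp add: C1_def)
  qed
  then show ?thesis using block_pot_diff[OF s, of i] block_pot_diff[OF s, of j] by (simp add: ij C3_def)
qed

lemma cas_block_pot_le:
  assumes s: "s < smax" and "set \<gamma> \<subseteq> arcs G" "pre_digraph.cas G u \<gamma> v"
  shows "block_pot s v - block_pot s u + real (prec_count \<gamma>) * s \<le> real (length \<gamma>) * (ln (xtotal s) + C3)"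
  using assms(2,3)
proof (induction \<gamma> arbitrary: u)
  case Nil
  then show ?case by (simp add: pre_digraph.cas.simps prec_count_def)
next
  case (Cons e \<gamma>)
  obtain l c k where e: "e = (l, c, k)" by (cases e)
  have u: "l = u" and cas: "pre_digraph.cas G k \<gamma> v"
    using Cons.prems by (auto simp: pre_digraph.cas.simps e G_def)
  have "block_pot s v - block_pot s k + real (prec_count \<gamma>) * s \<le> real (length \<gamma>) * (ln (xtotal s) + C3)"
    using Cons.IH[OF _ cas] Cons.prems by simp
  moreover have "block_pot s k - block_pot s l + (if c = Prec then s else 0) \<le> ln (xtotal s) + C3"
    using arc_block_pot_le[OF s, of l c k] Cons.prems e by simp
  ultimately show ?case using u by (auto simp: e prec_count_def distrib_right split: if_splits)
qed

text \<open>Around a closed walk the potential differences cancel. The constant is lost once per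
  edge and then divided by the length, so it does not depend on the walk.\<close>

lemma ln_xtotal_ge:
  assumes s: "s < smax" and \<gamma>: "closed_walk G \<gamma>"
  shows "real (prec_count \<gamma>) / real (length \<gamma>) * s - C3 \<le> ln (xtotal s)"
proof -
  obtain u where "pre_digraph.awalk G u \<gamma> u" and ne: "\<gamma> \<noteq> []" using \<gamma> by (auto simp: closed_walk_def)
  then have "real (prec_count \<gamma>) * s \<le> real (length \<gamma>) * (ln (xtotal s) + C3)"
    using cas_block_pot_le[OF s, of \<gamma> u u] by (simp add: pre_digraph.awalk_def)
  moreover have "0 < real (length \<gamma>)" using ne by simp
  ultimately show ?thesis by (simp add: field_simps)
qed

definition C5 :: real where "C5 = C4 + 2 * C2"

text \<open>A heavy path is projected to the graph on blocks. A step along a positive entry inside a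
  block is no arc, but it leaves \<open>block_pot\<close> unchanged and is dropped; this is why the
  length is only bounded by \<open>n\<close>.\<close>

lemma heavy_relpow_walk:
  assumes s: "s < smax" and "(i, j) \<in> heavy_rel s ^^ n"
  shows "\<exists>\<gamma>. set \<gamma> \<subseteq> arcs G \<and> pre_digraph.cas G (b i) \<gamma> (b j) \<and> length \<gamma> \<le> n \<and>
    real (length \<gamma>) * (ln (xtotal s) - C5) \<le> block_pot s (b j) - block_pot s (b i) + real (prec_count \<gamma>) * s"
  using assms(2)
proof (induction n arbitrary: j)
  case 0
  then show ?case by (intro exI[of _ "[]"]) (simp add: pre_digraph.cas.simps prec_count_def)
next
  case (Suc n)
  then obtain k where k: "(i, k) \<in> heavy_rel s ^^ n" "(k, j) \<in> heavy_rel s" by auto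
  obtain \<gamma> where \<gamma>: "set \<gamma> \<subseteq> arcs G" "pre_digraph.cas G (b i) \<gamma> (b k)" "length \<gamma> \<le> n"
    "real (length \<gamma>) * (ln (xtotal s) - C5) \<le> block_pot s (b k) - block_pot s (b i) + real (prec_count \<gamma>) * s"
    using Suc.IH[OF k(1)] by auto
  obtain c where c: "heavy s k c j" using k(2) by (auto simp: heavy_rel_def[OF s])
  show ?case
  proof (cases "c = Lhd \<and> b k = b j")
    case True
    then show ?thesis using \<gamma> by (intro exI[of _ \<gamma>]) auto
  next
    case False
    have arc: "(b k, c, b j) \<in> arcs G"
    proof (cases c)
      case Lhd
      then show ?thesis using False c by (auto simp: G_def heavy_def[OF s])
    next
      case Prec
      then show ?thesis using c by (auto simp: G_def heavy_def[OF s])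
    qed
    have "ln (xtotal s) - C5 \<le> block_pot s (b j) - block_pot s (b k) + (if c = Prec then s else 0)"
      using heavy_\<beta>[OF s c] block_pot_diff[OF s, of k] block_pot_diff[OF s, of j] unfolding C5_def by linarith
    then have "real (length (\<gamma> @ [(b k, c, b j)])) * (ln (xtotal s) - C5)
      \<le> block_pot s (b j) - block_pot s (b i) + real (prec_count (\<gamma> @ [(b k, c, b j)])) * s"
      using \<gamma>(4) by (auto simp: prec_count_def distrib_right)
    moreover have "pre_digraph.cas G (b i) (\<gamma> @ [(b k, c, b j)]) (b j)"
      by (rule cas_snoc[OF \<gamma>(2)]) (simp_all add: G_def)
    ultimately show ?thesis using \<gamma> arc by (intro exI[of _ "\<gamma> @ [(b k, c, b j)]"]) auto
  qed
qed


text \<open>\<open>relpow_length_bound\<close> for the heavy path, plus the \<open>Prec\<close> edge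
  that closes it.\<close>

definition maxlen :: nat where "maxlen = CARD('n) * CARD('n) + 1"

text \<open>The heavy path may project to an empty walk; prepending the heavy \<open>Prec\<close>
  arc closes it and makes it non-empty.\<close>

lemma heavy_closed_walk:
  assumes s: "s < smax"
  shows "\<exists>\<gamma>. closed_walk G \<gamma> \<and> length \<gamma> \<le> maxlen \<and>
    ln (xtotal s) \<le> real (prec_count \<gamma>) / real (length \<gamma>) * s + C5"
proof -
  obtain i0 j0 where h: "heavy s i0 Prec j0" "(j0, i0) \<in> (heavy_rel s)\<^sup>*" by (rule heavy_cycle[OF s])
  obtain n where n: "n \<le> CARD('n) * CARD('n)" "(j0, i0) \<in> heavy_rel s ^^ n"
    using relpow_length_bound[OF h(2)] by auto
  obtain \<gamma> where \<gamma>: "set \<gamma> \<subseteq> arcs G" "pre_digraph.cas G (b j0) \<gamma> (b i0)" "length \<gamma> \<le> n"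
    "real (length \<gamma>) * (ln (xtotal s) - C5) \<le> block_pot s (b i0) - block_pot s (b j0) + real (prec_count \<gamma>) * s"
    using heavy_relpow_walk[OF s n(2)] by auto
  define \<delta> where "\<delta> = (b i0, Prec, b j0) # \<gamma>"
  have arc: "(b i0, Prec, b j0) \<in> arcs G" using h(1) by (auto simp: G_def heavy_def[OF s])
  have "pre_digraph.awalk G (b i0) \<delta> (b i0)"
    using \<gamma> arc by (simp add: pre_digraph.awalk_def \<delta>_def pre_digraph.cas.simps) (simp add: G_def)
  then have "closed_walk G \<delta>" unfolding closed_walk_def \<delta>_def by auto
  moreover have "length \<delta> \<le> maxlen" using \<gamma>(3) n(1) by (simp add: \<delta>_def maxlen_def)
  moreover have "ln (xtotal s) \<le> real (prec_count \<delta>) / real (length \<delta>) * s + C5"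
  proof -
    have "ln (xtotal s) - C5 \<le> block_pot s (b j0) - block_pot s (b i0) + s"
      using heavy_\<beta>[OF s h(1)] block_pot_diff[OF s, of i0] block_pot_diff[OF s, of j0] by (simp add: C5_def)
    then have "real (length \<delta>) * (ln (xtotal s) - C5) \<le> real (prec_count \<delta>) * s"
      using \<gamma>(4) by (simp add: \<delta>_def prec_count_def distrib_right)
    moreover have "0 < real (length \<delta>)" by (simp add: \<delta>_def)
    ultimately show ?thesis by (simp add: field_simps)
  qed
  ultimately show ?thesis by blast
qed

text \<open>There may be infinitely many closed walks, so the minimum is taken over those ratios
  that are fractions with numerator and denominator at most \<open>maxlen\<close>. Its minimality
  among all ratios is read off from the two bounds on X as \<open>s\<close> tends to minus infinity,
  without decomposing walks into simple cycles.\<close>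

lemma exists_kappa:
  "\<exists>\<kappa> C. \<kappa> \<in> cycle_ratios G \<and> (\<forall>r\<in>cycle_ratios G. \<kappa> \<le> r) \<and> 0 < \<kappa> \<and> \<kappa> \<le> 1 \<and>
     (\<forall>s<smax. \<bar>ln (xtotal s) - \<kappa> * s\<bar> \<le> C)"
proof -
  define RR where "RR = cycle_ratios G \<inter> (\<lambda>(p, q). real p / real q) ` ({..maxlen} \<times> {..maxlen})"
  have "finite RR" by (simp add: RR_def)
  have pl: "prec_count \<gamma> \<le> length \<gamma>" for \<gamma> by (simp add: prec_count_def)
  have RRI: "real (prec_count \<gamma>) / real (length \<gamma>) \<in> RR" if "closed_walk G \<gamma>" "length \<gamma> \<le> maxlen" for \<gamma>
  proof -
    have "real (prec_count \<gamma>) / real (length \<gamma>) \<in> cycle_ratios G" using that(1) by (auto simp: cycle_ratios_def)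
    moreover have "(prec_count \<gamma>, length \<gamma>) \<in> {..maxlen} \<times> {..maxlen}" using that(2) pl[of \<gamma>] by auto
    then have "real (prec_count \<gamma>) / real (length \<gamma>) \<in> (\<lambda>(p, q). real p / real q) ` ({..maxlen} \<times> {..maxlen})"
      by (rule rev_image_eqI) simp
    ultimately show ?thesis by (simp add: RR_def)
  qed
  obtain \<gamma>0 where "closed_walk G \<gamma>0" "length \<gamma>0 \<le> maxlen"
    using heavy_closed_walk[of "smax - 1"] by auto
  then have "RR \<noteq> {}" using RRI by blast
  define \<kappa> where "\<kappa> = Min RR"
  have \<kappa>: "\<kappa> \<in> cycle_ratios G"
    using Min_in[OF \<open>finite RR\<close> \<open>RR \<noteq> {}\<close>] by (simp add: \<kappa>_def RR_def)
  have lower: "r * s - C3 \<le> ln (xtotal s)" if "r \<in> cycle_ratios G" "s < smax" for r s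
    using that ln_xtotal_ge by (auto simp: cycle_ratios_def)
  have upper: "ln (xtotal s) \<le> \<kappa> * s + C5" if s: "s < smax" for s
  proof -
    obtain \<gamma> where \<gamma>: "closed_walk G \<gamma>" "length \<gamma> \<le> maxlen"
      "ln (xtotal s) \<le> real (prec_count \<gamma>) / real (length \<gamma>) * s + C5"
      using heavy_closed_walk[OF s] by auto
    have "\<kappa> \<le> real (prec_count \<gamma>) / real (length \<gamma>)"
      unfolding \<kappa>_def using RRI[OF \<gamma>(1,2)] \<open>finite RR\<close> by (rule Min_le[rotated])
    moreover have "s \<le> 0" using exp_le_1[OF s] by simp
    ultimately have "real (prec_count \<gamma>) / real (length \<gamma>) * s \<le> \<kappa> * s" by (rule mult_right_mono_neg)
    then show ?thesis using \<gamma>(3) by linarith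
  qed
  have min: "\<kappa> \<le> r" if r: "r \<in> cycle_ratios G" for r
  proof (rule ccontr)
    assume "\<not> \<kappa> \<le> r"
    then have d: "0 < \<kappa> - r" by simp
    \<comment> \<open>Here \<open>r * s\<close> exceeds \<open>\<kappa> * s\<close> by at least
      \<open>C3 + C5 + 1\<close>, more than \<open>lower\<close> and \<open>upper\<close>
      allow.\<close>
    define s where "s = min (smax - 1) (- (C3 + C5 + 1) / (\<kappa> - r))"
    have s: "s < smax" by (simp add: s_def)
    have "s \<le> - (C3 + C5 + 1) / (\<kappa> - r)" by (simp add: s_def)
    then have "s * (\<kappa> - r) \<le> - (C3 + C5 + 1)" using d by (simp add: pos_le_divide_eq)
    then show False using lower[OF r s] upper[OF s] by (simp add: algebra_simps)
  qed
  have pos: "0 < \<kappa>"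
  proof (rule ccontr)
    assume "\<not> 0 < \<kappa>"
    moreover have "0 \<le> \<kappa>" using \<kappa> by (auto simp: cycle_ratios_def)
    ultimately have "\<kappa> = 0" by simp
    \<comment> \<open>With \<open>\<kappa> = 0\<close>, X would stay above
      \<open>exp (- C3)\<close>, which \<open>xtotal_bound\<close> refutes once
      \<open>- s \<ge> (C_x + 1) * exp C3\<close>.\<close>
    define s where "s = min (smax - 1) (- ((C_x + 1) * exp C3))"
    have s: "s < smax" by (simp add: s_def)
    have "- C3 \<le> ln (xtotal s)" using lower[OF \<kappa> s] \<open>\<kappa> = 0\<close> by simp
    then have "exp (- C3) \<le> xtotal s" using xtotal_pos[OF s] by (simp add: ln_ge_iff)
    moreover have "(C_x + 1) * exp C3 \<le> - s" by (simp add: s_def)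
    ultimately have "exp (- C3) * ((C_x + 1) * exp C3) \<le> xtotal s * - s"
      using C_x_pos xtotal_pos[OF s] by (intro mult_mono) auto
    moreover have "exp (- C3) * ((C_x + 1) * exp C3) = C_x + 1"
      by (simp add: exp_minus)
    ultimately show False using xtotal_bound[OF s] by linarith
  qed
  have le1: "\<kappa> \<le> 1"
  proof -
    obtain \<gamma> where "\<kappa> = real (prec_count \<gamma>) / real (length \<gamma>)" using \<kappa> by (auto simp: cycle_ratios_def)
    then show ?thesis using pl[of \<gamma>] by (simp add: divide_le_eq)
  qed
  have "\<bar>ln (xtotal s) - \<kappa> * s\<bar> \<le> \<bar>C3\<bar> + \<bar>C5\<bar>" if "s < smax" for s
    using lower[OF \<kappa> that] upper[OF that] by linarith
  then show ?thesis using \<kappa> min pos le1 by blast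
qed

section \<open>Lower bound for the derivative of X\<close>

text \<open>The first argument of \<open>min\<close> puts the heavy edges among those of weight at
  least \<open>c0 * X\<close>, the second does so for the diagonal edges, since
  \<open>X \<le> 1\<close>.\<close>

definition c0 :: real where "c0 = min (1 / (4 * K ^ 3)) (exp (- C_d))"
definition N0 :: real where "N0 = K * K + 1"

lemma c0_pos: "0 < c0" using K_pos by (simp add: c0_def)
lemma N0_pos: "0 < N0" using K_pos by (simp add: N0_def add_pos_pos)

text \<open>Along a heavy closed walk the logarithmic increments telescope to the increment of \<open>s\<close> times
  the number of its \<open>Prec\<close> edges, so one of its edges must move at a comparable rate.\<close>

lemma exists_moving_edge:
  assumes a: "a < smax" and s: "s < smax" and "a < s"
  shows "\<exists>e\<in>S_edges. c0 * xtotal a \<le> edge_weight a e \<and> (s - a) / (4 * N0) \<le> \<bar>edge_log e (edge_weight s e) - edge_log e (edge_weight a e)\<bar>"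
proof (rule ccontr)
  define h where "h = (s - a) / (4 * N0)"
  have h: "0 < h" using assms(3) N0_pos by (simp add: h_def)
  assume "\<not> ?thesis"
  then have no: "\<bar>edge_log e (edge_weight s e) - edge_log e (edge_weight a e)\<bar> < h" if "e \<in> S_edges" "c0 * xtotal a \<le> edge_weight a e" for e
    using that by (force simp: h_def not_le)
  have "c0 * xtotal a \<le> 1 / (4 * K ^ 3) * xtotal a" using xtotal_pos[OF a] by (intro mult_right_mono) (auto simp: c0_def)
  then have c0: "c0 * xtotal a \<le> xtotal a / (4 * K ^ 3)" by simp
  have log_diag: "\<bar>log_diag s i - log_diag a i\<bar> < h" for i
  proof -
    have "c0 * xtotal a \<le> exp (- C_d) * 1"
      using xtotal_le[OF a] xtotal_pos[OF a] by (intro mult_mono) (auto simp: c0_def)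
    also have "\<dots> \<le> mweight a (p1 i) (p2 i)"
      using log_diag_bounds(1)[OF a, of i] mweight_pos[OF a diag] by (simp add: log_diag_def ln_ge_iff)
    finally show ?thesis using no[of "Inl (p1 i, p2 i)"] Inl_S_edges[OF diag] by (simp add: edge_weight_def edge_log_def log_diag_def)
  qed
  define g where "g i = \<beta> s i - \<beta> a i" for i
  \<comment> \<open>Two edges are involved in each step, the edge itself and the diagonal edge at
    its tail, hence \<open>2 * h\<close>.\<close>
  have step: "g j - g i \<le> 2 * h - (if c = Prec then s - a else 0)" if hv: "heavy a i c j" for i c j
  proof (cases c)
    case Lhd
    then have e: "0 < S $ p1 i $ p2 j" "c0 * xtotal a \<le> mweight a (p1 i) (p2 j)"
      using hv c0 by (auto simp: heavy_def[OF a])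
    then have "\<bar>ln (mweight s (p1 i) (p2 j)) - ln (mweight a (p1 i) (p2 j))\<bar> < h"
      using no[of "Inl (p1 i, p2 j)"] Inl_S_edges by (simp add: edge_weight_def edge_log_def)
    then show ?thesis using mweight_edge[OF a e(1)] mweight_edge[OF s e(1)] log_diag[of i] Lhd by (simp add: g_def)
  next
    case Prec
    then have e: "p1 i = p2 j" "c0 * xtotal a \<le> xfrac a (p1 i)"
      using hv c0 by (auto simp: heavy_def[OF a])
    then have "\<bar>log_logistic (xfrac s (p1 i)) - log_logistic (xfrac a (p1 i))\<bar> < h"
      using no[of "Inr (p1 i)"] Inr_S_edges by (simp add: edge_weight_def edge_log_def)
    then show ?thesis using xfrac_edge[OF a e(1)] xfrac_edge[OF s e(1)] log_diag[of i] Prec by (simp add: g_def)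
  qed
  obtain i0 j0 where hc: "heavy a i0 Prec j0" "(j0, i0) \<in> (heavy_rel a)\<^sup>*" by (rule heavy_cycle[OF a])
  obtain n where n: "n \<le> CARD('n) * CARD('n)" "(j0, i0) \<in> heavy_rel a ^^ n"
    using relpow_length_bound[OF hc(2)] by auto
  have "g i0 - g j0 \<le> real n * (2 * h)"
  proof (rule relpow_potential_le[OF n(2)])
    fix x y assume "(x, y) \<in> heavy_rel a"
    then obtain c where "heavy a x c y" by (auto simp: heavy_rel_def[OF a])
    then show "g y - g x \<le> 2 * h" using step[of x c y] assms(3) by (auto split: if_splits)
  qed
  also have "\<dots> \<le> (K * K) * (2 * h)"
    using n(1) h unfolding K_def by (intro mult_right_mono) (simp_all flip: of_nat_mult)
  finally have "g i0 - g j0 \<le> (K * K) * (2 * h)" .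
  moreover have "g j0 - g i0 \<le> 2 * h - (s - a)" using step[OF hc(1)] by simp
  ultimately have "s - a \<le> N0 * (2 * h)" by (simp add: N0_def algebra_simps)
  also have "\<dots> = (s - a) / 2" using N0_pos by (simp add: h_def)
  finally show False using assms(3) by simp
qed

text \<open>Energy of the moving edge: near \<open>a\<close> its weight stays above half of
  \<open>c0 * X\<close> by continuity, and its logarithm moves by at least
  \<open>(s - a) / (4 * N0)\<close>. Dividing by \<open>(s - a)\<^sup>2\<close> leaves the factor
  \<open>1 / (2 * 16 * N0\<^sup>2)\<close>.\<close>

lemma deriv_xtotal_ge:
  assumes a: "a < smax" shows "c0 / (32 * N0\<^sup>2) * xtotal a \<le> deriv xtotal a"
proof -
  have "((\<lambda>s. (xtotal s - xtotal a) / (s - a)) \<longlongrightarrow> deriv xtotal a) (at_right a)"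
    using has_field_derivative_at_within[OF xtotal_differentiable[OF a]] by (simp add: has_field_derivative_iff)
  moreover have "eventually (\<lambda>s. c0 / (32 * N0\<^sup>2) * xtotal a \<le> (xtotal s - xtotal a) / (s - a)) (at_right a)"
  proof -
    have "eventually (\<lambda>s. \<forall>e\<in>S_edges. edge_weight a e / 2 < edge_weight s e) (at_right a)"
    proof (rule eventually_ball_finite)
      show "finite S_edges" by (simp add: S_edges_def)
      show "\<forall>e\<in>S_edges. eventually (\<lambda>s. edge_weight a e / 2 < edge_weight s e) (at_right a)"
      proof
        fix e assume e: "e \<in> S_edges"
        have "0 < edge_weight a e" using e mweight_pos[OF a] xfrac_pos[OF a] by (auto simp: S_edges_def edge_weight_def)
        then have lt: "edge_weight a e / 2 < edge_weight a e" by simp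
        obtain D where "((\<lambda>s. edge_weight s e) has_field_derivative D) (at a)" using edge_weight_differentiable[OF e a] by blast
        then have "((\<lambda>s. edge_weight s e) \<longlongrightarrow> edge_weight a e) (at a)" using DERIV_isCont isCont_def by blast
        then have "((\<lambda>s. edge_weight s e) \<longlongrightarrow> edge_weight a e) (at_right a)" by (rule tendsto_mono[rotated]) (simp add: at_le)
        then show "eventually (\<lambda>s. edge_weight a e / 2 < edge_weight s e) (at_right a)" using lt by (rule order_tendstoD)
      qed
    qed
    moreover have "eventually (\<lambda>s. s \<in> {a<..<smax}) (at_right a)" using a by (rule eventually_at_right_real)
    ultimately show ?thesis
    proof eventually_elim
      case (elim s)
      then have s: "s < smax" "a < s" by auto
      obtain e where e: "e \<in> S_edges" "c0 * xtotal a \<le> edge_weight a e" "(s - a) / (4 * N0) \<le> \<bar>edge_log e (edge_weight s e) - edge_log e (edge_weight a e)\<bar>"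
        using exists_moving_edge[OF a s] by auto
      have "((s - a) / (4 * N0))\<^sup>2 \<le> (edge_log e (edge_weight s e) - edge_log e (edge_weight a e))\<^sup>2"
        using e(3) s N0_pos by (subst power2_abs[of "edge_log e (edge_weight s e) - edge_log e (edge_weight a e)", symmetric], intro power_mono) auto
      moreover have "c0 * xtotal a / 2 \<le> min (edge_weight a e) (edge_weight s e)"
        using bspec[OF elim(1) e(1)] e(2) mult_pos_pos[OF c0_pos xtotal_pos[OF a]] by simp
      moreover have "0 \<le> c0 * xtotal a / 2" using c0_pos xtotal_pos[OF a] by simp
      ultimately have "c0 * xtotal a / 2 * ((s - a) / (4 * N0))\<^sup>2 \<le> min (edge_weight a e) (edge_weight s e) * (edge_log e (edge_weight s e) - edge_log e (edge_weight a e))\<^sup>2"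
        by (intro mult_mono) (auto intro: order_trans)
      also have "\<dots> \<le> (s - a) * (xtotal s - xtotal a)" by (rule energy_term_le[OF e(1) s(1) a])
      finally have *: "c0 * xtotal a / 2 * ((s - a) / (4 * N0))\<^sup>2 \<le> (s - a) * (xtotal s - xtotal a)" .
      have "c0 / (32 * N0\<^sup>2) * xtotal a * (s - a)\<^sup>2 = c0 * xtotal a / 2 * ((s - a) / (4 * N0))\<^sup>2"
        by (simp add: power_divide power_mult_distrib)
      with * have "(s - a) * (c0 / (32 * N0\<^sup>2) * xtotal a * (s - a)) \<le> (s - a) * (xtotal s - xtotal a)"
        by (simp only: power2_eq_square mult_ac)
      then have "c0 / (32 * N0\<^sup>2) * xtotal a * (s - a) \<le> xtotal s - xtotal a"
        using s(2) by (simp only: mult_le_cancel_left_pos diff_gt_0_iff_gt)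
      then show ?case using s(2) by (simp only: pos_le_divide_eq diff_gt_0_iff_gt)
    qed
  qed
  ultimately show ?thesis by (rule tendsto_lowerbound) simp
qed

end

section \<open>The density of states\<close>

lemma deriv2_radial:
  fixes F g h :: "real \<Rightarrow> real"
  assumes F: "\<And>x. 0 < x\<^sup>2 + c \<Longrightarrow> x\<^sup>2 + c < R \<Longrightarrow> F x = g (x\<^sup>2 + c)"
    and g: "\<And>t. 0 < t \<Longrightarrow> t < R \<Longrightarrow> (g has_field_derivative h t) (at t)"
    and h: "(h has_field_derivative h') (at (x\<^sup>2 + c))"
    and x: "0 < x\<^sup>2 + c" "x\<^sup>2 + c < R"
  shows "(deriv ^^ 2) F x = 2 * h (x\<^sup>2 + c) + 4 * x\<^sup>2 * h'"
proof -
  define U where "U = {y. 0 < y\<^sup>2 + c} \<inter> {y. y\<^sup>2 + c < R}"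
  have U: "open U" "x \<in> U"
    unfolding U_def using x by (auto intro!: open_Int open_Collect_less continuous_intros)
  have F': "(F has_field_derivative h (y\<^sup>2 + c) * (2 * y)) (at y)" if y: "y \<in> U" for y
  proof (rule has_field_derivative_transform_within_open[OF _ U(1) y])
    have "(g has_field_derivative h (y\<^sup>2 + c)) (at (y\<^sup>2 + c))"
      using y by (intro g) (auto simp: U_def)
    then show "((\<lambda>y. g (y\<^sup>2 + c)) has_field_derivative h (y\<^sup>2 + c) * (2 * y)) (at y)"
      by (rule DERIV_chain2) (auto intro!: derivative_eq_intros)
    show "g (z\<^sup>2 + c) = F z" if "z \<in> U" for z using F[of z] that by (simp add: U_def)
  qed
  have "((\<lambda>y. h (y\<^sup>2 + c)) has_field_derivative h' * (2 * x)) (at x)"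
    by (rule DERIV_chain2[where f = h and g = "\<lambda>y. y\<^sup>2 + c", OF h]) (auto intro!: derivative_eq_intros)
  then have "((\<lambda>y. h (y\<^sup>2 + c) * (2 * y)) has_field_derivative 2 * h (x\<^sup>2 + c) + 4 * x\<^sup>2 * h') (at x)"
    by (auto intro!: derivative_eq_intros simp: power2_eq_square)
  then have "(deriv F has_field_derivative 2 * h (x\<^sup>2 + c) + 4 * x\<^sup>2 * h') (at x)"
    by (rule has_field_derivative_transform_within_open[OF _ U]) (simp add: DERIV_imp_deriv[OF F'])
  then show ?thesis by (simp add: numeral_2_eq_2 DERIV_imp_deriv)
qed

lemma laplacian_radial:
  fixes f :: "complex \<Rightarrow> real" and g h :: "real \<Rightarrow> real"
  assumes f: "\<And>\<zeta>. 0 < (cmod \<zeta>)\<^sup>2 \<Longrightarrow> (cmod \<zeta>)\<^sup>2 < R \<Longrightarrow> f \<zeta> = g ((cmod \<zeta>)\<^sup>2)"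
    and g: "\<And>t. 0 < t \<Longrightarrow> t < R \<Longrightarrow> (g has_field_derivative h t) (at t)"
    and h: "(h has_field_derivative h') (at ((cmod z)\<^sup>2))"
    and z: "z \<noteq> 0" "(cmod z)\<^sup>2 < R"
  shows "laplacian f z = 4 * (h ((cmod z)\<^sup>2) + (cmod z)\<^sup>2 * h')"
proof -
  have sq: "(cmod z)\<^sup>2 = (Re z)\<^sup>2 + (Im z)\<^sup>2" "(cmod z)\<^sup>2 = (Im z)\<^sup>2 + (Re z)\<^sup>2"
    by (simp_all add: cmod_power2)
  have pos: "0 < (cmod z)\<^sup>2" using z by simp
  have f_Complex: "f (Complex a b) = g (a\<^sup>2 + b\<^sup>2)" if "0 < a\<^sup>2 + b\<^sup>2" "a\<^sup>2 + b\<^sup>2 < R" for a b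
    using f[of "Complex a b"] that by (simp only: cmod_power2 complex.sel)
  have "(deriv ^^ 2) (\<lambda>x. f (Complex x (Im z))) (Re z) = 2 * h ((Re z)\<^sup>2 + (Im z)\<^sup>2) + 4 * (Re z)\<^sup>2 * h'"
    by (rule deriv2_radial[OF _ g]) (use f_Complex h pos z(2) in \<open>auto simp: sq(1)\<close>)
  moreover have "(deriv ^^ 2) (\<lambda>y. f (Complex (Re z) y)) (Im z) = 2 * h ((Im z)\<^sup>2 + (Re z)\<^sup>2) + 4 * (Im z)\<^sup>2 * h'"
    by (rule deriv2_radial[OF _ g]) (use f_Complex[of "Re z"] h pos z(2) in \<open>auto simp: sq(2) add.commute\<close>)
  ultimately show ?thesis unfolding laplacian_def sq(1) by (simp add: algebra_simps)
qed

lemma filterlim_cmod_at_right: "filterlim cmod (at_right 0) (at 0)"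
proof -
  have "(cmod \<longlongrightarrow> 0) (at 0)" by (intro tendsto_norm_zero tendsto_ident_at)
  then show ?thesis by (simp add: filterlim_at eventually_at_filter)
qed

context irreducible_support begin

text \<open>In \<open>t = (cmod z)\<^sup>2\<close> the Laplacian is 4 times the derivative of
  \<open>t g'(t)\<close>. Since \<open>t g'(t) = - X / (2 K)\<close>, the terms with X itself cancel
  and one derivative of X remains.\<close>

lemma scdos_eq:
  assumes "z \<noteq> 0" "(cmod z)\<^sup>2 < exp smax"
  shows "scdos S z = deriv xtotal (ln ((cmod z)\<^sup>2)) / (pi * real CARD('n) * (cmod z)\<^sup>2)"
proof -
  define K where "K = real CARD('n)"
  have K: "0 < K" by (simp add: K_def)
  define f where "f \<zeta> = set_lebesgue_integral lborel {0<..}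
       (\<lambda>\<eta>. avg (dyson_v S ((cmod \<zeta>)\<^sup>2) \<eta>) - 1 / (1 + \<eta>))" for \<zeta>
  define g where "g t = 1 / 2 - V0 (ln t) / (2 * K)" for t
  define h where "h t = - (xtotal (ln t) / t) / (2 * K)" for t
  define t where "t = (cmod z)\<^sup>2"
  have t: "0 < t" "ln t < smax" using assms by (auto simp: t_def ln_less_iff)
  have f: "f \<zeta> = g ((cmod \<zeta>)\<^sup>2)" if "0 < (cmod \<zeta>)\<^sup>2" "(cmod \<zeta>)\<^sup>2 < exp smax" for \<zeta>
  proof -
    have l: "ln ((cmod \<zeta>)\<^sup>2) < smax" using that by (simp only: ln_less_iff)
    have "(Val ((cmod \<zeta>)\<^sup>2) \<longlongrightarrow> V0 (ln ((cmod \<zeta>)\<^sup>2))) (at_right 0)"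
      using limit_sol(2)[OF l] that(1) by (simp only: exp_ln)
    then show ?thesis unfolding f_def g_def K_def using that(1) by (intro integral_eq)
  qed
  have g: "(g has_field_derivative h t) (at t)" if "0 < t" "t < exp smax" for t
    unfolding g_def h_def using that V0_ln_DERIV[of t] K
    by (auto intro!: derivative_eq_intros simp: ln_less_iff)
  have "((\<lambda>t. xtotal (ln t)) has_field_derivative deriv xtotal (ln t) * (1 / t)) (at t)"
    using t by (intro DERIV_chain2[OF xtotal_differentiable]) (auto intro!: derivative_eq_intros)
  then have h: "(h has_field_derivative - ((deriv xtotal (ln t) - xtotal (ln t)) / t\<^sup>2) / (2 * K)) (at t)"
    unfolding h_def using t K
    by (auto intro!: derivative_eq_intros simp: power2_eq_square) (simp add: field_simps)
  have "laplacian f z = 4 * (h t + t * (- ((deriv xtotal (ln t) - xtotal (ln t)) / t\<^sup>2) / (2 * K)))"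
    unfolding t_def by (rule laplacian_radial[where R = "exp smax", OF f g h[unfolded t_def] assms])
  also have "\<dots> = - 2 * deriv xtotal (ln t) / (K * t)"
    using t K by (simp add: h_def field_simps power2_eq_square)
  finally show ?thesis
    unfolding scdos_def f_def[symmetric] t_def[symmetric] K_def[symmetric] by simp
qed

end

context block_structure begin

text \<open>Up to a constant \<open>ln \<sigma>\<close> is \<open>ln (dX/ds) - s\<close>, and the
  two bounds on dX/ds allow replacing it by X within a constant factor. As
  \<open>s = 2 ln (cmod z)\<close>, the exponent \<open>\<kappa> - 1\<close> of
  \<open>\<tau>\<close> becomes \<open>- 2 + 2 \<kappa>\<close>.\<close>

lemma scdos_limit:
  assumes C: "\<And>s. s < smax \<Longrightarrow> \<bar>ln (xtotal s) - \<kappa> * s\<bar> \<le> C"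
  shows "((\<lambda>z. ln (scdos S z) / ln (cmod z)) \<longlongrightarrow> - 2 + 2 * \<kappa>) (at 0)"
proof -
  define c where "c = c0 / (32 * N0\<^sup>2)"
  have c: "0 < c" using c0_pos N0_pos by (simp add: c_def)
  define C' where "C' = C + \<bar>ln c\<bar> + \<bar>ln (pi * K)\<bar>"
  have small: "eventually (\<lambda>z::complex. z \<noteq> 0 \<and> (cmod z)\<^sup>2 < exp smax \<and> cmod z < 1) (at 0)"
  proof -
    have "((\<lambda>z::complex. (cmod z)\<^sup>2) \<longlongrightarrow> (cmod 0)\<^sup>2) (at 0)" by (intro tendsto_intros)
    then have "eventually (\<lambda>z::complex. (cmod z)\<^sup>2 < exp smax) (at 0)" by (rule order_tendstoD) simp
    moreover have "((\<lambda>z::complex. cmod z) \<longlongrightarrow> cmod 0) (at 0)" by (intro tendsto_intros)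
    then have "eventually (\<lambda>z::complex. cmod z < 1) (at 0)" by (rule order_tendstoD) simp
    moreover have "eventually (\<lambda>z::complex. z \<noteq> 0) (at 0)" by (simp add: eventually_at_filter)
    ultimately show ?thesis by eventually_elim simp
  qed
  have "eventually (\<lambda>z. norm (ln (scdos S z) / ln (cmod z) - (- 2 + 2 * \<kappa>)) \<le> C' / \<bar>ln (cmod z)\<bar>) (at 0)"
    using small
  proof eventually_elim
    case (elim z)
    define s where "s = ln ((cmod z)\<^sup>2)"
    have r: "0 < cmod z" using elim by simp
    have s: "s < smax" using elim by (simp add: s_def ln_less_iff)
    have s_eq: "s = 2 * ln (cmod z)" using r by (simp add: s_def ln_realpow)
    have D: "c * xtotal s \<le> deriv xtotal s" "deriv xtotal s \<le> xtotal s"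
      using deriv_xtotal_ge[OF s] deriv_xtotal_le[OF s] by (auto simp: c_def)
    have cX: "0 < c * xtotal s" using c xtotal_pos[OF s] by simp
    have Dpos: "0 < deriv xtotal s" using D(1) cX by linarith
    have "ln (c * xtotal s) \<le> ln (deriv xtotal s)" using D(1) cX Dpos by (intro ln_mono) auto
    then have 1: "ln c + ln (xtotal s) \<le> ln (deriv xtotal s)" using c xtotal_pos[OF s] by (simp add: ln_mult_pos)
    have 2: "ln (deriv xtotal s) \<le> ln (xtotal s)" using D(2) Dpos xtotal_pos[OF s] by (intro ln_mono) auto
    have "scdos S z = deriv xtotal s / ((pi * K) * (cmod z)\<^sup>2)"
      using scdos_eq elim by (simp add: s_def K_def)
    then have "ln (scdos S z) = ln (deriv xtotal s) - (ln (pi * K) + ln ((cmod z)\<^sup>2))"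
      using Dpos r K_pos by (simp only: ln_divide_pos ln_mult_pos pi_gt_zero mult_pos_pos zero_less_power less_le_trans[OF zero_less_one K_pos])
    then have 3: "ln (scdos S z) = ln (deriv xtotal s) - ln (pi * K) - s" by (simp add: s_def)
    have 4: "ln (scdos S z) - (- 2 + 2 * \<kappa>) * ln (cmod z) = ln (deriv xtotal s) - ln (pi * K) - \<kappa> * s"
      unfolding 3 s_eq by (simp add: algebra_simps)
    have "\<bar>ln (scdos S z) - (- 2 + 2 * \<kappa>) * ln (cmod z)\<bar> \<le> C'"
      using 1 2 C[OF s] unfolding 4 C'_def by linarith
    moreover have "ln (cmod z) \<noteq> 0" using elim r by simp
    ultimately have "\<bar>ln (scdos S z) - (- 2 + 2 * \<kappa>) * ln (cmod z)\<bar> / \<bar>ln (cmod z)\<bar> \<le> C' / \<bar>ln (cmod z)\<bar>"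
      by (intro divide_right_mono) auto
    moreover have "(ln (scdos S z) - (- 2 + 2 * \<kappa>) * ln (cmod z)) / ln (cmod z) = ln (scdos S z) / ln (cmod z) - (- 2 + 2 * \<kappa>)"
      using \<open>ln (cmod z) \<noteq> 0\<close> by (simp add: diff_divide_distrib)
    ultimately show ?case by (simp only: abs_divide[symmetric] real_norm_def)
  qed
  moreover have "((\<lambda>r. C' / \<bar>ln r\<bar>) \<longlongrightarrow> 0) (at_right (0::real))" by real_asymp
  then have "((\<lambda>z. C' / \<bar>ln (cmod z)\<bar>) \<longlongrightarrow> 0) (at 0)"
    using filterlim_cmod_at_right by (rule filterlim_compose)
  ultimately have "((\<lambda>z. ln (scdos S z) / ln (cmod z) - (- 2 + 2 * \<kappa>)) \<longlongrightarrow> 0) (at 0)"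
    by (rule Lim_null_comparison)
  then show ?thesis by (rule Lim_null[THEN iffD2])
qed

end

section \<open>Translation of the normal form\<close>

text \<open>This turns primitivity of a diagonal block into strong connectivity: a positive entry of
  a power comes from a path of positive entries.\<close>

lemma mat_power_relpow:
  fixes A :: "'n::finite sqmat"
  assumes "\<And>i j. 0 \<le> A $ i $ j" "0 < mat_power A m $ i $ j"
  shows "(i, j) \<in> {(i, j). 0 < A $ i $ j} ^^ m"
  using assms(2)
proof (induction m arbitrary: i)
  case 0
  then show ?case by (simp add: mat_def split: if_splits)
next
  case (Suc m)
  have "(\<Sum>k\<in>UNIV. A $ i $ k * mat_power A m $ k $ j) > 0"
    using Suc.prems by (simp add: matrix_matrix_mult_def)
  then obtain k where k: "0 < A $ i $ k * mat_power A m $ k $ j"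
    using sum_nonpos[of UNIV "\<lambda>k. A $ i $ k * mat_power A m $ k $ j"] by (auto simp: not_le[symmetric])
  then have "0 < A $ i $ k" "0 < mat_power A m $ k $ j"
    using assms(1)[of i k] by (auto simp: zero_less_mult_iff)
  then show ?case using Suc.IH by (intro relpow_Suc_I2[of i k]) auto
qed

lemma permutation_conjugate:
  fixes A :: "'n::finite sqmat"
  shows "((\<chi> i j. if j = p i then 1 else 0) ** A ** transpose (\<chi> i j. if j = q i then 1 else 0)) $ i $ j = A $ p i $ q j"
proof -
  have 1: "((\<chi> i j. if j = p i then 1 else 0) ** A) $ i $ k = A $ p i $ k" for k
  proof -
    have "((\<chi> i j. if j = p i then 1 else 0) ** A) $ i $ k = (\<Sum>l\<in>UNIV. if l = p i then A $ l $ k else 0)"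
      by (simp add: matrix_matrix_mult_def if_distrib[of "\<lambda>x. x * _"] cong: if_cong)
    then show ?thesis by simp
  qed
  have "((\<chi> i j. if j = p i then 1 else 0) ** A ** transpose (\<chi> i j. if j = q i then 1 else 0)) $ i $ j
    = (\<Sum>k\<in>UNIV. A $ p i $ k * (if k = q j then 1 else 0))"
    by (subst matrix_matrix_mult_def) (simp add: 1 transpose_def)
  also have "\<dots> = (\<Sum>k\<in>UNIV. if k = q j then A $ p i $ k else 0)"
    by (intro sum.cong) auto
  finally show ?thesis by simp
qed

theorem theorem2p3:
  fixes S Q1 Q2 :: "'n::{finite,linorder} sqmat"
    and b :: "'n \<Rightarrow> nat" and L :: nat
  assumes "nonneg_matrix S"
    and "irreducible_matrix S"
    and "has_support S"
    and "normal_form S Q1 Q2 L b"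
  shows "\<exists>\<kappa>::real.
     \<kappa> \<in> cycle_ratios (normal_form_graph S Q1 Q2 L b) \<and>
     (\<forall>r \<in> cycle_ratios (normal_form_graph S Q1 Q2 L b). \<kappa> \<le> r) \<and>
     0 < \<kappa> \<and> \<kappa> \<le> 1 \<and>
     ((\<lambda>z. ln (scdos S z) / ln (cmod z)) \<longlongrightarrow> -2 + 2 * \<kappa>) (at 0)"
proof -
  obtain p1 where p1: "p1 permutes UNIV" "Q1 = (\<chi> i j. if j = p1 i then 1 else 0)"
    using assms(4) by (auto simp: normal_form_def permutation_matrix_def)
  obtain p2 where p2: "p2 permutes UNIV" "Q2 = (\<chi> i j. if j = p2 i then 1 else 0)"
    using assms(4) by (auto simp: normal_form_def permutation_matrix_def)
  have S': "(Q1 ** S ** transpose Q2) $ i $ j = S $ p1 i $ p2 j" for i j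
    unfolding p1(2) p2(2) by (rule permutation_conjugate)
  \<comment> \<open>\<open>Q1 Q2\<^sup>t\<close> is treated as the case of the identity matrix in
    \<open>permutation_conjugate\<close>.\<close>
  have Q: "(Q1 ** transpose Q2) $ i $ j = (if p1 i = p2 j then 1 else 0)" for i j
    using permutation_conjugate[of p1 "mat 1" p2 i j] unfolding p1(2) p2(2) matrix_mul_rid
    by (simp add: mat_def)
  have nn: "0 \<le> S $ i $ j" for i j using assms(1) by (simp add: nonneg_matrix_def)
  have rb: "range b = {1..L}"
    using assms(4) by (simp add: normal_form_def block_partition_def)
  then have bL: "b i \<in> {1..L}" for i by blast
  have "block_structure S p1 p2 b"
  proof
    show "nonneg_matrix S" "irreducible_matrix S" "has_support S" by fact+
    show "bij p1" "bij p2" using p1 p2 by (auto intro: permutes_bij)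
    show "0 < S $ p1 i $ p2 i" for i
    proof -
      have "0 < (Q1 ** S ** transpose Q2) $ i $ i" using assms(4) by (simp add: normal_form_def Let_def)
      then show ?thesis by (simp only: S')
    qed
    show "b i \<le> b j" if "0 < S $ p1 i $ p2 j" for i j
    proof (rule ccontr)
      assume "\<not> b i \<le> b j"
      then have "\<not> block_nonzero b (Q1 ** S ** transpose Q2) (b i) (b j)"
        using assms(4) bL[of i] bL[of j] by (simp add: normal_form_def Let_def)
      then show False using that S'[of i j] by (auto simp: block_nonzero_def)
    qed
    show "(i, j) \<in> {(i, j). 0 < S $ p1 i $ p2 j \<and> b i = b j}\<^sup>*" if ij: "b i = b j" for i j
    proof -
      define I where "I = {k. b k = b i}"
      \<comment> \<open>The extension by zero from \<open>primitive_on\<close>; paths of positive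
        entries in it stay inside the block.\<close>
      define A :: "'n sqmat" where
        "A = (\<chi> i j. if i \<in> I \<and> j \<in> I then (Q1 ** S ** transpose Q2) $ i $ j else 0)"
      have A: "A $ i $ j = (if i \<in> I \<and> j \<in> I then S $ p1 i $ p2 j else 0)" for i j
        by (simp add: A_def S')
      have "primitive_on I (Q1 ** S ** transpose Q2)"
        using assms(4) bL[of i] by (simp add: normal_form_def Let_def I_def)
      moreover have "i \<in> I" "j \<in> I" using ij by (auto simp: I_def)
      ultimately obtain m where "0 < mat_power A m $ i $ j"
        unfolding primitive_on_def A_def by blast
      then have "(i, j) \<in> {(i, j). 0 < A $ i $ j} ^^ m"
        using nn by (intro mat_power_relpow) (auto simp: A)
      then have "(i, j) \<in> {(i, j). 0 < A $ i $ j}\<^sup>*" by (rule relpow_imp_rtrancl)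
      moreover have "{(i, j). 0 < A $ i $ j} \<subseteq> {(i, j). 0 < S $ p1 i $ p2 j \<and> b i = b j}"
        by (auto simp: A I_def split: if_splits)
      ultimately show ?thesis using rtrancl_mono by blast
    qed
  qed
  then interpret block_structure S p1 p2 b .
  have pos_iff: "S $ i $ j \<noteq> 0 \<longleftrightarrow> 0 < S $ i $ j" for i j using nn[of i j] by (auto simp: less_le)
  have G_eq: "normal_form_graph S Q1 Q2 L b = G"
  proof -
    have "{(l, Lhd, k) | l k. l \<in> {1..L} \<and> k \<in> {1..L} \<and>
           block_nonzero b (Q1 ** S ** transpose Q2) l k \<and> l \<noteq> k}
      = {(b i, Lhd, b j) | i j. 0 < S $ p1 i $ p2 j \<and> b i \<noteq> b j}"
      unfolding block_nonzero_def S' pos_iff using bL by blast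
    moreover have "{(l, Prec, k) | l k. l \<in> {1..L} \<and> k \<in> {1..L} \<and>
           block_nonzero b (Q1 ** transpose Q2) l k} = {(b i, Prec, b j) | i j. p1 i = p2 j}"
      unfolding block_nonzero_def Q using bL by auto
    ultimately show ?thesis unfolding normal_form_graph_def G_def rb by simp
  qed
  obtain \<kappa> C where "\<kappa> \<in> cycle_ratios G" "\<forall>r\<in>cycle_ratios G. \<kappa> \<le> r" "0 < \<kappa>" "\<kappa> \<le> 1"
    and C: "\<forall>s<smax. \<bar>ln (xtotal s) - \<kappa> * s\<bar> \<le> C"
    using exists_kappa by auto
  moreover have "((\<lambda>z. ln (scdos S z) / ln (cmod z)) \<longlongrightarrow> -2 + 2 * \<kappa>) (at 0)"
    using C by (intro scdos_limit) auto
  ultimately show ?thesis unfolding G_eq by blast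
qed

end
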